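(* Let $h:\mathbb{R}\to\mathbb{R}$ be a real analytic and even Schwartz function whose Fourier transform $\hat h$ decays exponentially fast. Then there exists a constant $\alpha^h\ge 0$ such that for every real analytic, strictly convex and even $Q:\mathbb{R}\to\mathbb{R}$ with $\alpha_Q>\alpha^h$ the measure $\mu=\mu_Q^h$ described in the context exists, and, with $b$ the supremum of the support of $\mu$ and with the product measure $\mathbb{P}:=\bigotimes_{N=1}^\infty P_{N,Q}^h$ on $\prod_{N=1}^\infty\mathbb{R}^N$, $$\mathbb{P}\left(\lim_{N\to\infty}x_{\max}=b\right)=1,$$ where, for each $N$, $x_{\max}$ denotes the largest component of the $N$-th coordinate $x\in\mathbb{R}^N$.
   Context: Fourier transform: $\hat h(t)=(2\pi)^{-1/2}\int_{\mathbb{R}} e^{-its}h(s)\,ds$; exponential decay means $|\hat h(t)|\le Ce^{-c|t|}$ for some $C,c>0$. For twice differentiable convex $Q$ set $\alpha_Q:=\inf_{t\in\mathbb{R}}Q''(t)$. Ensemble: $P_{N,Q}^h$ is the probability measure on $\mathbb{R}^N$ with density $$P_{N,Q}^h(x)=\frac{1}{Z_{N,Q}^h}\prod_{i<j}|x_i-x_j|^2\exp\Big\{-N\sum_{j=1}^NQ(x_j)-\sum_{i<j}h(x_i-x_j)\Big\},$$ $Z_{N,Q}^h$ being the normalizing constant. Its $k$-th correlation measure is its marginal distribution in the first $k$ coordinates. Limiting measure: it is known (Götze–Venker) that, for $\alpha_Q$ larger than a constant depending only on $h$, there is a unique compactly supported probability measure $\mu=\mu_Q^h$ such that for each $k$ the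 $k$-th correlation measure of $P_{N,Q}^h$ converges weakly to $\mu^{\otimes k}$. This $\mu$ is even and is the equilibrium measure for the external field $V(x):=Q(x)+\int h(x-t)\,d\mu(t)$, i.e. the unique Borel probability measure minimizing $\nu\mapsto\iint\log|t-s|^{-1}d\nu(t)d\nu(s)+\int V\,d\nu$. The support of $\mu$ is an interval $[-b,b]$ with $b>0$. *)

theory Defs
  imports "HOL-Probability.Probability"
begin

section \<open>Classes of functions\<close>

definition real_analytic :: "(real \<Rightarrow> real) \<Rightarrow> bool" where
  "real_analytic f \<longleftrightarrow>
     (\<forall>x. \<exists>r>0. \<exists>a. \<forall>y. \<bar>y - x\<bar> < r \<longrightarrow> (\<lambda>n. a n * (y - x) ^ n) sums f y)"

definition even_function :: "(real \<Rightarrow> real) \<Rightarrow> bool" where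
  "even_function f \<longleftrightarrow> (\<forall>x. f (- x) = f x)"

definition schwartz_function :: "(real \<Rightarrow> real) \<Rightarrow> bool" where
  "schwartz_function f \<longleftrightarrow>
     (\<forall>n x. (deriv ^^ n) f differentiable (at x)) \<and>
     (\<forall>m n. bounded (range (\<lambda>x. x ^ m * (deriv ^^ n) f x)))"

definition strictly_convex :: "(real \<Rightarrow> real) \<Rightarrow> bool" where
  "strictly_convex f \<longleftrightarrow>
     (\<forall>x y u. x \<noteq> y \<and> 0 < u \<and> u < 1 \<longrightarrow>
        f ((1 - u) * x + u * y) < (1 - u) * f x + u * f y)"

definition fourier_transform :: "(real \<Rightarrow> real) \<Rightarrow> real \<Rightarrow> complex" where
  "fourier_transform h t =
     complex_of_real (1 / sqrt (2 * pi)) *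
     (LINT s|lborel. exp (- \<i> * complex_of_real (t * s)) * complex_of_real (h s))"

definition exponentially_decaying :: "(real \<Rightarrow> complex) \<Rightarrow> bool" where
  "exponentially_decaying g \<longleftrightarrow>
     (\<exists>C>0. \<exists>c>0. \<forall>t. norm (g t) \<le> C * exp (- c * \<bar>t\<bar>))"

text \<open>The infimum is taken in the reals, so it is only meaningful if \<open>Q''\<close> is bounded below,
  which holds for every twice differentiable convex \<open>Q\<close>.\<close>

definition alpha :: "(real \<Rightarrow> real) \<Rightarrow> real" where
  "alpha Q = (INF t. deriv (deriv Q) t)"


section \<open>The ensemble\<close>

text \<open>Vectors in \<open>\<real>\<^sup>N\<close> are functions on \<open>{..<N}\<close>, so coordinates are numbered from 0. 
  In the products and sums below, \<open>i < j < N\<close>.\<close>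

definition ensemble_weight :: "(real \<Rightarrow> real) \<Rightarrow> (real \<Rightarrow> real) \<Rightarrow> nat \<Rightarrow> (nat \<Rightarrow> real) \<Rightarrow> real" where
  "ensemble_weight h Q N x =
     (\<Prod>j<N. \<Prod>i<j. \<bar>x i - x j\<bar> ^ 2) *
     exp (- real N * (\<Sum>j<N. Q (x j)) - (\<Sum>j<N. \<Sum>i<j. h (x i - x j)))"

definition partition_function :: "(real \<Rightarrow> real) \<Rightarrow> (real \<Rightarrow> real) \<Rightarrow> nat \<Rightarrow> real" where
  "partition_function h Q N = (LINT x|(\<Pi>\<^sub>M i\<in>{..<N}. lborel). ensemble_weight h Q N x)"

definition ensemble :: "(real \<Rightarrow> real) \<Rightarrow> (real \<Rightarrow> real) \<Rightarrow> nat \<Rightarrow> (nat \<Rightarrow> real) measure" where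
  "ensemble h Q N =
     density (\<Pi>\<^sub>M i\<in>{..<N}. lborel)
       (\<lambda>x. ennreal (ensemble_weight h Q N x / partition_function h Q N))"

text \<open>This is the marginal only for \<open>k \<le> N\<close>.\<close>

definition correlation_measure ::
    "(real \<Rightarrow> real) \<Rightarrow> (real \<Rightarrow> real) \<Rightarrow> nat \<Rightarrow> nat \<Rightarrow> (nat \<Rightarrow> real) measure" where
  "correlation_measure h Q N k =
     distr (ensemble h Q N) (\<Pi>\<^sub>M i\<in>{..<k}. borel) (\<lambda>x. restrict x {..<k})"


section \<open>The limiting measure\<close>

text \<open>The space of \<open>\<Pi>\<^sub>M i\<in>{..<k}. borel\<close> consists of the functions on \<open>{..<k}\<close> extended by
  \<open>undefined\<close>; as a subspace of \<open>nat \<Rightarrow> real\<close> with the product topology it is homeomorphic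
  to \<open>\<real>\<^sup>k\<close>.\<close>

definition converges_weakly :: "(nat \<Rightarrow> 'a::topological_space measure) \<Rightarrow> 'a measure \<Rightarrow> bool" where
  "converges_weakly M L \<longleftrightarrow>
     (\<forall>f :: 'a \<Rightarrow> real. continuous_on (space L) f \<and> bounded (f ` space L) \<longrightarrow>
        (\<lambda>N. LINT x|M N. f x) \<longlonglongrightarrow> (LINT x|L. f x))"

definition measure_support :: "real measure \<Rightarrow> real set" where
  "measure_support \<mu> = {x. \<forall>U. open U \<and> x \<in> U \<longrightarrow> emeasure \<mu> U > 0}"

definition limiting_measure :: "(real \<Rightarrow> real) \<Rightarrow> (real \<Rightarrow> real) \<Rightarrow> real measure \<Rightarrow> bool" where
  "limiting_measure h Q \<mu> \<longleftrightarrow>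
     real_distribution \<mu> \<and> compact (measure_support \<mu>) \<and>
     (\<forall>k\<ge>1. converges_weakly (\<lambda>N. correlation_measure h Q N k) (\<Pi>\<^sub>M i\<in>{..<k}. \<mu>))"

definition even_measure :: "real measure \<Rightarrow> bool" where
  "even_measure \<mu> \<longleftrightarrow> distr \<mu> borel uminus = \<mu>"


section \<open>Equilibrium measures\<close>

text \<open>Integral of an extended-real function as the difference of the integrals of its positive
  and negative parts.\<close>

definition ext_integral :: "'a measure \<Rightarrow> ('a \<Rightarrow> ereal) \<Rightarrow> ereal" where
  "ext_integral M f =
     enn2ereal (\<integral>\<^sup>+x. e2ennreal (f x) \<partial>M) - enn2ereal (\<integral>\<^sup>+x. e2ennreal (- f x) \<partial>M)"

text \<open>The kernel \<open>log |t - s|\<^sup>-\<^sup>1\<close>. The diagonal has to be treated separately because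
  \<open>ln 0 = 0\<close>.\<close>

definition log_kernel :: "real \<Rightarrow> real \<Rightarrow> ereal" where
  "log_kernel t s = (if t = s then \<infinity> else ereal (ln (1 / \<bar>t - s\<bar>)))"

text \<open>On type \<^typ>\<open>ereal\<close>, \<open>\<infinity> + x = \<infinity> = \<infinity> - x\<close> for every \<open>x\<close>. Hence a measure \<open>\<nu>\<close> whose
  logarithmic energy is \<open>-\<infinity>\<close> or undefined because of heavy tails has energy \<open>\<infinity>\<close>, as
  its \<open>V\<close>-integral is then \<open>\<infinity>\<close> (\<open>V\<close> growing at least quadratically). This agrees with
  integrating \<open>log |t - s|\<^sup>-\<^sup>1 + (V t + V s) / 2\<close>, which is bounded below.\<close>

definition energy :: "(real \<Rightarrow> real) \<Rightarrow> real measure \<Rightarrow> ereal" where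
  "energy V \<nu> =
     ext_integral (\<nu> \<Otimes>\<^sub>M \<nu>) (\<lambda>(t, s). log_kernel t s) + ext_integral \<nu> (\<lambda>t. ereal (V t))"

definition equilibrium_measure :: "(real \<Rightarrow> real) \<Rightarrow> real measure \<Rightarrow> bool" where
  "equilibrium_measure V \<mu> \<longleftrightarrow>
     is_arg_min (energy V) real_distribution \<mu> \<and>
     (\<forall>\<nu>. is_arg_min (energy V) real_distribution \<nu> \<longrightarrow> \<nu> = \<mu>)"

definition external_field ::
    "(real \<Rightarrow> real) \<Rightarrow> (real \<Rightarrow> real) \<Rightarrow> real measure \<Rightarrow> real \<Rightarrow> real" where
  "external_field h Q \<mu> x = Q x + (LINT t|\<mu>. h (x - t))"

end

theory Submission
  imports Defs
begin

text \<open>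
  Put \<open>M = sup |h''|\<close> and \<open>\<alpha>\<^sup>h = 4 M\<close>. Then \<open>Q\<close> is so convex that the mean-field energy
  \<open>I(\<nu>) = \<integral>Q d\<nu> + \<integral>\<integral> (h(s - t) / 2 - log |s - t|) d\<nu> d\<nu>\<close> is uniformly convex along averages of
  quantile functions: on monotone rearrangements the logarithm is concave, and \<open>Q\<close> absorbs the
  concavity of \<open>h\<close>. Hence \<open>I\<close> has a unique minimizer \<open>\<mu>\<close>, and \<open>I(\<nu>) - I(\<mu>)\<close> dominates
  \<open>(\<alpha>\<^sub>Q / 4 - M / 2) W(\<mu>, \<nu>)\<^sup>2\<close>, where \<open>W\<close> is the quadratic Wasserstein distance. The energy with
  external field \<open>V = Q + h * \<mu>\<close> differs from \<open>I\<close> only by \<open>- 1/2 \<integral>\<integral> h d(\<nu> - \<mu>) d(\<nu> - \<mu>)\<close>, which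
  is at least \<open>- (M / 2) W\<^sup>2\<close>; so \<open>\<mu>\<close> is also the equilibrium measure for \<open>V\<close>.

  The first variation of \<open>I\<close> shows that the effective potential is at most its \<open>\<mu>\<close>-mean on the
  support and at least this mean elsewhere. By midpoint convexity of the potential off the support,
  the support has no gaps and the potential grows quadratically to the right of \<open>b\<close>.

  Comparing the partition function with \<open>exp (- N\<^sup>2 inf I)\<close>, configurations whose weight is smaller
  than \<open>exp (- N\<^sup>2 (inf I + \<epsilon>))\<close> have exponentially small probability. All other configurations have
  empirical measures close to \<open>\<mu>\<close>, by compactness and uniqueness of the minimizer; this yields the
  convergence of the correlation measures and the lower bound on the largest particle. For the upper
  bound one integrates out a single particle: given the others, the ratio of its mass beyond
  \<open>b + \<delta>\<close> to its total mass is exponentially small because of the growth of the potential. The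
  Borel-Cantelli lemma concludes.
\<close>

section \<open>The interaction kernel\<close>

text \<open>The constant 4 comes from two losses. In an average of quantile functions Q gains
  \<open>a / 8\<close> per squared displacement and h costs at most \<open>M / 4\<close>, which
  leaves the margin \<open>a - 2 * M\<close> for I; the passage to the field V costs
  \<open>M / 2\<close> of the resulting gap \<open>(a - 2 * M) / 4\<close>, which leaves
  \<open>(a - 4 * M) / 4\<close>. The obstacle throughout is the logarithm. Empirical measures have
  infinite energy because of the diagonal, so they enter only through bounded continuous truncations
  of the kernel, and the diagonal becomes an error of order 1/N. Their convergence can be tested
  only on Lipschitz functions. When one particle is integrated out, its interaction beyond b +
  \<delta> is therefore cut off at distance \<delta>, which loses nothing against a measure
  supported in [-b, b]. The total mass is bounded below by Jensen's inequality for a Lipschitz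
  density on [-b, b], whose logarithmic potential is Lipschitz. The cut-off functions depend on the
  position of the removed particle, so convergence must be uniform over all functions with a given
  Lipschitz constant.\<close>

text \<open>\<open>h_second_difference\<close> expresses \<open>|h''| \<le> M\<close>, and \<open>Q_midpoint\<close> expresses \<open>Q'' \<ge> a\<close>.\<close>

locale convex_ensemble =
  fixes h Q :: "real \<Rightarrow> real" and B L M a :: real
  assumes h_even: "h (- x) = h x"
    and h_bound: "\<bar>h x\<bar> \<le> B"
    and h_lipschitz: "\<bar>h x - h y\<bar> \<le> L * \<bar>x - y\<bar>"
    and h_second_difference: "\<bar>h p - h (p - v) - h (p + u) + h (p + u - v)\<bar> \<le> M * \<bar>u\<bar> * \<bar>v\<bar>"
    and Q_even: "Q (- x) = Q x"
    and Q_continuous: "continuous_on UNIV Q"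
    and Q_midpoint: "Q ((x + y) / 2) \<le> (Q x + Q y) / 2 - a / 8 * (x - y)\<^sup>2"
    and M_nonneg: "0 \<le> M" and a_gt: "4 * M < a"
begin

section \<open>Consequences of the bounds on h and Q; the pair kernel and its truncations\<close>

lemma a_pos: "0 < a" using M_nonneg a_gt by linarith
lemma B_nonneg: "0 \<le> B" using h_bound[of 0] by linarith
lemma L_nonneg: "0 \<le> L" using h_lipschitz[of 1 0] by simp

lemma h_continuous: "continuous_on UNIV h"
proof -
  have "L-lipschitz_on UNIV h"
    by (intro lipschitz_onI) (auto simp: dist_real_def h_lipschitz L_nonneg)
  then show ?thesis by (rule lipschitz_on_continuous_on)
qed

lemma h_measurable[measurable]: "h \<in> borel_measurable borel"
  using h_continuous by (rule borel_measurable_continuous_onI)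

lemma Q_measurable[measurable]: "Q \<in> borel_measurable borel"
  using Q_continuous by (rule borel_measurable_continuous_onI)

lemma Q_growth: "Q 0 + a / 2 * x\<^sup>2 \<le> Q x"
  using Q_midpoint[of x "- x"] Q_even[of x] by (simp add: power2_eq_square)

text \<open>With the steps \<open>u = (q - p) / 2\<close> and \<open>v = - u\<close> both middle
  terms of the second difference sit at the midpoint, so it becomes the midpoint defect of
  h.\<close>

lemma h_midpoint: "h ((p + q) / 2) \<le> (h p + h q) / 2 + M / 8 * (p - q)\<^sup>2"
  using h_second_difference[of p "- ((q - p) / 2)" "(q - p) / 2"]
  by (simp add: field_simps power2_eq_square abs_if split: if_splits)

text \<open>With this \<open>C\<close> the kernel \<open>w\<close> dominates \<open>a / 8 (s\<^sup>2 + t\<^sup>2)\<close>, so that all energies can be taken in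
  \<^typ>\<open>ennreal\<close>. The junk value \<open>ln 0 = 0\<close> is overridden on the diagonal in \<open>K\<close>.\<close>

definition C :: real where "C = B / 2 + 4 / a + \<bar>Q 0\<bar>"

definition w0 :: "real \<Rightarrow> real \<Rightarrow> real" where
  "w0 s t = (Q s + Q t) / 2 + h (s - t) / 2 + C"

definition w :: "real \<Rightarrow> real \<Rightarrow> real" where
  "w s t = w0 s t - ln \<bar>s - t\<bar>"

definition K :: "real \<Rightarrow> real \<Rightarrow> ennreal" where
  "K s t = (if s = t then \<infinity> else ennreal (w s t))"

text \<open>This is \<open>min n w\<close>, written so that continuity on the diagonal is evident.\<close>

definition wtrunc :: "nat \<Rightarrow> real \<Rightarrow> real \<Rightarrow> real" where
  "wtrunc n s t = w0 s t - ln (max \<bar>s - t\<bar> (exp (w0 s t - real n)))"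

text \<open>Half of the quadratic growth of Q is kept; the other half pays for the logarithm, which
  is at most \<open>\<bar>s\<bar> + \<bar>t\<bar>\<close>. Completing the square costs
  \<open>2 / a\<close> per variable, whence the summand \<open>4 / a\<close> in
  \<open>C\<close>.\<close>

lemma w_ge: "a / 8 * (s\<^sup>2 + t\<^sup>2) \<le> w s t"
proof -
  have *: "\<bar>x\<bar> \<le> a / 8 * x\<^sup>2 + 2 / a" for x :: real
  proof -
    have "0 \<le> a / 8 * (\<bar>x\<bar> - 4 / a)\<^sup>2" using a_pos by simp
    also have "\<dots> = a / 8 * x\<^sup>2 - \<bar>x\<bar> + 2 / a"
      using a_pos by (simp add: power2_eq_square field_simps)
    finally show ?thesis by simp
  qed
  have "ln \<bar>s - t\<bar> \<le> \<bar>s\<bar> + \<bar>t\<bar>"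
  proof (cases "s = t")
    case False
    then have "ln \<bar>s - t\<bar> \<le> \<bar>s - t\<bar> - 1" by (intro ln_le_minus_one) auto
    then show ?thesis by linarith
  qed auto
  moreover have "- B \<le> h (s - t)" using h_bound[of "s - t"] by linarith
  moreover have "- \<bar>Q 0\<bar> \<le> Q 0" by linarith
  moreover have "a / 4 * s\<^sup>2 + a / 4 * t\<^sup>2 - \<bar>Q 0\<bar> - B / 2 + C - (\<bar>s\<bar> + \<bar>t\<bar>) \<ge> a / 8 * s\<^sup>2 + a / 8 * t\<^sup>2"
    using *[of s] *[of t] unfolding C_def by simp
  ultimately have "a / 8 * s\<^sup>2 + a / 8 * t\<^sup>2 \<le> (Q s + Q t) / 2 + h (s - t) / 2 + C - ln \<bar>s - t\<bar>"
    using Q_growth[of s] Q_growth[of t] by (simp add: field_simps)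
  then show ?thesis unfolding w_def w0_def by (simp add: algebra_simps)
qed

lemma w_nonneg: "0 \<le> w s t"
  using a_pos by (intro order_trans[OF _ w_ge]) auto

lemma w_commute: "w s t = w t s"
  using h_even[of "s - t"] by (simp add: w_def w0_def abs_minus_commute)

lemma K_commute: "K s t = K t s"
  by (simp add: K_def w_commute[of s t])

lemma K_ge: "ennreal (a / 8 * (s\<^sup>2 + t\<^sup>2)) \<le> K s t"
  using w_ge by (auto simp: K_def intro!: ennreal_leI)

lemma K_measurable[measurable]: "(\<lambda>(s, t). K s t) \<in> borel_measurable (borel \<Otimes>\<^sub>M borel)"
  unfolding K_def w_def w0_def by measurable

lemma K_measurable'[measurable (raw)]:
  assumes [measurable]: "f \<in> borel_measurable N" "g \<in> borel_measurable N"
  shows "(\<lambda>x. K (f x) (g x)) \<in> borel_measurable N"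
  using measurable_compose[OF measurable_Pair[OF assms] K_measurable] by simp

text \<open>Off the diagonal \<open>\<bar>s - t\<bar> \<le> exp (w0 s t - real n)\<close> says that
  w is at least n; in that case the logarithm in \<open>wtrunc\<close> cancels w0 and leaves n. On
  the diagonal the exponential always wins, which gives n there as well.\<close>

lemma wtrunc_eq: "wtrunc n s t = (if s = t then real n else min (real n) (w s t))"
proof (cases "s = t")
  case False
  show ?thesis
  proof (cases "\<bar>s - t\<bar> \<le> exp (w0 s t - real n)")
    case True
    then have "ln \<bar>s - t\<bar> \<le> w0 s t - real n"
      using False by (metis exp_gt_zero ln_exp ln_le_cancel_iff right_minus_eq zero_less_abs_iff)
    with True False show ?thesis by (simp add: wtrunc_def w_def max_def min_def)
  next
    case *: False
    then have "ln \<bar>s - t\<bar> \<ge> w0 s t - real n"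
      using False by (subst ln_ge_iff) auto
    with * False show ?thesis by (simp add: wtrunc_def w_def max_def min_def)
  qed
qed (simp add: wtrunc_def max_def)

lemma wtrunc_nonneg: "0 \<le> wtrunc n s t" and wtrunc_le: "wtrunc n s t \<le> real n"
  using w_nonneg[of s t] by (auto simp: wtrunc_eq)

lemma wtrunc_continuous:
  assumes "continuous_on S f" "continuous_on S g"
  shows "continuous_on S (\<lambda>x. wtrunc n (f x) (g x))"
proof -
  have Q: "continuous_on S (\<lambda>x. Q (f x))" if "continuous_on S f" for f
    using continuous_on_compose2[OF Q_continuous that] by simp
  have h: "continuous_on S (\<lambda>x. h (f x))" if "continuous_on S f" for f
    using continuous_on_compose2[OF h_continuous that] by simp
  have pos: "max \<bar>x\<bar> (exp y) > 0" for x y :: real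
    using exp_gt_zero[of y] by linarith
  have w: "continuous_on S (\<lambda>x. w0 (f x) (g x))"
    unfolding w0_def by (intro continuous_intros Q h assms) auto
  show ?thesis
    unfolding wtrunc_def
    by (intro continuous_intros w assms) (use pos in \<open>auto simp: less_imp_neq[OF pos, symmetric]\<close>)
qed

lemma wtrunc_measurable[measurable]:
  "(\<lambda>(s, t). wtrunc n s t) \<in> borel_measurable (borel \<Otimes>\<^sub>M borel)"
  unfolding wtrunc_def w0_def by measurable

lemma SUP_wtrunc: "(SUP n. ennreal (wtrunc n s t)) = K s t"
proof (cases "s = t")
  case True
  then show ?thesis
    using ennreal_SUP_of_nat_eq_top by (simp add: wtrunc_eq K_def ennreal_of_nat_eq_real_of_nat)
next
  case False
  obtain n where n: "w s t \<le> real n" using real_arch_simple by blast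
  show ?thesis
  proof (rule antisym)
    show "(SUP n. ennreal (wtrunc n s t)) \<le> K s t"
      using False by (intro SUP_least) (auto simp: wtrunc_eq K_def intro!: ennreal_leI)
    show "K s t \<le> (SUP n. ennreal (wtrunc n s t))"
      using False n by (intro SUP_upper2[of n]) (auto simp: wtrunc_eq K_def intro!: ennreal_leI)
  qed
qed

text \<open>\<open>En \<nu> = I(\<nu>) + C\<close>.\<close>

definition En :: "real measure \<Rightarrow> ennreal" where
  "En \<nu> = (\<integral>\<^sup>+s. \<integral>\<^sup>+t. K s t \<partial>\<nu> \<partial>\<nu>)"

lemma En_pair:
  assumes "real_distribution \<nu>"
  shows "En \<nu> = (\<integral>\<^sup>+p. K (fst p) (snd p) \<partial>(\<nu> \<Otimes>\<^sub>M \<nu>))"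
proof -
  interpret real_distribution \<nu> by fact
  show ?thesis unfolding En_def
    by (subst nn_integral_fst[symmetric]) auto
qed

lemma incseq_wtrunc: "incseq (\<lambda>n. ennreal (wtrunc n s t))"
  by (auto simp: incseq_def wtrunc_eq intro!: ennreal_leI)

text \<open>The energy becomes a supremum of integrals of bounded continuous functions, which is the
  source of its lower semicontinuity.\<close>

lemma En_SUP:
  assumes "real_distribution \<nu>"
  shows "En \<nu> = (SUP n. \<integral>\<^sup>+p. ennreal (wtrunc n (fst p) (snd p)) \<partial>(\<nu> \<Otimes>\<^sub>M \<nu>))"
proof -
  interpret real_distribution \<nu> by fact
  have [measurable]: "(\<lambda>p. wtrunc n (fst p) (snd p)) \<in> borel_measurable (\<nu> \<Otimes>\<^sub>M \<nu>)" for n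
    using wtrunc_measurable[of n] by (simp add: split_beta cong: measurable_cong_sets)
  show ?thesis
    unfolding En_pair[OF assms] SUP_wtrunc[symmetric]
    using incseq_wtrunc
    by (intro nn_integral_monotone_convergence_SUP) (auto simp: incseq_def le_fun_def)
qed

text \<open>Since the kernel dominates a multiple of the square of either variable, measures of
  bounded energy have bounded second moments and form a tight family.\<close>

lemma second_moment_le_En:
  assumes "real_distribution \<nu>"
  shows "(\<integral>\<^sup>+x. ennreal (x\<^sup>2) \<partial>\<nu>) \<le> ennreal (8 / a) * En \<nu>"
proof -
  interpret real_distribution \<nu> by fact
  have "(\<integral>\<^sup>+x. ennreal (x\<^sup>2) \<partial>\<nu>) = (\<integral>\<^sup>+x. \<integral>\<^sup>+y. ennreal (x\<^sup>2) \<partial>\<nu> \<partial>\<nu>)"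
    using emeasure_space_1 by simp
  also have "\<dots> \<le> (\<integral>\<^sup>+x. \<integral>\<^sup>+y. ennreal (8 / a) * K x y \<partial>\<nu> \<partial>\<nu>)"
  proof (intro nn_integral_mono)
    fix x y :: real
    have "ennreal (x\<^sup>2) \<le> ennreal (8 / a * (a / 8 * (x\<^sup>2 + y\<^sup>2)))"
      using a_pos by (intro ennreal_leI) auto
    also have "\<dots> = ennreal (8 / a) * ennreal (a / 8 * (x\<^sup>2 + y\<^sup>2))"
      using a_pos by (intro ennreal_mult) auto
    also have "\<dots> \<le> ennreal (8 / a) * K x y"
      by (intro mult_left_mono K_ge) auto
    finally show "ennreal (x\<^sup>2) \<le> ennreal (8 / a) * K x y" .
  qed
  also have "\<dots> = ennreal (8 / a) * En \<nu>"
    unfolding En_def by (simp add: nn_integral_cmult)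
  finally show ?thesis .
qed

end

section \<open>Tightness and lower semicontinuity of the energy\<close>

lemma tight_second_moment:
  assumes rd: "\<And>n. real_distribution (\<nu> n)"
    and bd: "\<And>n. (\<integral>\<^sup>+x. ennreal (x\<^sup>2) \<partial>\<nu> n) \<le> ennreal A" and A: "0 \<le> A"
  shows "tight \<nu>"
  unfolding tight_def
proof (intro conjI allI impI rd)
  fix e :: real assume e: "0 < e"
  obtain R :: real where R: "R > 0" "R\<^sup>2 > A / e"
  proof -
    let ?R = "1 + A / e"
    have "A / e \<ge> 0" using A e by simp
    moreover have "(1 + y)\<^sup>2 > y" if "0 \<le> y" for y :: real
      using that by (simp add: power2_eq_square algebra_simps add_pos_nonneg)
    ultimately have "?R\<^sup>2 > A / e" by blast
    then show ?thesis using A e by (intro that[of ?R]) (auto intro!: add_pos_nonneg)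
  qed
  show "\<exists>a b. a < b \<and> (\<forall>n. measure (\<nu> n) {a<..b} > 1 - e)"
  proof (rule exI[of _ "- R"], rule exI[of _ R], intro conjI allI)
    fix n
    interpret real_distribution "\<nu> n" by (rule rd)
    have "emeasure (\<nu> n) (UNIV - {-R<..R}) * ennreal (R\<^sup>2) = (\<integral>\<^sup>+x. ennreal (R\<^sup>2) * indicator (UNIV - {-R<..R}) x \<partial>\<nu> n)"
      by (subst nn_integral_cmult_indicator) (auto simp: mult.commute)
    also have "\<dots> \<le> (\<integral>\<^sup>+x. ennreal (x\<^sup>2) \<partial>\<nu> n)"
    proof (intro nn_integral_mono)
      fix x :: real
      have "R\<^sup>2 \<le> x\<^sup>2" if "x \<notin> {-R<..R}"
      proof -
        from that have "\<bar>R\<bar> \<le> \<bar>x\<bar>" using R by auto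
        then show ?thesis by (simp add: abs_le_square_iff)
      qed
      then show "ennreal (R\<^sup>2) * indicator (UNIV - {-R<..R}) x \<le> ennreal (x\<^sup>2)"
        by (auto simp: indicator_def intro!: ennreal_leI)
    qed
    also have "\<dots> \<le> ennreal A" by (rule bd)
    finally have "measure (\<nu> n) (UNIV - {-R<..R}) * R\<^sup>2 \<le> A"
      using A by (simp add: emeasure_eq_measure flip: ennreal_mult)
    then have "measure (\<nu> n) (UNIV - {-R<..R}) \<le> A / R\<^sup>2"
      using R by (simp add: field_simps)
    also have "\<dots> < e" using R e by (auto simp: field_simps)
    finally show "1 - e < measure (\<nu> n) {-R<..R}"
      using prob_compl[of "{-R<..R}"] by simp
  qed (use R in auto)
qed

text \<open>\<open>weak_conv_m\<close> speaks only of measures on the line. Skorohod's theorem turns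
  it into pointwise convergence on one space \<Omega>, and on the square of \<Omega> dominated
  convergence applies.\<close>

lemma weak_conv_pair_integral:
  fixes F :: "real \<times> real \<Rightarrow> real"
  assumes rd: "\<And>n. real_distribution (\<nu> n)" and rd': "real_distribution \<nu>'"
    and wc: "weak_conv_m \<nu> \<nu>'"
    and F: "continuous_on UNIV F" and bd: "\<And>p. \<bar>F p\<bar> \<le> D"
  shows "(\<lambda>n. LINT p|(\<nu> n \<Otimes>\<^sub>M \<nu> n). F p) \<longlonglongrightarrow> (LINT p|(\<nu>' \<Otimes>\<^sub>M \<nu>'). F p)"
proof -
  from Skorohod[OF rd rd' wc] obtain \<Omega> :: "real measure" and Yn Y where
    O: "prob_space \<Omega>" and Yn[measurable]: "\<And>n. Yn n \<in> borel_measurable \<Omega>"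
    and dn: "\<And>n. distr \<Omega> borel (Yn n) = \<nu> n"
    and Y[measurable]: "Y \<in> borel_measurable \<Omega>" and d: "distr \<Omega> borel Y = \<nu>'"
    and lim: "\<And>x. x \<in> space \<Omega> \<Longrightarrow> (\<lambda>n. Yn n x) \<longlonglongrightarrow> Y x"
    by force
  interpret O: prob_space \<Omega> by fact
  interpret OO: pair_prob_space \<Omega> \<Omega> ..
  have F_m[measurable]: "F \<in> borel_measurable (borel \<Otimes>\<^sub>M borel)"
    using borel_measurable_continuous_onI[OF F] by (simp add: borel_prod)
  have eq: "(LINT p|(distr \<Omega> borel Z \<Otimes>\<^sub>M distr \<Omega> borel Z). F p)
      = (LINT q|(\<Omega> \<Otimes>\<^sub>M \<Omega>). F (Z (fst q), Z (snd q)))"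
    if [measurable]: "Z \<in> borel_measurable \<Omega>" for Z :: "real \<Rightarrow> real"
  proof -
    interpret Z: prob_space "distr \<Omega> borel Z" by (rule O.prob_space_distr) fact
    have "distr \<Omega> borel Z \<Otimes>\<^sub>M distr \<Omega> borel Z
        = distr (\<Omega> \<Otimes>\<^sub>M \<Omega>) (borel \<Otimes>\<^sub>M borel) (\<lambda>(x, y). (Z x, Z y))"
      by (intro pair_measure_distr) (auto intro: Z.sigma_finite_measure)
    then show ?thesis
      by (simp add: integral_distr split_beta')
  qed
  have "(\<lambda>n. LINT q|(\<Omega> \<Otimes>\<^sub>M \<Omega>). F (Yn n (fst q), Yn n (snd q)))
      \<longlonglongrightarrow> (LINT q|(\<Omega> \<Otimes>\<^sub>M \<Omega>). F (Y (fst q), Y (snd q)))"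
  proof (rule integral_dominated_convergence[where w="\<lambda>_. D"])
    show "AE q in \<Omega> \<Otimes>\<^sub>M \<Omega>. (\<lambda>n. F (Yn n (fst q), Yn n (snd q))) \<longlonglongrightarrow> F (Y (fst q), Y (snd q))"
    proof (rule AE_I2)
      fix q assume "q \<in> space (\<Omega> \<Otimes>\<^sub>M \<Omega>)"
      then have "(\<lambda>n. (Yn n (fst q), Yn n (snd q))) \<longlonglongrightarrow> (Y (fst q), Y (snd q))"
        by (intro tendsto_Pair lim) (auto simp: space_pair_measure)
      moreover have "isCont F (Y (fst q), Y (snd q))"
        using F by (simp add: continuous_on_eq_continuous_at)
      ultimately show "(\<lambda>n. F (Yn n (fst q), Yn n (snd q))) \<longlonglongrightarrow> F (Y (fst q), Y (snd q))"
        by (rule isCont_tendsto_compose[rotated])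
    qed
  qed (auto simp: bd)
  then show ?thesis
    by (simp add: eq[symmetric] dn d)
qed

context convex_ensemble begin

text \<open>The bound is asked of each truncation separately, with an error that may depend on the
  truncation level. This form covers empirical measures: their energy is infinite, but every
  truncated energy feels the diagonal only in the limit-zero error.\<close>

lemma En_lower_semicontinuous:
  assumes rd: "\<And>n. real_distribution (\<nu> n)" and rd': "real_distribution \<nu>'"
    and wc: "weak_conv_m \<nu> \<nu>'"
    and bd: "\<And>k. \<exists>e. e \<longlonglongrightarrow> 0 \<and> (\<forall>\<^sub>F n in sequentially.
       (LINT p|(\<nu> n \<Otimes>\<^sub>M \<nu> n). wtrunc k (fst p) (snd p)) \<le> A + e n)"
  shows "En \<nu>' \<le> ennreal A"
proof -
  interpret N: real_distribution \<nu>' by (rule rd')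
  interpret NN: pair_prob_space \<nu>' \<nu>' ..
  have "(\<integral>\<^sup>+p. ennreal (wtrunc k (fst p) (snd p)) \<partial>(\<nu>' \<Otimes>\<^sub>M \<nu>')) \<le> ennreal A" for k
  proof -
    obtain e where e: "e \<longlonglongrightarrow> 0" and ev: "\<forall>\<^sub>F n in sequentially.
       (LINT p|(\<nu> n \<Otimes>\<^sub>M \<nu> n). wtrunc k (fst p) (snd p)) \<le> A + e n" using bd by blast
    have [measurable]: "(\<lambda>p. wtrunc k (fst p) (snd p)) \<in> borel_measurable (\<nu>' \<Otimes>\<^sub>M \<nu>')"
      using wtrunc_measurable[of k] by (simp add: split_beta cong: measurable_cong_sets)
    have c: "continuous_on UNIV (\<lambda>p. wtrunc k (fst p) (snd p))"
      by (intro wtrunc_continuous continuous_intros)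
    have lim: "(\<lambda>n. LINT p|(\<nu> n \<Otimes>\<^sub>M \<nu> n). wtrunc k (fst p) (snd p))
        \<longlonglongrightarrow> (LINT p|(\<nu>' \<Otimes>\<^sub>M \<nu>'). wtrunc k (fst p) (snd p))"
      by (intro weak_conv_pair_integral[OF rd rd' wc c, of "real k"])
         (auto simp: abs_of_nonneg wtrunc_nonneg wtrunc_le)
    have "(\<lambda>n. A + e n) \<longlonglongrightarrow> A + 0" by (intro tendsto_intros e)
    from tendsto_le[OF sequentially_bot this lim ev]
    have le: "(LINT p|(\<nu>' \<Otimes>\<^sub>M \<nu>'). wtrunc k (fst p) (snd p)) \<le> A" by simp
    have "integrable (\<nu>' \<Otimes>\<^sub>M \<nu>') (\<lambda>p. wtrunc k (fst p) (snd p))"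
      by (intro NN.integrable_const_bound[where B="real k"])
         (auto simp: abs_of_nonneg wtrunc_nonneg wtrunc_le)
    then show ?thesis
      using le by (subst nn_integral_eq_integral) (auto simp: wtrunc_nonneg intro!: ennreal_leI)
  qed
  then show ?thesis unfolding En_SUP[OF rd'] by (intro SUP_least)
qed

end

section \<open>Displacement convexity and the minimizer\<close>

text \<open>\<open>- ln u = 2 * ln (u powr (-1/2))\<close> is at most twice that power, whose
  integral over the unit interval is 2.\<close>

lemma nn_integral_neg_ln_half: "(\<integral>\<^sup>+u. ennreal (max 0 (- ln u)) * indicator {0..1} u \<partial>lborel) \<le> 4"
proof -
  have "((\<lambda>x::real. x powr (-1/2)) has_integral (1 powr (-1/2 + 1) / (-1/2 + 1))) {0..1}"
    by (rule has_integral_powr_from_0) auto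
  then have hi: "((\<lambda>x::real. x powr (-1/2)) has_integral 2) {0..1}" by simp
  have "(\<integral>\<^sup>+u. ennreal (max 0 (- ln u)) * indicator {0..1} u \<partial>lborel)
      \<le> (\<integral>\<^sup>+u. 2 * ennreal (indicator {0..1} u * u powr (-1/2)) \<partial>lborel)"
  proof (intro nn_integral_mono)
    fix u :: real
    show "ennreal (max 0 (- ln u)) * indicator {0..1} u \<le> 2 * ennreal (indicator {0..1} u * u powr (-1/2))"
    proof (cases "0 < u \<and> u \<le> 1")
      case True
      have "- ln u = 2 * ln (u powr (-1/2))" using True by (simp add: ln_powr)
      also have "\<dots> \<le> 2 * u powr (-1/2)"
        using ln_le_minus_one[of "u powr (-1/2)"] True by simp
      finally have "ennreal (max 0 (- ln u)) \<le> ennreal (2 * u powr (-1/2))"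
        by (intro ennreal_leI) auto
      with True show ?thesis by (simp add: ennreal_mult)
    qed (auto simp: indicator_def)
  qed
  also have "\<dots> = 2 * (\<integral>\<^sup>+u. ennreal (indicator {0..1} u * u powr (-1/2)) \<partial>lborel)"
    by (intro nn_integral_cmult) measurable
  also have "(\<integral>\<^sup>+u. ennreal (indicator {0..1} u * u powr (-1/2)) \<partial>lborel) = ennreal 2"
    by (rule nn_integral_has_integral_lebesgue[OF _ hi]) auto
  finally show ?thesis by (simp flip: ennreal_numeral ennreal_mult)
qed

text \<open>Uniformity in s is the point: for a measure with bounded density, the singular part of
  the logarithmic potential is bounded everywhere.\<close>

lemma nn_integral_neg_ln: "(\<integral>\<^sup>+t. ennreal (max 0 (- ln \<bar>s - t\<bar>)) \<partial>lborel) \<le> 8"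
proof -
  let ?g = "\<lambda>u::real. ennreal (max 0 (- ln u)) * indicator {0..1} u"
  have "(\<integral>\<^sup>+t. ennreal (max 0 (- ln \<bar>s - t\<bar>)) \<partial>lborel) = (\<integral>\<^sup>+t. ennreal (max 0 (- ln \<bar>t\<bar>)) \<partial>lborel)"
    by (subst nn_integral_real_affine[where c="-1" and t=s]) auto
  also have "\<dots> \<le> (\<integral>\<^sup>+u. ?g u + ?g (- u) \<partial>lborel)"
  proof (intro nn_integral_mono)
    fix u :: real
    show "ennreal (max 0 (- ln \<bar>u\<bar>)) \<le> ?g u + ?g (- u)"
    proof (cases "\<bar>u\<bar> \<le> 1")
      case True
      then show ?thesis by (cases "u > 0"; cases "u = 0") (auto simp: indicator_def)
    next
      case False
      then have "max 0 (- ln \<bar>u\<bar>) = 0" by (auto simp: max_def ln_ge_zero)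
      then show ?thesis by simp
    qed
  qed
  also have "\<dots> = (\<integral>\<^sup>+u. ?g u \<partial>lborel) + (\<integral>\<^sup>+u. ?g (- u) \<partial>lborel)"
    by (intro nn_integral_add) auto
  also have "(\<integral>\<^sup>+u. ?g (- u) \<partial>lborel) = (\<integral>\<^sup>+u. ?g u \<partial>lborel)"
    by (subst (2) nn_integral_real_affine[where c="-1" and t=0]) auto
  also have "\<dots> + \<dots> \<le> 4 + 4"
    using nn_integral_neg_ln_half by (rule add_mono[OF _ nn_integral_neg_ln_half])
  finally show ?thesis by simp
qed

section \<open>Quantile functions and displacement midpoints\<close>

definition unit_measure :: "real measure" where
  "unit_measure = restrict_space lborel {0<..<1}"

text \<open>All laws are realised by increasing functions on one probability space. Any two of them
  are then coupled in the way that is optimal for the quadratic cost.\<close>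

definition quantile :: "real measure \<Rightarrow> real \<Rightarrow> real" where
  "quantile \<nu> u = Inf {x. u \<le> cdf \<nu> x}"

lemma space_unit_measure[simp]: "space unit_measure = {0<..<1}"
  by (simp add: unit_measure_def space_restrict_space)

interpretation unit_measure: prob_space unit_measure
  by (auto simp: unit_measure_def space_restrict_space emeasure_restrict_space intro!: prob_spaceI)

lemma quantile_measurable[measurable]:
  assumes "real_distribution \<nu>"
  shows "quantile \<nu> \<in> borel_measurable unit_measure"
proof -
  interpret cdf_distribution \<nu> unfolding cdf_distribution_def by fact
  show ?thesis
    using measurable_CI unfolding quantile_def[abs_def] unit_measure_def
    by (simp add: measurable_cong_sets[OF sets_restrict_space_cong[OF sets_lborel] refl])
qed

lemma distr_quantile:
  assumes "real_distribution \<nu>"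
  shows "distr unit_measure borel (quantile \<nu>) = \<nu>"
proof -
  interpret cdf_distribution \<nu> unfolding cdf_distribution_def by fact
  show ?thesis using distr_I_eq_M unfolding quantile_def[abs_def] unit_measure_def .
qed

lemma quantile_mono:
  assumes "real_distribution \<nu>" "0 < u" "u \<le> v" "v < 1"
  shows "quantile \<nu> u \<le> quantile \<nu> v"
proof -
  interpret cdf_distribution \<nu> unfolding cdf_distribution_def by fact
  show ?thesis using mono_I assms unfolding quantile_def mono_on_def by auto
qed

text \<open>The squared quadratic Wasserstein distance.\<close>

definition qdist :: "real measure \<Rightarrow> real measure \<Rightarrow> ennreal" where
  "qdist \<mu> \<nu> = (\<integral>\<^sup>+u. ennreal ((quantile \<mu> u - quantile \<nu> u)\<^sup>2) \<partial>unit_measure)"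

lemma qdist_eq_0:
  assumes [measurable]: "real_distribution \<mu>" "real_distribution \<nu>" and 0: "qdist \<mu> \<nu> = 0"
  shows "\<mu> = \<nu>"
proof -
  have "AE u in unit_measure. quantile \<mu> u = quantile \<nu> u"
    using 0 unfolding qdist_def by (subst (asm) nn_integral_0_iff_AE) auto
  then have "distr unit_measure borel (quantile \<mu>) = distr unit_measure borel (quantile \<nu>)"
    by (intro distr_cong_AE) auto
  then show ?thesis by (simp add: distr_quantile assms)
qed

text \<open>The midpoint of the Wasserstein geodesic between the two measures. Unlike a mixture it
  moves mass, so that distances between particles average and the concavity of the logarithm can be
  used.\<close>

definition qmid :: "real measure \<Rightarrow> real measure \<Rightarrow> real measure" where
  "qmid \<mu> \<nu> = distr unit_measure borel (\<lambda>u. (quantile \<mu> u + quantile \<nu> u) / 2)"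

lemma real_distribution_distr:
  "prob_space P \<Longrightarrow> X \<in> borel_measurable P \<Longrightarrow> real_distribution (distr P borel X)"
  by (simp add: real_distribution_def real_distribution_axioms_def prob_space.prob_space_distr)

section \<open>Existence, uniqueness and symmetry of the minimizer\<close>

context convex_ensemble begin

lemma LINT_wtrunc_le:
  assumes "real_distribution \<nu>" "En \<nu> \<le> ennreal c" "0 \<le> c"
  shows "(LINT p|(\<nu> \<Otimes>\<^sub>M \<nu>). wtrunc k (fst p) (snd p)) \<le> c"
proof -
  interpret N: real_distribution \<nu> by fact
  interpret NN: pair_prob_space \<nu> \<nu> ..
  have [measurable]: "(\<lambda>p. wtrunc k (fst p) (snd p)) \<in> borel_measurable (\<nu> \<Otimes>\<^sub>M \<nu>)"
    using wtrunc_measurable[of k] by (simp add: split_beta cong: measurable_cong_sets)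
  have "integrable (\<nu> \<Otimes>\<^sub>M \<nu>) (\<lambda>p. wtrunc k (fst p) (snd p))"
    by (intro NN.integrable_const_bound[where B="real k"])
       (auto simp: abs_of_nonneg wtrunc_nonneg wtrunc_le)
  then have "ennreal (LINT p|(\<nu> \<Otimes>\<^sub>M \<nu>). wtrunc k (fst p) (snd p))
      = (\<integral>\<^sup>+p. ennreal (wtrunc k (fst p) (snd p)) \<partial>(\<nu> \<Otimes>\<^sub>M \<nu>))"
    by (subst nn_integral_eq_integral) (auto simp: wtrunc_nonneg)
  also have "\<dots> \<le> En \<nu>" unfolding En_SUP[OF assms(1)] by (intro SUP_upper) auto
  also note assms(2)
  finally show ?thesis using assms(3) by (subst (asm) ennreal_le_iff)
qed

text \<open>Direct method: a minimizing sequence has bounded second moments, so a subsequence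
  converges weakly, and lower semicontinuity passes the bound to its limit.\<close>

lemma exists_minimizer:
  assumes "real_distribution \<nu>0" "En \<nu>0 < \<infinity>"
  shows "\<exists>\<mu>. real_distribution \<mu> \<and> (\<forall>\<nu>. real_distribution \<nu> \<longrightarrow> En \<mu> \<le> En \<nu>)"
proof -
  define m where "m = (INF \<nu>\<in>Collect real_distribution. En \<nu>)"
  have "m \<le> En \<nu>0" unfolding m_def using assms by (intro INF_lower) auto
  with assms obtain r where r: "m = ennreal r" "0 \<le> r" by (cases m) auto
  have "\<exists>\<nu>. real_distribution \<nu> \<and> En \<nu> \<le> ennreal (r + 1 / Suc n)" for n
  proof -
    have "m < ennreal (r + 1 / Suc n)" unfolding r using r by (subst ennreal_less_iff) auto
    then show ?thesis unfolding m_def INF_less_iff by (auto intro: less_imp_le)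
  qed
  then obtain \<nu> where rd: "\<And>n. real_distribution (\<nu> n)" and En: "\<And>n. En (\<nu> n) \<le> ennreal (r + 1 / Suc n)"
    by metis
  have "tight \<nu>"
  proof (rule tight_second_moment[OF rd])
    fix n
    have "(\<integral>\<^sup>+x. ennreal (x\<^sup>2) \<partial>\<nu> n) \<le> ennreal (8 / a) * En (\<nu> n)"
      by (rule second_moment_le_En[OF rd])
    also have "\<dots> \<le> ennreal (8 / a) * ennreal (r + 1)"
      using r by (intro mult_left_mono order_trans[OF En] ennreal_leI) (auto simp: field_simps)
    also have "\<dots> = ennreal (8 / a * (r + 1))"
      using r a_pos by (intro ennreal_mult[symmetric]) auto
    finally show "(\<integral>\<^sup>+x. ennreal (x\<^sup>2) \<partial>\<nu> n) \<le> ennreal (8 / a * (r + 1))" .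
  qed (use r a_pos in auto)
  from tight_imp_convergent_subsubsequence[OF this strict_mono_id]
  obtain s \<mu> where s: "strict_mono s" and \<mu>: "real_distribution \<mu>" and wc: "weak_conv_m (\<lambda>n. \<nu> (s n)) \<mu>"
    by (auto simp: comp_def)
  have "En \<mu> \<le> ennreal r"
  proof (rule En_lower_semicontinuous[OF rd \<mu> wc], intro exI[of _ "\<lambda>n. 1 / Suc n"] conjI always_eventually allI)
    fix k n
    have "(LINT p|(\<nu> (s n) \<Otimes>\<^sub>M \<nu> (s n)). wtrunc k (fst p) (snd p)) \<le> r + 1 / Suc (s n)"
      using r by (intro LINT_wtrunc_le rd En) auto
    also have "\<dots> \<le> r + 1 / Suc n"
      using seq_suble[OF s, of n] by (intro add_left_mono divide_left_mono) auto
    finally show "(LINT p|(\<nu> (s n) \<Otimes>\<^sub>M \<nu> (s n)). wtrunc k (fst p) (snd p)) \<le> r + 1 / Suc n" .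
  qed (use LIMSEQ_inverse_real_of_nat in \<open>simp add: inverse_eq_divide\<close>)
  then have "En \<mu> \<le> m" using r by simp
  also have "m \<le> En \<nu>" if "real_distribution \<nu>" for \<nu>
    unfolding m_def using that by (intro INF_lower) auto
  finally (order_trans) show ?thesis using \<mu> by blast
qed

lemma w0_bounded: "\<exists>A\<ge>0. \<forall>s\<in>{x..y}. \<forall>t\<in>{x..y}. w0 s t \<le> A"
proof -
  have "bounded (Q ` {x..y})"
    by (intro compact_imp_bounded compact_continuous_image continuous_on_subset[OF Q_continuous]) auto
  then obtain D where D: "\<And>s. s \<in> {x..y} \<Longrightarrow> \<bar>Q s\<bar> \<le> D"
    unfolding bounded_iff by (metis image_eqI real_norm_def)
  have "w0 s t \<le> \<bar>D\<bar> + B / 2 + \<bar>C\<bar>" if "s \<in> {x..y}" "t \<in> {x..y}" for s t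
  proof -
    have "Q s \<le> D" "Q t \<le> D" "h (s - t) \<le> B" "D \<le> \<bar>D\<bar>" "C \<le> \<bar>C\<bar>"
      using D[OF that(1)] D[OF that(2)] h_bound[of "s - t"] by auto
    then show ?thesis unfolding w0_def by argo
  qed
  then show ?thesis using B_nonneg by (intro exI[of _ "\<bar>D\<bar> + B / 2 + \<bar>C\<bar>"]) auto
qed

text \<open>These measures show that the infimum of the energy is finite, and later serve as test
  measures concentrated near a point off the support.\<close>

lemma uniform_finite_energy:
  assumes "x < y"
  shows "real_distribution (uniform_measure lborel {x..y})" "En (uniform_measure lborel {x..y}) < \<infinity>"
proof -
  let ?U = "uniform_measure lborel {x..y}"
  have p: "prob_space ?U" using assms by (intro prob_space_uniform_measure) auto
  then show rd: "real_distribution ?U"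
    by (simp add: real_distribution_def real_distribution_axioms_def)
  interpret real_distribution ?U by fact
  obtain A where A: "0 \<le> A" "\<And>s t. s\<in>{x..y} \<Longrightarrow> t\<in>{x..y} \<Longrightarrow> w0 s t \<le> A"
    using w0_bounded[of x y] by blast
  have [simp]: "y - x > 0" using assms by simp
  let ?c = "ennreal (A + 8 / (y - x))"
  have "(\<integral>\<^sup>+t. K s t \<partial>?U) \<le> ?c" if s: "s \<in> {x..y}" for s
  proof -
    have "(\<integral>\<^sup>+t. K s t \<partial>?U) = (\<integral>\<^sup>+t. K s t * indicator {x..y} t \<partial>lborel) / ennreal (y - x)"
      using assms by (subst nn_integral_uniform_measure) auto
    also have "(\<integral>\<^sup>+t. K s t * indicator {x..y} t \<partial>lborel)
      \<le> (\<integral>\<^sup>+t. ennreal A * indicator {x..y} t + ennreal (max 0 (- ln \<bar>s - t\<bar>)) \<partial>lborel)"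
    proof (rule nn_integral_mono_AE)
      show "AE t in lborel. K s t * indicator {x..y} t \<le> ennreal A * indicator {x..y} t + ennreal (max 0 (- ln \<bar>s - t\<bar>))"
        using AE_lborel_singleton[of s]
      proof eventually_elim
        case (elim t)
        show ?case
        proof (cases "t \<in> {x..y}")
          case True
          have "w s t \<le> A + max 0 (- ln \<bar>s - t\<bar>)" using A(2)[OF s True] by (simp add: w_def)
          then have "ennreal (w s t) \<le> ennreal A + ennreal (max 0 (- ln \<bar>s - t\<bar>))"
            using A(1) by (subst ennreal_plus[symmetric]) (auto intro!: ennreal_leI simp del: ennreal_plus)
          then show ?thesis using True elim by (simp add: K_def)
        qed auto
      qed
    qed
    also have "\<dots> = ennreal A * ennreal (y - x) + (\<integral>\<^sup>+t. ennreal (max 0 (- ln \<bar>s - t\<bar>)) \<partial>lborel)"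
      using assms by (subst nn_integral_add) (auto simp: nn_integral_cmult_indicator)
    also have "\<dots> \<le> ennreal A * ennreal (y - x) + 8"
      by (intro add_left_mono nn_integral_neg_ln)
    also have "\<dots> = ennreal (A * (y - x) + 8)"
      using A(1) assms by (simp add: ennreal_plus ennreal_mult)
    also have "\<dots> / ennreal (y - x) = ennreal ((A * (y - x) + 8) / (y - x))"
      using A(1) assms by (subst divide_ennreal) auto
    also have "(A * (y - x) + 8) / (y - x) = A + 8 / (y - x)"
      using assms by (simp add: field_simps)
    finally show ?thesis by (simp add: divide_right_mono_ennreal)
  qed
  moreover have "AE s in ?U. s \<in> {x..y}"
    using assms by (intro AE_uniform_measureI) auto
  ultimately have "En ?U \<le> (\<integral>\<^sup>+s. ?c \<partial>?U)"
    unfolding En_def by (intro nn_integral_mono_AE) auto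
  also have "\<dots> < \<infinity>" using emeasure_space_1 by (simp add: ennreal_mult_less_top)
  finally show "En ?U < \<infinity>" .
qed

definition \<mu> :: "real measure" where
  "\<mu> = (SOME \<mu>. real_distribution \<mu> \<and> (\<forall>\<nu>. real_distribution \<nu> \<longrightarrow> En \<mu> \<le> En \<nu>))"

lemma real_distribution_\<mu>: "real_distribution \<mu>" and En_\<mu>_le: "real_distribution \<nu> \<Longrightarrow> En \<mu> \<le> En \<nu>"
  using someI_ex[OF exists_minimizer[OF uniform_finite_energy[of 0 1]]] by (auto simp: \<mu>_def)

sublocale \<mu>: real_distribution \<mu> by (rule real_distribution_\<mu>)

lemma En_\<mu>_finite: "En \<mu> < \<infinity>"
  using En_\<mu>_le[OF uniform_finite_energy(1)] uniform_finite_energy(2)[of 0 1] by (rule le_less_trans) auto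

text \<open>The hypothesis says that both pairs are in the same order, so their distances average
  and concavity of ln has the right sign. Q gains \<open>a / 8\<close> times the squared
  displacements; h loses \<open>M / 8\<close> times the square of their difference, hence at most
  \<open>M / 4\<close> times their squares. If one of the pairs lies on the diagonal, the right-hand
  side is infinite.\<close>

lemma K_midpoint:
  assumes "0 \<le> (s - t) * (s' - t')"
  shows "2 * K ((s + s') / 2) ((t + t') / 2) + ennreal ((a - 2 * M) / 8 * ((s - s')\<^sup>2 + (t - t')\<^sup>2))
    \<le> K s t + K s' t'"
proof (cases "s = t \<or> s' = t'")
  case False
  define p q where "p = \<bar>s - t\<bar>" and "q = \<bar>s' - t'\<bar>"
  have pq: "p > 0" "q > 0" using False by (auto simp: p_def q_def)
  have sg: "(s > t \<and> s' > t') \<or> (s < t \<and> s' < t')"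
    using False assms by (auto simp: zero_le_mult_iff)
  then have eq: "\<bar>(s + s') / 2 - (t + t') / 2\<bar> = (p + q) / 2" and ne: "(s + s') / 2 \<noteq> (t + t') / 2"
    by (auto simp: p_def q_def abs_if field_simps)
  have "(ln p + ln q) / 2 = ln (sqrt (p * q))" using pq by (simp add: ln_sqrt ln_mult)
  also have "\<dots> \<le> ln ((p + q) / 2)"
    using pq arith_geo_mean_sqrt[of p q] by (subst ln_le_cancel_iff) auto
  finally have ln: "(ln p + ln q) / 2 \<le> ln ((p + q) / 2)" .
  have "M / 8 * ((s - t) - (s' - t'))\<^sup>2 \<le> M / 8 * (2 * ((s - s')\<^sup>2 + (t - t')\<^sup>2))"
  proof (intro mult_left_mono)
    have "0 \<le> ((s - s') + (t - t'))\<^sup>2" by simp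
    then show "((s - t) - (s' - t'))\<^sup>2 \<le> 2 * ((s - s')\<^sup>2 + (t - t')\<^sup>2)"
      by (simp add: power2_eq_square algebra_simps)
  qed (use M_nonneg in auto)
  moreover have "h ((s + s') / 2 - (t + t') / 2) \<le> (h (s - t) + h (s' - t')) / 2 + M / 8 * ((s - t) - (s' - t'))\<^sup>2"
  proof -
    have "(s + s') / 2 - (t + t') / 2 = ((s - t) + (s' - t')) / 2" by argo
    then show ?thesis using h_midpoint[of "s - t" "s' - t'"] by (simp only:)
  qed
  ultimately have "2 * w ((s + s') / 2) ((t + t') / 2) + (a - 2 * M) / 8 * ((s - s')\<^sup>2 + (t - t')\<^sup>2)
      \<le> w s t + w s' t'"
    using Q_midpoint[of s s'] Q_midpoint[of t t'] ln
    unfolding w_def w0_def eq by (simp add: field_simps flip: p_def q_def)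
  then have "ennreal (2 * w ((s + s') / 2) ((t + t') / 2) + (a - 2 * M) / 8 * ((s - s')\<^sup>2 + (t - t')\<^sup>2))
      \<le> ennreal (w s t + w s' t')" by (rule ennreal_leI)
  then show ?thesis
    using False ne M_nonneg a_gt by (simp add: K_def ennreal_plus ennreal_mult w_nonneg)
qed (auto simp: K_def)

lemma En_distr:
  assumes [measurable]: "X \<in> borel_measurable unit_measure"
  shows "En (distr unit_measure borel X) = (\<integral>\<^sup>+u. \<integral>\<^sup>+v. K (X u) (X v) \<partial>unit_measure \<partial>unit_measure)"
proof -
  interpret D: real_distribution "distr unit_measure borel X"
    by (intro real_distribution_distr) (auto simp: unit_measure.prob_space_axioms)
  have "(\<integral>\<^sup>+t. K s t \<partial>distr unit_measure borel X) = (\<integral>\<^sup>+v. K s (X v) \<partial>unit_measure)" for s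
    by (subst nn_integral_distr) auto
  moreover have "(\<lambda>s. \<integral>\<^sup>+v. K s (X v) \<partial>unit_measure) \<in> borel_measurable borel"
    by measurable
  ultimately show ?thesis unfolding En_def
    by (simp add: nn_integral_distr)
qed

text \<open>Two quantile functions increase together, so \<open>K_midpoint\<close> applies to every
  pair (u, v). Integration collects the quadratic term once from u and once from v, which doubles
  its constant.\<close>

lemma En_qmid:
  assumes rd[measurable]: "real_distribution \<nu>" "real_distribution \<nu>'"
  shows "2 * En (qmid \<nu> \<nu>') + ennreal ((a - 2 * M) / 4) * qdist \<nu> \<nu>' \<le> En \<nu> + En \<nu>'"
proof -
  let ?U = unit_measure and ?X = "quantile \<nu>" and ?Y = "quantile \<nu>'"
  let ?d = "\<lambda>u. ennreal ((?X u - ?Y u)\<^sup>2)" and ?c = "ennreal ((a - 2 * M) / 8)"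
  have c: "?c + ?c = ennreal ((a - 2 * M) / 4)"
    using a_gt M_nonneg by (subst ennreal_plus[symmetric]) auto
  have mid: "En (qmid \<nu> \<nu>') = (\<integral>\<^sup>+u. \<integral>\<^sup>+v. K ((?X u + ?Y u) / 2) ((?X v + ?Y v) / 2) \<partial>?U \<partial>?U)"
    unfolding qmid_def by (rule En_distr) measurable
  have En: "En \<nu> = (\<integral>\<^sup>+u. \<integral>\<^sup>+v. K (?X u) (?X v) \<partial>?U \<partial>?U)"
    and En': "En \<nu>' = (\<integral>\<^sup>+u. \<integral>\<^sup>+v. K (?Y u) (?Y v) \<partial>?U \<partial>?U)"
    using En_distr[of ?X] En_distr[of ?Y] rd by (simp_all add: distr_quantile)
  have "2 * En (qmid \<nu> \<nu>') + ennreal ((a - 2 * M) / 4) * qdist \<nu> \<nu>'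
     = 2 * En (qmid \<nu> \<nu>') + (?c * qdist \<nu> \<nu>' + ?c * qdist \<nu> \<nu>')"
    by (simp add: c[symmetric] distrib_right)
  also have "\<dots> = (\<integral>\<^sup>+u. \<integral>\<^sup>+v. 2 * K ((?X u + ?Y u) / 2) ((?X v + ?Y v) / 2) + (?c * ?d u + ?c * ?d v) \<partial>?U \<partial>?U)"
    unfolding mid qdist_def
    using unit_measure.emeasure_space_1
    by (simp add: nn_integral_add nn_integral_cmult)
  also have "\<dots> \<le> (\<integral>\<^sup>+u. \<integral>\<^sup>+v. K (?X u) (?X v) + K (?Y u) (?Y v) \<partial>?U \<partial>?U)"
  proof (intro nn_integral_mono)
    fix u v assume uv: "u \<in> space ?U" "v \<in> space ?U"
    have "0 \<le> (?X u - ?X v) * (?Y u - ?Y v)"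
      using uv quantile_mono[OF rd(1), of u v] quantile_mono[OF rd(1), of v u]
        quantile_mono[OF rd(2), of u v] quantile_mono[OF rd(2), of v u]
      by (cases "u \<le> v") (auto intro: mult_nonneg_nonneg mult_nonpos_nonpos)
    from K_midpoint[OF this] 
    show "2 * K ((?X u + ?Y u) / 2) ((?X v + ?Y v) / 2) + (?c * ?d u + ?c * ?d v)
      \<le> K (?X u) (?X v) + K (?Y u) (?Y v)"
      using a_gt M_nonneg
      by (simp add: ennreal_mult ennreal_plus distrib_left del: times_divide_eq_left)
  qed
  also have "\<dots> = En \<nu> + En \<nu>'"
    unfolding En En' by (simp add: nn_integral_add)
  finally show ?thesis .
qed

text \<open>Minimality of \<mu> is applied at the displacement midpoint; of the two copies of
  \<open>En \<mu>\<close> so obtained, one cancels because it is finite.\<close>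

lemma En_gap:
  assumes "real_distribution \<nu>"
  shows "En \<mu> + ennreal ((a - 2 * M) / 4) * qdist \<mu> \<nu> \<le> En \<nu>"
proof -
  have [measurable]: "real_distribution \<mu>" "real_distribution \<nu>" using assms real_distribution_\<mu> by auto
  have "real_distribution (qmid \<mu> \<nu>)"
    unfolding qmid_def by (intro real_distribution_distr unit_measure.prob_space_axioms) measurable
  then have "2 * En \<mu> + ennreal ((a - 2 * M) / 4) * qdist \<mu> \<nu>
      \<le> 2 * En (qmid \<mu> \<nu>) + ennreal ((a - 2 * M) / 4) * qdist \<mu> \<nu>"
    by (intro add_right_mono mult_left_mono En_\<mu>_le) auto
  also have "\<dots> \<le> En \<mu> + En \<nu>" by (rule En_qmid) (auto simp: assms real_distribution_\<mu>)
  finally have "En \<mu> + (En \<mu> + ennreal ((a - 2 * M) / 4) * qdist \<mu> \<nu>) \<le> En \<mu> + En \<nu>"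
    by (simp only: mult_2 add.assoc)
  then show ?thesis using En_\<mu>_finite by (subst (asm) ennreal_add_left_cancel_le) auto
qed

lemma En_minimizer_unique:
  assumes "real_distribution \<nu>" "En \<nu> \<le> En \<mu>"
  shows "\<nu> = \<mu>"
proof -
  have "En \<mu> + ennreal ((a - 2 * M) / 4) * qdist \<mu> \<nu> \<le> En \<mu> + 0"
    using order_trans[OF En_gap[OF assms(1)] assms(2)] by simp
  then have "ennreal ((a - 2 * M) / 4) * qdist \<mu> \<nu> = 0"
    using En_\<mu>_finite by (subst (asm) ennreal_add_left_cancel_le) auto
  then have "qdist \<mu> \<nu> = 0" using a_gt M_nonneg by (auto simp: ennreal_eq_0_iff)
  from qdist_eq_0[OF real_distribution_\<mu> assms(1) this] show ?thesis ..
qed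

text \<open>Reflection preserves the kernel, so the reflected measure is a minimizer as
  well.\<close>

lemma \<mu>_even: "distr \<mu> borel uminus = \<mu>"
proof (rule En_minimizer_unique)
  show rd: "real_distribution (distr \<mu> borel uminus)"
    by (intro real_distribution_distr \<mu>.prob_space_axioms) measurable
  interpret D: real_distribution "distr \<mu> borel uminus" by fact
  have K: "K (- s) (- t) = K s t" for s t
    using Q_even h_even[of "s - t"] by (simp add: K_def w_def w0_def abs_minus_commute)
  have "(\<integral>\<^sup>+t. K s t \<partial>distr \<mu> borel uminus) = (\<integral>\<^sup>+v. K s (- v) \<partial>\<mu>)" for s
    by (subst nn_integral_distr) auto
  then have "En (distr \<mu> borel uminus) = (\<integral>\<^sup>+u. \<integral>\<^sup>+v. K (- u) (- v) \<partial>\<mu> \<partial>\<mu>)"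
    unfolding En_def by (simp add: nn_integral_distr)
  then show "En (distr \<mu> borel uminus) \<le> En \<mu>" by (simp add: K En_def)
qed

end

section \<open>The effective potential and the support\<close>

lemma closed_measure_support: "closed (measure_support \<nu>)"
proof -
  have "- measure_support \<nu> = \<Union>{U. open U \<and> emeasure \<nu> U = 0}"
    by (auto simp: measure_support_def zero_less_iff_neq_zero)
  then show ?thesis unfolding closed_def by auto
qed

text \<open>The complement of the support is a union of open null sets, and by the Lindelof property
  countably many of them suffice.\<close>

lemma AE_measure_support:
  assumes "real_distribution \<nu>"
  shows "AE x in \<nu>. x \<in> measure_support \<nu>"
proof -
  interpret real_distribution \<nu> by fact
  let ?F = "{U. open U \<and> emeasure \<nu> U = 0}"
  obtain F' where F': "F' \<subseteq> ?F" "countable F'" "\<Union>F' = \<Union>?F"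
    using Lindelof[of ?F] by blast
  have "\<Union>F' \<in> null_sets \<nu>"
    using F' by (intro null_sets_UN'[of F' "\<lambda>x. x", simplified]) (auto simp: null_sets_def)
  moreover have "- measure_support \<nu> = \<Union>?F"
    by (auto simp: measure_support_def zero_less_iff_neq_zero)
  ultimately show ?thesis
    by (intro AE_I'[of "\<Union>F'"]) (auto simp: F'(3))
qed

text \<open>Supplies the competitors for the first variation. The mixture is obtained by tossing a
  coin with bias \<theta> and then drawing from \<nu> or \<mu>.\<close>

lemma exists_mixture:
  assumes "real_distribution \<mu>" "real_distribution \<nu>" "0 \<le> \<theta>" "\<theta> \<le> 1"
  obtains \<rho> where "real_distribution \<rho>"
    "\<And>f. f \<in> borel_measurable borel \<Longrightarrow>
      (\<integral>\<^sup>+x. f x \<partial>\<rho>) = ennreal \<theta> * (\<integral>\<^sup>+x. f x \<partial>\<nu>) + ennreal (1 - \<theta>) * (\<integral>\<^sup>+x. f x \<partial>\<mu>)"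
proof -
  interpret m: real_distribution \<mu> by fact
  interpret n: real_distribution \<nu> by fact
  define N where "N b = (if b then \<nu> else \<mu>)" for b
  have N: "N \<in> measurable (measure_pmf (bernoulli_pmf \<theta>)) (prob_algebra borel)"
    by (simp add: N_def space_prob_algebra m.prob_space_axioms n.prob_space_axioms)
  note N' = measurable_prob_algebraD[OF N]
  let ?R = "measure_pmf (bernoulli_pmf \<theta>) \<bind> N"
  have p: "prob_space ?R"
    by (rule prob_space.prob_space_bind[OF prob_space_measure_pmf _ N'])
       (auto simp: N_def m.prob_space_axioms n.prob_space_axioms)
  have s: "sets ?R = sets borel"
    by (rule sets_bind) (auto simp: N_def)
  show ?thesis
  proof (rule that[of ?R])
    show "real_distribution ?R" using p s by (simp add: real_distribution_def real_distribution_axioms_def)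
    fix f :: "real \<Rightarrow> ennreal" assume f: "f \<in> borel_measurable borel"
    show "(\<integral>\<^sup>+x. f x \<partial>?R) = ennreal \<theta> * (\<integral>\<^sup>+x. f x \<partial>\<nu>) + ennreal (1 - \<theta>) * (\<integral>\<^sup>+x. f x \<partial>\<mu>)"
      using assms by (subst nn_integral_bind[OF f N']) (auto simp: N_def mult.commute)
  qed
qed

section \<open>Euler-Lagrange conditions and the shape of the support\<close>

context convex_ensemble begin

text \<open>Up to an additive constant this is half of the effective potential, the first variation
  of I at \<mu>. Its \<mu>-mean \<open>E0\<close> is the Euler-Lagrange constant.\<close>

definition \<Psi> :: "real \<Rightarrow> ennreal" where "\<Psi> x = (\<integral>\<^sup>+t. K x t \<partial>\<mu>)"

definition E0 :: real where "E0 = enn2real (En \<mu>)"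

lemma En_\<mu>: "En \<mu> = ennreal E0" and E0_nonneg: "0 \<le> E0"
  using En_\<mu>_finite by (auto simp: E0_def)

lemma \<Psi>_measurable[measurable]: "\<Psi> \<in> borel_measurable borel"
  unfolding \<Psi>_def[abs_def] by measurable

lemma nn_integral_\<Psi>: "(\<integral>\<^sup>+x. \<Psi> x \<partial>\<mu>) = ennreal E0"
  using En_\<mu> by (simp add: \<Psi>_def En_def)

text \<open>Along the mixtures of \<mu> and \<nu> the energy is a quadratic polynomial in \<theta>
  with slope \<open>2 * (J - E0)\<close> at 0, and finiteness of \<open>En \<nu>\<close> keeps its
  second-order coefficient finite. A negative slope would contradict minimality.\<close>

lemma nn_integral_\<Psi>_ge:
  assumes rd: "real_distribution \<nu>" and fin: "En \<nu> < \<infinity>"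
  shows "ennreal E0 \<le> (\<integral>\<^sup>+x. \<Psi> x \<partial>\<nu>)"
proof (cases "(\<integral>\<^sup>+x. \<Psi> x \<partial>\<nu>) = \<infinity>")
  case False
  interpret n: real_distribution \<nu> by fact
  interpret mn: pair_sigma_finite \<mu> \<nu> ..
  obtain J where J: "(\<integral>\<^sup>+x. \<Psi> x \<partial>\<nu>) = ennreal J" "0 \<le> J"
    using False by (cases "\<integral>\<^sup>+x. \<Psi> x \<partial>\<nu>") auto
  obtain F where F: "En \<nu> = ennreal F" "0 \<le> F" using fin by (cases "En \<nu>") auto
  have J': "(\<integral>\<^sup>+s. \<integral>\<^sup>+t. K s t \<partial>\<nu> \<partial>\<mu>) = ennreal J"
  proof -
    have "(\<integral>\<^sup>+s. \<integral>\<^sup>+t. K s t \<partial>\<nu> \<partial>\<mu>) = (\<integral>\<^sup>+t. \<integral>\<^sup>+s. K s t \<partial>\<mu> \<partial>\<nu>)"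
      by (rule mn.Fubini'[symmetric]) measurable
    also have "\<dots> = (\<integral>\<^sup>+x. \<Psi> x \<partial>\<nu>)" unfolding \<Psi>_def by (subst K_commute) simp
    finally show ?thesis by (simp add: J)
  qed
  have q: "E0 \<le> \<theta>\<^sup>2 * F + 2 * \<theta> * (1 - \<theta>) * J + (1 - \<theta>)\<^sup>2 * E0" if th: "0 < \<theta>" "\<theta> < 1" for \<theta>
  proof -
    obtain \<rho> where rho: "real_distribution \<rho>"
      "\<And>f. f \<in> borel_measurable borel \<Longrightarrow>
        (\<integral>\<^sup>+x. f x \<partial>\<rho>) = ennreal \<theta> * (\<integral>\<^sup>+x. f x \<partial>\<nu>) + ennreal (1 - \<theta>) * (\<integral>\<^sup>+x. f x \<partial>\<mu>)"
      using exists_mixture[OF real_distribution_\<mu> rd, of \<theta>] th by auto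
    have "En \<rho> = (\<integral>\<^sup>+s. (ennreal \<theta> * (\<integral>\<^sup>+t. K s t \<partial>\<nu>) + ennreal (1 - \<theta>) * (\<integral>\<^sup>+t. K s t \<partial>\<mu>)) \<partial>\<rho>)"
      unfolding En_def by (intro nn_integral_cong rho(2)) measurable
    also have "\<dots> = ennreal \<theta> * (ennreal \<theta> * En \<nu> + ennreal (1 - \<theta>) * (\<integral>\<^sup>+s. \<Psi> s \<partial>\<nu>))
        + ennreal (1 - \<theta>) * (ennreal \<theta> * (\<integral>\<^sup>+s. \<integral>\<^sup>+t. K s t \<partial>\<nu> \<partial>\<mu>) + ennreal (1 - \<theta>) * En \<mu>)"
      unfolding En_def \<Psi>_def by (subst rho(2)) (simp_all add: nn_integral_add nn_integral_cmult)
    also have "\<dots> = ennreal (\<theta> * (\<theta> * F + (1 - \<theta>) * J) + (1 - \<theta>) * (\<theta> * J + (1 - \<theta>) * E0))"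
      unfolding J J' F En_\<mu> using th J F E0_nonneg by (simp add: ennreal_plus ennreal_mult)
    finally have "ennreal E0 \<le> \<dots>"
      using En_\<mu>_le[OF rho(1)] unfolding En_\<mu> by simp
    then have "E0 \<le> \<theta> * (\<theta> * F + (1 - \<theta>) * J) + (1 - \<theta>) * (\<theta> * J + (1 - \<theta>) * E0)"
      using th J F E0_nonneg by (subst (asm) ennreal_le_iff) auto
    then show ?thesis by (simp add: power2_eq_square algebra_simps)
  qed
  have "E0 \<le> J"
  proof (rule ccontr)
    assume "\<not> E0 \<le> J"
    then have d: "0 < E0 - J" by simp
    \<comment> \<open>With this D the choice of \<theta> makes the second-order term at most
      \<open>E0 - J\<close>, half of the first-order gain. The summand 1 keeps D positive.\<close>
    define D where "D = \<bar>F - 2 * J + E0\<bar> + 1"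
    define \<theta> where "\<theta> = min (1/2) ((E0 - J) / D)"
    have D: "D > 0" by (simp add: D_def add_nonneg_pos)
    have th: "0 < \<theta>" "\<theta> < 1" using d D by (auto simp: \<theta>_def)
    have "\<theta> * (2 * (E0 - J)) \<le> \<theta> * (\<theta> * (F - 2 * J + E0))"
      using q[OF th] by (simp add: power2_eq_square algebra_simps)
    then have "2 * (E0 - J) \<le> \<theta> * (F - 2 * J + E0)" using th by simp
    also have "\<dots> \<le> \<theta> * D" using th by (intro mult_left_mono) (auto simp: D_def)
    also have "\<dots> \<le> (E0 - J) / D * D" using D by (intro mult_right_mono) (auto simp: \<theta>_def)
    also have "\<dots> = E0 - J" using D by simp
    finally show False using d by simp
  qed
  then show ?thesis unfolding J by (rule ennreal_leI)
qed simp

text \<open>If \<open>\<Psi> < E0\<close> had \<mu>-probability p > 0, conditioning \<mu> on this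
  set would multiply the energy by at most \<open>1 / p\<^sup>2\<close> and give a finite-energy
  measure with \<Psi>-mean below \<open>E0\<close>. So \<Psi> is at least \<open>E0\<close> almost
  everywhere, and its mean forces equality.\<close>

lemma AE_\<Psi>_eq: "AE x in \<mu>. \<Psi> x = ennreal E0"
proof -
  let ?B = "{x. \<Psi> x < ennreal E0}"
  have B[measurable]: "?B \<in> sets borel" by measurable
  have "emeasure \<mu> ?B = 0"
  proof (rule ccontr)
    assume ne: "emeasure \<mu> ?B \<noteq> 0"
    define p where "p = measure \<mu> ?B"
    have p: "0 < p" "emeasure \<mu> ?B = ennreal p"
      using ne by (auto simp: p_def \<mu>.emeasure_eq_measure zero_less_measure_iff)
    let ?N = "uniform_measure \<mu> ?B"
    have rd: "real_distribution ?N"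
      using ne by (auto simp: real_distribution_def real_distribution_axioms_def intro!: prob_space_uniform_measure)
    have En: "En ?N \<le> (En \<mu> / ennreal p) / ennreal p"
    proof -
      have "(\<integral>\<^sup>+t. K s t \<partial>?N) \<le> \<Psi> s / ennreal p" for s
      proof -
        have "(\<integral>\<^sup>+t. K s t \<partial>?N) = (\<integral>\<^sup>+t. K s t * indicator ?B t \<partial>\<mu>) / ennreal p"
          by (subst nn_integral_uniform_measure) (auto simp: p)
        also have "\<dots> \<le> \<Psi> s / ennreal p" unfolding \<Psi>_def
          by (intro divide_right_mono_ennreal nn_integral_mono) (auto simp: indicator_def)
        finally show ?thesis .
      qed
      then have "En ?N \<le> (\<integral>\<^sup>+s. \<Psi> s / ennreal p \<partial>?N)"
        unfolding En_def by (intro nn_integral_mono)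
      also have "\<dots> = (\<integral>\<^sup>+s. \<Psi> s / ennreal p * indicator ?B s \<partial>\<mu>) / ennreal p"
        by (subst nn_integral_uniform_measure) (auto simp: p)
      also have "\<dots> \<le> (\<integral>\<^sup>+s. \<Psi> s / ennreal p \<partial>\<mu>) / ennreal p"
        by (intro divide_right_mono_ennreal nn_integral_mono) (auto simp: indicator_def)
      also have "(\<integral>\<^sup>+s. \<Psi> s / ennreal p \<partial>\<mu>) = En \<mu> / ennreal p"
        by (subst nn_integral_divide) (auto simp: En_\<mu> nn_integral_\<Psi>)
      finally show ?thesis .
    qed
    also have "\<dots> < \<infinity>"
      using p E0_nonneg by (simp add: En_\<mu> divide_ennreal)
    finally have "ennreal E0 \<le> (\<integral>\<^sup>+x. \<Psi> x \<partial>?N)" by (intro nn_integral_\<Psi>_ge rd)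
    moreover have "(\<integral>\<^sup>+x. \<Psi> x \<partial>?N) = (\<integral>\<^sup>+x. \<Psi> x * indicator ?B x \<partial>\<mu>) / ennreal p"
      by (subst nn_integral_uniform_measure) (auto simp: p)
    moreover have "(\<integral>\<^sup>+x. \<Psi> x * indicator ?B x \<partial>\<mu>) < ennreal E0 * ennreal p"
    proof -
      have "(\<integral>\<^sup>+x. \<Psi> x * indicator ?B x \<partial>\<mu>) < (\<integral>\<^sup>+x. ennreal E0 * indicator ?B x \<partial>\<mu>)"
      proof (rule nn_integral_less)
        have "(\<integral>\<^sup>+x. \<Psi> x * indicator ?B x \<partial>\<mu>) \<le> (\<integral>\<^sup>+x. \<Psi> x \<partial>\<mu>)"
          by (intro nn_integral_mono) (auto simp: indicator_def)
        then show "(\<integral>\<^sup>+x. \<Psi> x * indicator ?B x \<partial>\<mu>) \<noteq> \<infinity>"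
          by (auto simp: nn_integral_\<Psi> top_unique)
        show "AE x in \<mu>. \<Psi> x * indicator ?B x \<le> ennreal E0 * indicator ?B x"
          by (auto simp: indicator_def intro: less_imp_le)
        show "\<not> (AE x in \<mu>. ennreal E0 * indicator ?B x \<le> \<Psi> x * indicator ?B x)"
        proof
          assume "AE x in \<mu>. ennreal E0 * indicator ?B x \<le> \<Psi> x * indicator ?B x"
          then have "AE x in \<mu>. x \<notin> ?B"
            by eventually_elim (auto simp: indicator_def split: if_splits)
          then show False using ne by (subst (asm) AE_iff_measurable[OF _ refl]) auto
        qed
      qed measurable
      then show ?thesis by (simp add: nn_integral_cmult_indicator p)
    qed
    ultimately have le: "ennreal E0 * ennreal p \<le> (\<integral>\<^sup>+x. \<Psi> x * indicator ?B x \<partial>\<mu>) / ennreal p * ennreal p"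
      and lt: "(\<integral>\<^sup>+x. \<Psi> x * indicator ?B x \<partial>\<mu>) < ennreal E0 * ennreal p"
      by (auto intro!: mult_right_mono)
    note le
    also have "(\<integral>\<^sup>+x. \<Psi> x * indicator ?B x \<partial>\<mu>) / ennreal p * ennreal p = (\<integral>\<^sup>+x. \<Psi> x * indicator ?B x \<partial>\<mu>)"
      using p by (subst mult.commute, subst ennreal_times_divide, subst mult.commute, subst mult_divide_eq_ennreal) auto
    finally show False using lt by simp
  qed
  then have ge: "AE x in \<mu>. ennreal E0 \<le> \<Psi> x"
    by (subst AE_iff_measurable[OF _ refl]) (auto simp: not_le)
  have "AE x in \<mu>. \<Psi> x \<le> ennreal E0"
  proof (rule ccontr)
    assume "\<not> (AE x in \<mu>. \<Psi> x \<le> ennreal E0)"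
    then have "(\<integral>\<^sup>+x. ennreal E0 \<partial>\<mu>) < (\<integral>\<^sup>+x. \<Psi> x \<partial>\<mu>)"
      using ge \<mu>.emeasure_space_1 by (intro nn_integral_less) auto
    then show False using \<mu>.emeasure_space_1 by (simp add: nn_integral_\<Psi>)
  qed
  with ge show ?thesis by eventually_elim auto
qed

lemma wtrunc_measurable_section[measurable]: "wtrunc n x \<in> borel_measurable borel"
  using measurable_compose[OF _ wtrunc_measurable[of n], of "\<lambda>t. (x, t)" borel] by simp

lemma isCont_wtrunc_potential: "isCont (\<lambda>x. LINT t|\<mu>. wtrunc n x t) x"
  unfolding continuous_at_sequentially comp_def
proof safe
  fix y assume y: "y \<longlonglongrightarrow> x"

  show "(\<lambda>k. LINT t|\<mu>. wtrunc n (y k) t) \<longlonglongrightarrow> (LINT t|\<mu>. wtrunc n x t)"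
  proof (rule integral_dominated_convergence[where w="\<lambda>_. real n"])
    show "AE t in \<mu>. (\<lambda>k. wtrunc n (y k) t) \<longlonglongrightarrow> wtrunc n x t"
    proof (intro AE_I2)
      fix t
      have "continuous_on UNIV (\<lambda>x. wtrunc n x t)" by (intro wtrunc_continuous continuous_intros)
      then have "isCont (\<lambda>x. wtrunc n x t) x" by (simp add: continuous_on_eq_continuous_at)
      from isCont_tendsto_compose[OF this y] show "(\<lambda>k. wtrunc n (y k) t) \<longlonglongrightarrow> wtrunc n x t" .
    qed
  qed (auto simp: abs_of_nonneg wtrunc_nonneg wtrunc_le)
qed

lemma \<Psi>_SUP: "\<Psi> x = (SUP n. ennreal (LINT t|\<mu>. wtrunc n x t))"
proof -

  have int: "integrable \<mu> (\<lambda>t. wtrunc n x t)" for n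
    by (intro \<mu>.integrable_const_bound[where B="real n"]) (auto simp: abs_of_nonneg wtrunc_nonneg wtrunc_le)
  have "\<Psi> x = (SUP n. \<integral>\<^sup>+t. ennreal (wtrunc n x t) \<partial>\<mu>)"
    unfolding \<Psi>_def SUP_wtrunc[symmetric]
    using incseq_wtrunc by (intro nn_integral_monotone_convergence_SUP) (auto simp: incseq_def le_fun_def)
  then show ?thesis
    by (simp add: nn_integral_eq_integral[OF int] wtrunc_nonneg)
qed

abbreviation S :: "real set" where "S \<equiv> measure_support \<mu>"

lemma AE_S: "AE x in \<mu>. x \<in> S" by (rule AE_measure_support[OF real_distribution_\<mu>])

text \<open>\<Psi> is a supremum of continuous truncated potentials. The set where one of them
  exceeds \<open>E0\<close> is open, and null by \<open>AE_\<Psi>_eq\<close>, so it misses the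
  support.\<close>

lemma \<Psi>_le_support:
  assumes "x \<in> S"
  shows "\<Psi> x \<le> ennreal E0"
proof (rule ccontr)
  assume "\<not> \<Psi> x \<le> ennreal E0"
  then obtain n where n: "E0 < (LINT t|\<mu>. wtrunc n x t)"
    using E0_nonneg by (auto simp: \<Psi>_SUP not_le less_SUP_iff ennreal_less_iff)
  let ?U = "{y. E0 < (LINT t|\<mu>. wtrunc n y t)}"
  have o: "open ?U"
    by (intro open_Collect_less continuous_on_const continuous_at_imp_continuous_on ballI isCont_wtrunc_potential)
  then have "emeasure \<mu> ?U > 0" using assms n by (auto simp: measure_support_def)
  moreover have "AE y in \<mu>. y \<notin> ?U"
    using AE_\<Psi>_eq
  proof eventually_elim
    case (elim y)
    have "ennreal (LINT t|\<mu>. wtrunc n y t) \<le> \<Psi> y" unfolding \<Psi>_SUP by (intro SUP_upper) auto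
    then show ?case using elim E0_nonneg by (simp add: ennreal_le_iff)
  qed
  then have "emeasure \<mu> ?U = 0" using o
    by (subst (asm) AE_iff_measurable[OF _ refl]) auto
  ultimately show False by simp
qed

text \<open>Away from the support the logarithm is regular, so a value of \<Psi> below
  \<open>E0\<close> would persist on a small interval; the uniform measure there has finite energy
  and would contradict \<open>nn_integral_\<Psi>_ge\<close>.\<close>

lemma \<Psi>_ge_off_support:
  assumes "x \<notin> S"
  shows "ennreal E0 \<le> \<Psi> x"
proof (rule ccontr)
  assume lt: "\<not> ennreal E0 \<le> \<Psi> x"
  then obtain p where p: "\<Psi> x = ennreal p" "0 \<le> p" "p < E0"
    using E0_nonneg by (cases "\<Psi> x") (auto simp: not_le ennreal_less_iff)
  obtain r0 where r0: "0 < r0" "\<And>t. t \<in> S \<Longrightarrow> r0 \<le> \<bar>x - t\<bar>"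
  proof -
    have "open (- S)" using closed_measure_support by auto
    then obtain e where "e > 0" "ball x e \<subseteq> - S" using assms by (auto simp: open_contains_ball)
    then show ?thesis by (intro that[of e]) (auto simp: subset_eq dist_real_def not_less[symmetric])
  qed
  \<comment> \<open>Bounds the increase of w from (x, t) to (y, t) for all t in the support at once,
    since \<open>\<bar>y - t\<bar>\<close> is at least
    \<open>\<bar>x - t\<bar> * (1 - \<bar>y - x\<bar> / r0)\<close> there.\<close>
  let ?g = "\<lambda>y. \<bar>Q y - Q x\<bar> / 2 + L * \<bar>y - x\<bar> / 2 - ln (1 - \<bar>y - x\<bar> / r0)"
  have "isCont Q x" using Q_continuous by (simp add: continuous_on_eq_continuous_at)
  then have "isCont ?g x" using r0(1) by (intro continuous_intros) auto
  moreover have "?g x < E0 - p" using p by simp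
  ultimately have "\<forall>\<^sub>F y in at x. ?g y < E0 - p"
    unfolding isCont_def by (rule order_tendstoD(2))
  then obtain d where d: "d > 0" "\<And>y. \<bar>y - x\<bar> < d \<Longrightarrow> ?g y < E0 - p"
  proof -
    from \<open>\<forall>\<^sub>F y in at x. ?g y < E0 - p\<close> obtain d where d: "d > 0"
      "\<forall>y\<in>UNIV. y \<noteq> x \<and> \<bar>y - x\<bar> < d \<longrightarrow> ?g y < E0 - p"
      unfolding eventually_at dist_real_def by blast
    show ?thesis
    proof (rule that[OF d(1)])
      fix y assume "\<bar>y - x\<bar> < d"
      then show "?g y < E0 - p" using d(2) \<open>?g x < E0 - p\<close> by (cases "y = x") auto
    qed
  qed
  define r where "r = min d r0 / 2"
  have r: "0 < r" "r < d" "r < r0" using d r0 by (auto simp: r_def)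
  have cx: "compact {x - r..x + r}" by simp
  have "continuous_on {x - r..x + r} ?g"
    using r r0 by (intro continuous_intros continuous_on_subset[OF Q_continuous]) (auto simp: field_simps abs_if split: if_splits)
  from continuous_attains_sup[OF cx _ this] obtain z where
    z: "z \<in> {x - r..x + r}" "\<And>y. y \<in> {x - r..x + r} \<Longrightarrow> ?g y \<le> ?g z" using r by auto
  define \<eta> where "\<eta> = ?g z"
  have \<eta>: "0 \<le> \<eta>" "\<eta> < E0 - p"
    using z(2)[of x] d(2)[of z] z(1) r by (auto simp: \<eta>_def)
  have le: "\<Psi> y \<le> ennreal (p + \<eta>)" if y: "y \<in> {x - r..x + r}" for y
  proof -
    have "AE t in \<mu>. K y t \<le> K x t + ennreal \<eta>"
      using AE_S
    proof eventually_elim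
      case (elim t)
      let ?u = "\<bar>y - x\<bar>"
      have u: "?u < r0" using y r by auto
      have xt: "r0 \<le> \<bar>x - t\<bar>" by (rule r0(2)[OF elim])
      have "\<bar>x - t\<bar> * (1 - ?u / r0) = \<bar>x - t\<bar> - ?u * (\<bar>x - t\<bar> / r0)" using r0 by (simp add: field_simps)
      also have "\<dots> \<le> \<bar>x - t\<bar> - ?u * 1"
        using xt r0 by (intro diff_left_mono mult_left_mono) (auto simp: field_simps)
      also have "\<dots> \<le> \<bar>y - t\<bar>" by (simp add: abs_if)
      finally have "\<bar>x - t\<bar> * (1 - ?u / r0) \<le> \<bar>y - t\<bar>" .
      moreover have pos: "0 < 1 - ?u / r0" "0 < \<bar>x - t\<bar>" using u r0 xt by (auto simp: field_simps)
      ultimately have "ln \<bar>x - t\<bar> + ln (1 - ?u / r0) \<le> ln \<bar>y - t\<bar>" and ne: "y \<noteq> t"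
        using u r0(1) xt by (auto simp flip: ln_mult_pos)
      moreover have "h (y - t) \<le> h (x - t) + L * ?u" using h_lipschitz[of "y - t" "x - t"] by simp
      moreover have "Q y \<le> Q x + \<bar>Q y - Q x\<bar>" by simp
      ultimately have "w y t \<le> w x t + ?g y" unfolding w_def w0_def by (simp add: field_simps)
      also have "\<dots> \<le> w x t + \<eta>" using z(2)[OF y] by (simp add: \<eta>_def)
      finally show ?case using ne xt r0(1) \<eta>
        by (auto simp: K_def w_nonneg simp flip: ennreal_plus intro!: ennreal_leI)
    qed
    then have "\<Psi> y \<le> (\<integral>\<^sup>+t. K x t + ennreal \<eta> \<partial>\<mu>)" unfolding \<Psi>_def by (rule nn_integral_mono_AE)
    also have "\<dots> = \<Psi> x + ennreal \<eta>"
      unfolding \<Psi>_def using \<mu>.emeasure_space_1 by (subst nn_integral_add) auto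
    finally show ?thesis using p \<eta> by (simp add: ennreal_plus)
  qed
  let ?U = "uniform_measure lborel {x - r..x + r}"
  have xr: "x - r < x + r" using r by simp
  note U = uniform_finite_energy[OF xr]
  interpret U: real_distribution ?U by (rule U)
  have "AE y in ?U. y \<in> {x - r..x + r}" using r by (intro AE_uniform_measureI) auto
  then have "AE y in ?U. \<Psi> y \<le> ennreal (p + \<eta>)" by eventually_elim (rule le)
  then have "(\<integral>\<^sup>+y. \<Psi> y \<partial>?U) \<le> (\<integral>\<^sup>+y. ennreal (p + \<eta>) \<partial>?U)" by (rule nn_integral_mono_AE)
  also have "\<dots> = ennreal (p + \<eta>)" using U.emeasure_space_1 by simp
  finally have "ennreal E0 \<le> ennreal (p + \<eta>)" using nn_integral_\<Psi>_ge[OF U] by (rule order_trans[rotated])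
  then have "E0 \<le> p + \<eta>" using p \<eta> by (subst (asm) ennreal_le_iff) auto
  then show False using \<eta> by linarith
qed

text \<open>\<open>K_midpoint\<close> with the second point held fixed. The order condition then
  says that almost no t lies strictly between s and s'.\<close>

lemma \<Psi>_midpoint:
  assumes "AE t in \<mu>. 0 \<le> (s - t) * (s' - t)"
  shows "2 * \<Psi> ((s + s') / 2) + ennreal ((a - 2 * M) / 8 * (s - s')\<^sup>2) \<le> \<Psi> s + \<Psi> s'"
proof -
  have "2 * \<Psi> ((s + s') / 2) + ennreal ((a - 2 * M) / 8 * (s - s')\<^sup>2)
    = (\<integral>\<^sup>+t. 2 * K ((s + s') / 2) t + ennreal ((a - 2 * M) / 8 * (s - s')\<^sup>2) \<partial>\<mu>)"
    unfolding \<Psi>_def using \<mu>.emeasure_space_1 by (simp add: nn_integral_add nn_integral_cmult)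
  also have "\<dots> \<le> (\<integral>\<^sup>+t. K s t + K s' t \<partial>\<mu>)"
  proof (rule nn_integral_mono_AE)
    show "AE t in \<mu>. 2 * K ((s + s') / 2) t + ennreal ((a - 2 * M) / 8 * (s - s')\<^sup>2) \<le> K s t + K s' t"
      using assms
    proof eventually_elim
      case (elim t)
      from K_midpoint[OF elim] show ?case by simp
    qed
  qed
  also have "\<dots> = \<Psi> s + \<Psi> s'" unfolding \<Psi>_def by (intro nn_integral_add) auto
  finally show ?thesis .
qed

text \<open>\<Psi> grows at least like \<open>a / 8 * x\<^sup>2\<close> but is at most
  \<open>E0\<close> on the support.\<close>

lemma support_bounded:
  assumes "x \<in> S"
  shows "\<bar>x\<bar> \<le> sqrt (8 / a * E0)"
proof -
  have "ennreal (a / 8 * x\<^sup>2) = (\<integral>\<^sup>+t. ennreal (a / 8 * x\<^sup>2) \<partial>\<mu>)"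
    using \<mu>.emeasure_space_1 by simp
  also have "\<dots> \<le> \<Psi> x" unfolding \<Psi>_def
    using a_pos by (intro nn_integral_mono order_trans[OF _ K_ge] ennreal_leI) (auto intro!: mult_left_mono)
  also have "\<dots> \<le> ennreal E0" by (rule \<Psi>_le_support[OF assms])
  finally have "x\<^sup>2 \<le> 8 / a * E0" using a_pos E0_nonneg by (simp add: field_simps)
  then have "sqrt (x\<^sup>2) \<le> sqrt (8 / a * E0)" by (rule real_sqrt_le_mono)
  then show ?thesis by simp
qed

lemma support_nonempty: "S \<noteq> {}"
  using AE_S \<mu>.AE_False by auto

lemma support_even: "x \<in> S \<Longrightarrow> - x \<in> S"
proof -
  assume x: "x \<in> S"
  show "- x \<in> S" unfolding measure_support_def
  proof safe
    fix U :: "real set" assume U: "open U" "- x \<in> U"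
    have o: "open (uminus ` U)" using U by (simp add: open_negations)
    have "x \<in> uminus ` U" using U(2) by (metis image_eqI minus_minus)
    with o x have "emeasure \<mu> (uminus ` U) > 0" by (auto simp: measure_support_def)
    also have "uminus ` U = uminus -` U" by force
    also have "emeasure \<mu> (uminus -` U) = emeasure (distr \<mu> borel uminus) U"
      using U by (subst emeasure_distr) auto
    finally show "emeasure \<mu> U > 0" by (simp add: \<mu>_even)
  qed
qed

definition b :: real where "b = Sup S"

lemma bdd_S: "bdd_above S"
  using support_bounded by (intro bdd_aboveI[of _ "sqrt (8 / a * E0)"]) (auto simp: abs_le_iff)

lemma b_in_S: "b \<in> S"
  unfolding b_def by (intro closed_contains_Sup support_nonempty bdd_S closed_measure_support)

lemma S_le_b: "x \<in> S \<Longrightarrow> \<bar>x\<bar> \<le> b"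
  using cSup_upper[OF _ bdd_S, of x] cSup_upper[OF _ bdd_S, of "- x"] support_even[of x]
  by (auto simp: b_def abs_le_iff)

text \<open>Otherwise \<mu> would be the point mass at 0, whose potential at 0 is infinite.\<close>

lemma b_pos: "0 < b"
proof (rule ccontr)
  assume "\<not> 0 < b"
  then have "S \<subseteq> {0}" using S_le_b by force
  then have ae: "AE x in \<mu>. x = 0" by (intro eventually_mono[OF AE_S]) auto
  have "\<Psi> 0 = (\<integral>\<^sup>+t. \<infinity> \<partial>\<mu>)" unfolding \<Psi>_def
    by (rule nn_integral_cong_AE, rule eventually_mono[OF ae]) (auto simp: K_def)
  also have "\<dots> = \<infinity>" using \<mu>.emeasure_space_1 by simp
  finally have "\<Psi> 0 = \<infinity>" .
  moreover have "0 \<in> S" using \<open>S \<subseteq> {0}\<close> support_nonempty by auto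
  ultimately show False using \<Psi>_le_support[of 0] by (simp add: top_unique)
qed

text \<open>At the endpoints of a gap \<Psi> is at most \<open>E0\<close>, at its midpoint at least
  \<open>E0\<close>; the strict midpoint convexity inside a gap excludes this.\<close>

lemma support_interval: "S = {-b..b}"
proof
  show "S \<subseteq> {-b..b}"
  proof
    fix x assume "x \<in> S"
    from S_le_b[OF this] show "x \<in> {-b..b}" by auto
  qed
  show "{-b..b} \<subseteq> S"
  proof (rule ccontr)
    assume "\<not> {-b..b} \<subseteq> S"
    then obtain x where "x \<in> {-b..b}" "x \<notin> S" by blast
    then have x: "-b \<le> x" "x \<le> b" "x \<notin> S" by auto
    define c d where "c = Sup (S \<inter> {..x})" and "d = Inf (S \<inter> {x..})"
    have bd: "bdd_above (S \<inter> {..x})" "bdd_below (S \<inter> {x..})" by auto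
    have "c \<in> S \<inter> {..x}" unfolding c_def
      using support_even[OF b_in_S] x closed_measure_support
      by (intro closed_contains_Sup bd closed_Int) auto
    then have c: "c \<in> S" "c < x" using x(3) by (auto simp: less_le)
    have "d \<in> S \<inter> {x..}" unfolding d_def
      using b_in_S x closed_measure_support by (intro closed_contains_Inf bd closed_Int) auto
    then have d: "d \<in> S" "x < d" using x(3) by (auto simp: less_le)
    have cd: "t \<le> c \<or> d \<le> t" if "t \<in> S" for t
      using that cSup_upper[OF _ bd(1), of t] cInf_lower[OF _ bd(2), of t]
      by (cases "t \<le> x") (auto simp: c_def d_def)
    let ?m = "(c + d) / 2"
    have "?m \<notin> S" using cd[of ?m] c d by auto
    then have m: "ennreal E0 \<le> \<Psi> ?m" by (rule \<Psi>_ge_off_support)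
    have pos: "0 < (a - 2 * M) / 8 * (c - d)\<^sup>2"
      using c d a_gt M_nonneg by (intro mult_pos_pos) auto
    have "2 * ennreal E0 + ennreal ((a - 2 * M) / 8 * (c - d)\<^sup>2) \<le> 2 * \<Psi> ?m + ennreal ((a - 2 * M) / 8 * (c - d)\<^sup>2)"
      using m by (intro add_right_mono mult_left_mono) auto
    also have "\<dots> \<le> \<Psi> c + \<Psi> d"
    proof (rule \<Psi>_midpoint)
      show "AE t in \<mu>. 0 \<le> (c - t) * (d - t)"
        using AE_S
      proof eventually_elim
        case (elim t)
        then show ?case using cd[OF elim] c d by (auto intro: mult_nonneg_nonneg mult_nonpos_nonpos)
      qed
    qed
    also have "\<dots> \<le> 2 * ennreal E0"
      using \<Psi>_le_support[OF c(1)] \<Psi>_le_support[OF d(1)] by (auto simp: mult_2 intro: add_mono)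
    finally have "ennreal (2 * E0 + (a - 2 * M) / 8 * (c - d)\<^sup>2) \<le> ennreal (2 * E0)"
      using E0_nonneg pos by (simp add: ennreal_plus ennreal_mult)
    then have "2 * E0 + (a - 2 * M) / 8 * (c - d)\<^sup>2 \<le> 2 * E0"
      using E0_nonneg by (subst (asm) ennreal_le_iff) auto
    then show False using pos by linarith
  qed
qed

text \<open>Midpoint convexity on [b, x]: \<Psi> is at most \<open>E0\<close> at b and at least
  \<open>E0\<close> at the midpoint, so the whole quadratic gain has to appear at x.\<close>

lemma \<Psi>_growth:
  assumes "b < x"
  shows "ennreal (E0 + (a - 2 * M) / 8 * (x - b)\<^sup>2) \<le> \<Psi> x"
proof -
  let ?q = "(a - 2 * M) / 8 * (x - b)\<^sup>2"
  have q: "0 \<le> ?q" using a_gt M_nonneg by (intro mult_nonneg_nonneg) auto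
  have "ennreal E0 \<le> \<Psi> ((b + x) / 2)"
    by (rule \<Psi>_ge_off_support) (use assms in \<open>auto simp: support_interval\<close>)
  then have "2 * ennreal E0 + ennreal ?q \<le> 2 * \<Psi> ((b + x) / 2) + ennreal ?q"
    by (intro add_right_mono mult_left_mono) auto
  also have "\<dots> = 2 * \<Psi> ((b + x) / 2) + ennreal ((a - 2 * M) / 8 * (b - x)\<^sup>2)"
    by (simp add: power2_commute)
  also have "\<dots> \<le> \<Psi> b + \<Psi> x"
  proof (rule \<Psi>_midpoint)
    show "AE t in \<mu>. 0 \<le> (b - t) * (x - t)"
      using AE_S
    proof eventually_elim
      case (elim t)
      then show ?case using S_le_b[OF elim] assms by (auto intro: mult_nonneg_nonneg)
    qed
  qed
  also have "\<dots> \<le> ennreal E0 + \<Psi> x" by (intro add_right_mono \<Psi>_le_support b_in_S)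
  finally have "ennreal E0 + (ennreal E0 + ennreal ?q) \<le> ennreal E0 + \<Psi> x"
    by (simp only: mult_2 add.assoc)
  then have "ennreal E0 + ennreal ?q \<le> \<Psi> x"
    by (subst (asm) ennreal_add_left_cancel_le) auto
  then show ?thesis using E0_nonneg q by (simp add: ennreal_plus)
qed

end

section \<open>The equilibrium measure\<close>

lemma ext_integral_eq_integral:
  assumes [measurable]: "f \<in> borel_measurable M" and g: "integrable M g"
    and eq: "AE x in M. f x = ereal (g x)"
  shows "ext_integral M f = ereal (LINT x|M. g x)"
proof -
  have 1: "(\<integral>\<^sup>+x. e2ennreal (f x) \<partial>M) = (\<integral>\<^sup>+x. ennreal (g x) \<partial>M)"
    using eq by (intro nn_integral_cong_AE) (auto simp: e2ennreal_ereal elim!: eventually_mono)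
  have 2: "(\<integral>\<^sup>+x. e2ennreal (- f x) \<partial>M) = (\<integral>\<^sup>+x. ennreal (- g x) \<partial>M)"
    using eq by (intro nn_integral_cong_AE) (auto simp: e2ennreal_ereal elim!: eventually_mono)
  have fin: "(\<integral>\<^sup>+x. ennreal (g x) \<partial>M) \<noteq> \<infinity>" "(\<integral>\<^sup>+x. ennreal (- g x) \<partial>M) \<noteq> \<infinity>"
    using g by (auto simp: real_integrable_def)
  have "enn2ereal X = ereal (enn2real X)" if "X \<noteq> \<infinity>" for X
    using that by (cases X) auto
  then show ?thesis
    unfolding ext_integral_def 1 2 using fin by (simp add: real_lebesgue_integral_def[OF g])
qed

lemma borel_measurable_fst_snd:
  assumes "sets \<nu> = sets borel"
  shows "fst \<in> borel_measurable (\<nu> \<Otimes>\<^sub>M \<nu>)" "snd \<in> borel_measurable (\<nu> \<Otimes>\<^sub>M \<nu>)"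
  using measurable_fst[of \<nu> \<nu>] measurable_snd[of \<nu> \<nu>]
  unfolding measurable_cong_sets[OF refl assms] .

lemma log_kernel_measurable[measurable]:
  "(\<lambda>(t, s). log_kernel t s) \<in> borel_measurable (borel \<Otimes>\<^sub>M borel)"
  unfolding log_kernel_def by measurable

lemma bounded_LINT:
  assumes "prob_space P" "\<And>x. \<bar>f x\<bar> \<le> D" "f \<in> borel_measurable P"
  shows "\<bar>LINT x|P. f x\<bar> \<le> (D :: real)"
proof -
  interpret prob_space P by fact
  have "integrable P f" using assms by (intro integrable_const_bound[where B=D]) auto
  have D: "0 \<le> D" using assms(2)[of undefined] by simp
  have "\<bar>LINT x|P. f x\<bar> \<le> (LINT x|P. \<bar>f x\<bar>)" by (rule integral_abs_bound)
  also have "\<dots> \<le> (LINT x|P. D)"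
    using \<open>integrable P f\<close> assms(2) by (intro integral_mono) auto
  finally show ?thesis by (simp add: prob_space)
qed

lemma integrable_abs_of_square:
  fixes N :: "real measure"
  assumes "prob_space N" and [measurable]: "f \<in> borel_measurable N"
    and "(\<integral>\<^sup>+x. ennreal ((f x)\<^sup>2) \<partial>N) < \<infinity>"
  shows "integrable N (\<lambda>x. (f x)\<^sup>2)" "integrable N (\<lambda>x. \<bar>f x :: real\<bar>)"
proof -
  interpret prob_space N by fact
  show sq: "integrable N (\<lambda>x. (f x)\<^sup>2)" using assms by (intro integrableI_nonneg) auto
  show "integrable N (\<lambda>x. \<bar>f x\<bar>)"
  proof (rule Bochner_Integration.integrable_bound)
    show "integrable N (\<lambda>x. 1 + (f x)\<^sup>2)" using sq by auto
    have "\<bar>z\<bar> \<le> 1 + z\<^sup>2" for z :: real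
    proof -
      have "0 \<le> (\<bar>z\<bar> - 1)\<^sup>2" by simp
      then show ?thesis by (simp add: power2_eq_square algebra_simps abs_if split: if_splits)
    qed
    then show "AE x in N. norm \<bar>f x\<bar> \<le> norm (1 + (f x)\<^sup>2)" by (auto simp: abs_of_nonneg add_nonneg_nonneg)
  qed measurable
qed

lemma ln_diff_le: "ln \<bar>s - t\<bar> \<le> \<bar>s\<bar> + \<bar>t\<bar>" for s t :: real
proof (cases "s = t")
  case False
  then have "ln \<bar>s - t\<bar> \<le> \<bar>s - t\<bar> - 1" by (intro ln_le_minus_one) auto
  then show ?thesis by (simp add: abs_if split: if_splits)
qed auto

section \<open>Comparison of the energy with external field V and the mean-field energy\<close>

context convex_ensemble begin

definition h\<mu> :: "real \<Rightarrow> real" where "h\<mu> x = (LINT t|\<mu>. h (x - t))"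

lemma h\<mu>_measurable[measurable]: "h\<mu> \<in> borel_measurable borel"
  unfolding h\<mu>_def[abs_def] by (rule \<mu>.borel_measurable_lebesgue_integral) measurable

lemma h\<mu>_bound: "\<bar>h\<mu> x\<bar> \<le> B"
  unfolding h\<mu>_def by (rule bounded_LINT) (auto simp: h_bound \<mu>.prob_space_axioms)

abbreviation V :: "real \<Rightarrow> real" where "V \<equiv> external_field h Q \<mu>"

lemma V_eq: "V x = Q x + h\<mu> x" by (simp add: external_field_def h\<mu>_def)

lemma V_measurable[measurable]: "V \<in> borel_measurable borel"
  unfolding V_eq[abs_def] by measurable

definition hh :: "real measure \<Rightarrow> real" where "hh \<nu> = (LINT p|(\<nu> \<Otimes>\<^sub>M \<nu>). h (fst p - snd p))"

text \<open>Finite \<open>En \<nu>\<close> makes the diagonal a null set and each of Q, h and the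
  logarithm integrable. The logarithmic energy is then \<open>En \<nu>\<close> minus the other parts
  of w, and the integral of V restores that of Q.\<close>

lemma energy_finite:
  assumes rd: "real_distribution \<nu>" and fin: "En \<nu> < \<infinity>"
  shows "energy V \<nu> = ereal (enn2real (En \<nu>) - C + (LINT x|\<nu>. h\<mu> x) - hh \<nu> / 2)"
proof -
  interpret N: real_distribution \<nu> by fact
  interpret NN: pair_prob_space \<nu> \<nu> ..
  note f[measurable] = borel_measurable_fst_snd[OF N.events_eq_borel]
  have wm[measurable]: "(\<lambda>p. w (fst p) (snd p)) \<in> borel_measurable (\<nu> \<Otimes>\<^sub>M \<nu>)"
    unfolding w_def w0_def by measurable
  have nn: "(\<integral>\<^sup>+p. K (fst p) (snd p) \<partial>(\<nu> \<Otimes>\<^sub>M \<nu>)) = En \<nu>" by (rule En_pair[OF rd, symmetric])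
  have "AE p in \<nu> \<Otimes>\<^sub>M \<nu>. K (fst p) (snd p) \<noteq> \<infinity>"
    using fin by (intro nn_integral_noteq_infinite) (auto simp: nn)
  then have ne: "AE p in \<nu> \<Otimes>\<^sub>M \<nu>. fst p \<noteq> snd p"
    by eventually_elim (auto simp: K_def)
  have nnw: "(\<integral>\<^sup>+p. ennreal (w (fst p) (snd p)) \<partial>(\<nu> \<Otimes>\<^sub>M \<nu>)) = En \<nu>"
    unfolding nn[symmetric] using ne by (intro nn_integral_cong_AE) (auto simp: K_def elim!: eventually_mono)
  have w: "integrable (\<nu> \<Otimes>\<^sub>M \<nu>) (\<lambda>p. w (fst p) (snd p))"
    using fin by (intro integrableI_nonneg) (auto simp: w_nonneg nnw)
  have Iw: "(LINT p|(\<nu> \<Otimes>\<^sub>M \<nu>). w (fst p) (snd p)) = enn2real (En \<nu>)"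
    using w by (subst integral_eq_nn_integral) (auto simp: w_nonneg nnw)
  have sq: "(\<integral>\<^sup>+x. ennreal (x\<^sup>2) \<partial>\<nu>) < \<infinity>"
    using second_moment_le_En[OF rd] by (rule le_less_trans) (use fin in \<open>auto simp: ennreal_mult_less_top\<close>)
  have ab: "integrable \<nu> (\<lambda>x. \<bar>x\<bar>)"
    by (rule integrable_abs_of_square[OF N.prob_space_axioms _ sq]) auto
  have d1: "distr (\<nu> \<Otimes>\<^sub>M \<nu>) \<nu> fst = \<nu>"
    by (rule N.distr_pair_fst) 
  have d2: "distr (\<nu> \<Otimes>\<^sub>M \<nu>) \<nu> snd = \<nu>"
  proof -
    have "distr (\<nu> \<Otimes>\<^sub>M \<nu>) \<nu> snd = distr (distr (\<nu> \<Otimes>\<^sub>M \<nu>) (\<nu> \<Otimes>\<^sub>M \<nu>) (\<lambda>(x, y). (y, x))) \<nu> fst"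
      by (subst distr_distr) (auto simp: comp_def split_beta)
    then show ?thesis using NN.distr_pair_swap d1 by simp
  qed
  have fst_int: "integrable (\<nu> \<Otimes>\<^sub>M \<nu>) (\<lambda>p. g (fst p)) \<longleftrightarrow> integrable \<nu> g"
    and snd_int: "integrable (\<nu> \<Otimes>\<^sub>M \<nu>) (\<lambda>p. g (snd p)) \<longleftrightarrow> integrable \<nu> g"
    and fst_eq: "(LINT p|(\<nu> \<Otimes>\<^sub>M \<nu>). g (fst p)) = (LINT x|\<nu>. g x)"
    and snd_eq: "(LINT p|(\<nu> \<Otimes>\<^sub>M \<nu>). g (snd p)) = (LINT x|\<nu>. g x)"
    if [measurable]: "g \<in> borel_measurable borel" for g :: "real \<Rightarrow> real"
    using integrable_distr_eq[of fst "\<nu> \<Otimes>\<^sub>M \<nu>" \<nu> g] integrable_distr_eq[of snd "\<nu> \<Otimes>\<^sub>M \<nu>" \<nu> g]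
      integral_distr[of fst "\<nu> \<Otimes>\<^sub>M \<nu>" \<nu> g] integral_distr[of snd "\<nu> \<Otimes>\<^sub>M \<nu>" \<nu> g]
    by (simp_all add: d1 d2)
  have Q: "integrable (\<nu> \<Otimes>\<^sub>M \<nu>) (\<lambda>p. Q (fst p))"
  proof (rule Bochner_Integration.integrable_bound)
    \<comment> \<open>The linear upper bound on the logarithm bounds \<open>Q s + Q t\<close> by w
      and first moments; the lower bound \<open>Q 0\<close> on \<open>Q t\<close> then isolates
      \<open>Q s\<close>.\<close>
    let ?g = "\<lambda>p. 2 * w (fst p) (snd p) + 2 * \<bar>fst p\<bar> + 2 * \<bar>snd p\<bar> + (B + 2 * \<bar>C\<bar> + \<bar>Q 0\<bar>)"
    show "integrable (\<nu> \<Otimes>\<^sub>M \<nu>) ?g"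
      using w ab by (intro Bochner_Integration.integrable_add integrable_mult_right)
        (auto simp: fst_int[of "\<lambda>x. \<bar>x\<bar>"] snd_int[of "\<lambda>x. \<bar>x\<bar>"])
    show "AE p in \<nu> \<Otimes>\<^sub>M \<nu>. norm (Q (fst p)) \<le> norm (?g p)"
    proof (intro AE_I2)
      fix p :: "real \<times> real"
      obtain s t where p: "p = (s, t)" by (cases p)
      have Q0: "Q 0 \<le> Q s" "Q 0 \<le> Q t"
        using Q_growth[of s] Q_growth[of t] a_pos by (smt (verit) mult_nonneg_nonneg zero_le_power2 divide_nonneg_pos)+
      have "Q s + Q t \<le> 2 * w s t + 2 * (\<bar>s\<bar> + \<bar>t\<bar>) + B + 2 * \<bar>C\<bar>"
      proof -
        have "- h (s - t) \<le> B" "- C \<le> \<bar>C\<bar>" using h_bound[of "s - t"] by auto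
        moreover have "0 \<le> \<bar>C\<bar>" by simp
        ultimately show ?thesis
          using ln_diff_le[of s t] unfolding w_def w0_def by argo
      qed
      then have "Q s \<le> ?g p" "- Q s \<le> ?g p"
        using Q0 B_nonneg w_nonneg[of s t] unfolding p by (simp_all add: abs_if split: if_splits)
      then show "norm (Q (fst p)) \<le> norm (?g p)" by (simp add: p abs_if)
    qed
  qed measurable
  then have Q1: "integrable \<nu> Q" by (simp add: fst_int)
  have Q2: "integrable (\<nu> \<Otimes>\<^sub>M \<nu>) (\<lambda>p. Q (snd p))" using Q1 by (simp add: snd_int)
  have hi: "integrable (\<nu> \<Otimes>\<^sub>M \<nu>) (\<lambda>p. h (fst p - snd p))"
    by (intro NN.integrable_const_bound[where B=B]) (auto simp: h_bound)
  have hmi: "integrable \<nu> h\<mu>"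
    by (intro N.integrable_const_bound[where B=B]) (auto simp: h\<mu>_bound)
  let ?l = "\<lambda>p::real \<times> real. - ln \<bar>fst p - snd p\<bar>"
  have l_eq: "?l = (\<lambda>p. w (fst p) (snd p) - (Q (fst p) / 2 + Q (snd p) / 2 + h (fst p - snd p) / 2 + C))"
    by (auto simp: w_def w0_def field_simps)
  have li: "integrable (\<nu> \<Otimes>\<^sub>M \<nu>) ?l"
    unfolding l_eq using w Q Q2 hi by auto
  have Il: "(LINT p|(\<nu> \<Otimes>\<^sub>M \<nu>). ?l p) = enn2real (En \<nu>) - ((LINT x|\<nu>. Q x) + hh \<nu> / 2 + C)"
    unfolding l_eq using w Q Q2 hi
    by (simp add: Iw fst_eq snd_eq hh_def NN.prob_space field_simps)
  have 1: "ext_integral (\<nu> \<Otimes>\<^sub>M \<nu>) (\<lambda>(t, s). log_kernel t s) = ereal (LINT p|(\<nu> \<Otimes>\<^sub>M \<nu>). ?l p)"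
  proof (rule ext_integral_eq_integral[OF _ li])
    show "(\<lambda>(t, s). log_kernel t s) \<in> borel_measurable (\<nu> \<Otimes>\<^sub>M \<nu>)"
      using log_kernel_measurable by (simp cong: measurable_cong_sets)
    show "AE p in \<nu> \<Otimes>\<^sub>M \<nu>. (case p of (t, s) \<Rightarrow> log_kernel t s) = ereal (?l p)"
      using ne by eventually_elim (auto simp: log_kernel_def ln_div)
  qed
  have 2: "ext_integral \<nu> (\<lambda>t. ereal (V t)) = ereal (LINT x|\<nu>. V x)"
    using Q1 hmi by (intro ext_integral_eq_integral) (auto simp: V_eq[abs_def])
  show ?thesis unfolding energy_def 1 2 Il
    using Q1 hmi by (simp add: V_eq[abs_def])
qed

text \<open>The four parts are bounded in the order in which this is possible. V is bounded below,
  so its negative part is finite; its positive part is finite, since \<infinity> absorbs every other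
  term. Growth of Q then gives moments, these bound the logarithm at large distances, and absorption
  applies again to its singular part.\<close>

lemma energy_lt_top_imp:
  assumes rd: "real_distribution \<nu>" and fin: "energy V \<nu> < \<infinity>"
  shows "En \<nu> < \<infinity>"
proof -
  interpret N: real_distribution \<nu> by fact
  interpret NN: pair_prob_space \<nu> \<nu> ..
  note f[measurable] = borel_measurable_fst_snd[OF N.events_eq_borel]
  have lk[measurable]: "(\<lambda>p. log_kernel (fst p) (snd p)) \<in> borel_measurable (\<nu> \<Otimes>\<^sub>M \<nu>)"
    using log_kernel_measurable by (simp add: split_beta cong: measurable_cong_sets)
  have Q0: "Q 0 \<le> Q s" for s
    using Q_growth[of s] a_pos by (smt (verit) mult_nonneg_nonneg zero_le_power2 divide_nonneg_pos)
  let ?P2 = "\<integral>\<^sup>+x. e2ennreal (ereal (V x)) \<partial>\<nu>" and ?N2 = "\<integral>\<^sup>+x. e2ennreal (- ereal (V x)) \<partial>\<nu>"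
  let ?P1 = "\<integral>\<^sup>+p. e2ennreal (log_kernel (fst p) (snd p)) \<partial>(\<nu> \<Otimes>\<^sub>M \<nu>)"
    and ?N1 = "\<integral>\<^sup>+p. e2ennreal (- log_kernel (fst p) (snd p)) \<partial>(\<nu> \<Otimes>\<^sub>M \<nu>)"
  have en: "energy V \<nu> = (enn2ereal ?P1 - enn2ereal ?N1) + (enn2ereal ?P2 - enn2ereal ?N2)"
    by (simp add: energy_def ext_integral_def split_beta)
  have N2: "?N2 < \<infinity>"
  proof -
    have "?N2 \<le> (\<integral>\<^sup>+x. ennreal (\<bar>Q 0\<bar> + B) \<partial>\<nu>)"
    proof (intro nn_integral_mono)
      fix x
      have "- V x \<le> \<bar>Q 0\<bar> + B" using Q0[of x] h\<mu>_bound[of x] by (simp add: V_eq abs_if split: if_splits)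
      then show "e2ennreal (- ereal (V x)) \<le> ennreal (\<bar>Q 0\<bar> + B)" by (simp add: e2ennreal_ereal ennreal_leI)
    qed
    also have "\<dots> < \<infinity>" using N.emeasure_space_1 by simp
    finally show ?thesis .
  qed
  have P2: "?P2 < \<infinity>"
  proof (rule ccontr)
    assume "\<not> ?P2 < \<infinity>"
    then have "?P2 = \<infinity>" by (simp add: less_top[symmetric])
    then have "enn2ereal ?P2 - enn2ereal ?N2 = \<infinity>" using N2 by (cases ?N2) auto
    then show False using fin unfolding en by simp
  qed
  have "(\<integral>\<^sup>+x. ennreal \<bar>Q x\<bar> \<partial>\<nu>) \<le> (\<integral>\<^sup>+x. e2ennreal (ereal (V x)) + ennreal (2 * \<bar>Q 0\<bar> + B) \<partial>\<nu>)"
  proof (intro nn_integral_mono)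
    fix x
    have "\<bar>Q x\<bar> \<le> max 0 (V x) + (2 * \<bar>Q 0\<bar> + B)"
      using Q0[of x] h\<mu>_bound[of x] by (simp add: V_eq abs_if max_def split: if_splits)
    then have "ennreal \<bar>Q x\<bar> \<le> ennreal (max 0 (V x) + (2 * \<bar>Q 0\<bar> + B))" by (rule ennreal_leI)
    also have "\<dots> = ennreal (V x) + ennreal (2 * \<bar>Q 0\<bar> + B)"
      using B_nonneg by (subst ennreal_plus) (auto simp: max_def ennreal_neg)
    finally show "ennreal \<bar>Q x\<bar> \<le> e2ennreal (ereal (V x)) + ennreal (2 * \<bar>Q 0\<bar> + B)" by (simp add: e2ennreal_ereal)
  qed
  also have "\<dots> = ?P2 + ennreal (2 * \<bar>Q 0\<bar> + B)"
    using N.emeasure_space_1 by (subst nn_integral_add) auto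
  also have "\<dots> < \<infinity>" using P2 by simp
  finally have Qf: "(\<integral>\<^sup>+x. ennreal \<bar>Q x\<bar> \<partial>\<nu>) < \<infinity>" .
  have sq: "(\<integral>\<^sup>+x. ennreal (x\<^sup>2) \<partial>\<nu>) < \<infinity>"
  proof -
    have "(\<integral>\<^sup>+x. ennreal (x\<^sup>2) \<partial>\<nu>) \<le> (\<integral>\<^sup>+x. ennreal (2 / a) * (ennreal \<bar>Q x\<bar> + ennreal \<bar>Q 0\<bar>) \<partial>\<nu>)"
    proof (intro nn_integral_mono)
      fix x :: real
      have "x\<^sup>2 \<le> 2 / a * (\<bar>Q x\<bar> + \<bar>Q 0\<bar>)"
        using Q_growth[of x] a_pos by (simp add: field_simps abs_if split: if_splits)
      then show "ennreal (x\<^sup>2) \<le> ennreal (2 / a) * (ennreal \<bar>Q x\<bar> + ennreal \<bar>Q 0\<bar>)"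
        using a_pos by (simp flip: ennreal_plus ennreal_mult add: ennreal_leI)
    qed
    also have "\<dots> = ennreal (2 / a) * ((\<integral>\<^sup>+x. ennreal \<bar>Q x\<bar> \<partial>\<nu>) + ennreal \<bar>Q 0\<bar>)"
      using N.emeasure_space_1 by (simp add: nn_integral_cmult nn_integral_add)
    also have "\<dots> < \<infinity>" using Qf by (simp add: ennreal_mult_less_top)
    finally show ?thesis .
  qed
  have abf: "(\<integral>\<^sup>+x. ennreal \<bar>x\<bar> \<partial>\<nu>) < \<infinity>"
    using integrable_abs_of_square(2)[OF N.prob_space_axioms, of "\<lambda>x. x"] sq
    by (simp add: integrable_iff_bounded)
  have pair: "(\<integral>\<^sup>+p. f (fst p) + f (snd p) \<partial>(\<nu> \<Otimes>\<^sub>M \<nu>)) < \<infinity>"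
    if [measurable]: "f \<in> borel_measurable borel" and "(\<integral>\<^sup>+x. f x \<partial>\<nu>) < \<infinity>" for f :: "real \<Rightarrow> ennreal"
  proof -
    have "(\<integral>\<^sup>+p. f (fst p) + f (snd p) \<partial>(\<nu> \<Otimes>\<^sub>M \<nu>)) = (\<integral>\<^sup>+x. \<integral>\<^sup>+y. f x + f y \<partial>\<nu> \<partial>\<nu>)"
      by (subst N.nn_integral_fst[symmetric]) auto
    also have "\<dots> = (\<integral>\<^sup>+x. f x \<partial>\<nu>) + (\<integral>\<^sup>+x. f x \<partial>\<nu>)"
      using N.emeasure_space_1 by (simp add: nn_integral_add)
    also have "\<dots> < \<infinity>" using that by simp
    finally show ?thesis .
  qed
  have N1: "?N1 < \<infinity>"
  proof -
    have "?N1 \<le> (\<integral>\<^sup>+p. ennreal \<bar>fst p\<bar> + ennreal \<bar>snd p\<bar> \<partial>(\<nu> \<Otimes>\<^sub>M \<nu>))"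
    proof (intro nn_integral_mono)
      fix p :: "real \<times> real"
      show "e2ennreal (- log_kernel (fst p) (snd p)) \<le> ennreal \<bar>fst p\<bar> + ennreal \<bar>snd p\<bar>"
        using ln_diff_le[of "fst p" "snd p"]
        by (auto simp: log_kernel_def e2ennreal_ereal ln_div e2ennreal_neg simp flip: ennreal_plus intro!: ennreal_leI)
    qed
    also have "\<dots> < \<infinity>" using abf by (intro pair) auto
    finally show ?thesis .
  qed
  have P1: "?P1 < \<infinity>"
  proof (rule ccontr)
    assume "\<not> ?P1 < \<infinity>"
    then have "?P1 = \<infinity>" by (simp add: less_top[symmetric])
    then have "enn2ereal ?P1 - enn2ereal ?N1 = \<infinity>" using N1 by (cases ?N1) auto
    then show False using fin unfolding en by simp
  qed
  have "En \<nu> \<le> (\<integral>\<^sup>+p. e2ennreal (log_kernel (fst p) (snd p)) + ((ennreal \<bar>Q (fst p)\<bar> + ennreal \<bar>Q (snd p)\<bar>) + ennreal (B + \<bar>C\<bar>)) \<partial>(\<nu> \<Otimes>\<^sub>M \<nu>))"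
    unfolding En_pair[OF rd]
  proof (intro nn_integral_mono)
    fix p :: "real \<times> real"
    obtain s t where p: "p = (s, t)" by (cases p)
    show "K (fst p) (snd p) \<le> e2ennreal (log_kernel (fst p) (snd p)) + ((ennreal \<bar>Q (fst p)\<bar> + ennreal \<bar>Q (snd p)\<bar>) + ennreal (B + \<bar>C\<bar>))"
    proof (cases "s = t")
      case False
      have "w s t \<le> max 0 (- ln \<bar>s - t\<bar>) + (\<bar>Q s\<bar> + \<bar>Q t\<bar> + (B + \<bar>C\<bar>))"
      proof -
        have "h (s - t) \<le> B" "C \<le> \<bar>C\<bar>" "Q s \<le> \<bar>Q s\<bar>" "Q t \<le> \<bar>Q t\<bar>" "0 \<le> \<bar>Q s\<bar>" "0 \<le> \<bar>Q t\<bar>"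
          "- ln \<bar>s - t\<bar> \<le> max 0 (- ln \<bar>s - t\<bar>)"
          using h_bound[of "s - t"] by auto
        then show ?thesis using B_nonneg unfolding w_def w0_def by argo
      qed
      then have "ennreal (w s t) \<le> ennreal (max 0 (- ln \<bar>s - t\<bar>) + (\<bar>Q s\<bar> + \<bar>Q t\<bar> + (B + \<bar>C\<bar>)))" by (rule ennreal_leI)
      also have "\<dots> = ennreal (max 0 (- ln \<bar>s - t\<bar>)) + (ennreal \<bar>Q s\<bar> + ennreal \<bar>Q t\<bar> + ennreal (B + \<bar>C\<bar>))"
        using B_nonneg by (simp add: ennreal_plus del: ennreal_max_0)
      finally show ?thesis using False
        by (simp add: p K_def log_kernel_def e2ennreal_ereal ln_div)
    qed (simp add: p log_kernel_def)
  qed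
  also have "\<dots> = ?P1 + ((\<integral>\<^sup>+p. (ennreal \<bar>Q (fst p)\<bar> + ennreal \<bar>Q (snd p)\<bar>) \<partial>(\<nu> \<Otimes>\<^sub>M \<nu>)) + ennreal (B + \<bar>C\<bar>))"
    using NN.emeasure_space_1 by (simp add: nn_integral_add)
  also have "\<dots> < \<infinity>" using P1 pair[of "\<lambda>x. ennreal \<bar>Q x\<bar>"] Qf by simp
  finally show ?thesis .
qed

lemma h_swap: "h (x - y) = h (y - x)"
  using h_even[of "y - x"] by simp

text \<open>The right-hand side is -1/2 times the integral of h(s - t) against the square of the
  signed measure \<nu> - \<mu>. Under the quantile coupling this integral is the mean of mixed
  second differences of h, each at most M times a product of two displacements, and the squared mean
  displacement is at most D.\<close>

lemma hh_gap:
  assumes rd: "real_distribution \<nu>" and D: "qdist \<mu> \<nu> = ennreal D" "0 \<le> D"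
  shows "- (M / 2 * D) \<le> (LINT x|\<nu>. h\<mu> x) - hh \<nu> / 2 - hh \<mu> / 2"
proof -
  let ?U = unit_measure and ?X = "quantile \<mu>" and ?Y = "quantile \<nu>"
  have X[measurable]: "?X \<in> borel_measurable ?U" and Y[measurable]: "?Y \<in> borel_measurable ?U"
    using quantile_measurable real_distribution_\<mu> rd by auto
  have dX: "distr ?U borel ?X = \<mu>" and dY: "distr ?U borel ?Y = \<nu>"
    using distr_quantile real_distribution_\<mu> rd by auto
  interpret UU: pair_prob_space ?U ?U ..
  let ?UU = "?U \<Otimes>\<^sub>M ?U"
  have hi: "integrable ?UU (\<lambda>p. h (F (fst p) - G (snd p)))"
    if [measurable]: "F \<in> borel_measurable ?U" "G \<in> borel_measurable ?U" for F G :: "real \<Rightarrow> real"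
    by (intro UU.integrable_const_bound[where B=B]) (auto simp: h_bound)
  have hh: "hh (distr ?U borel F) = (LINT p|?UU. h (F (fst p) - F (snd p)))"
    if [measurable]: "F \<in> borel_measurable ?U" for F :: "real \<Rightarrow> real"
  proof -
    interpret F: prob_space "distr ?U borel F" by (rule unit_measure.prob_space_distr) fact
    have "distr ?U borel F \<Otimes>\<^sub>M distr ?U borel F
        = distr ?UU (borel \<Otimes>\<^sub>M borel) (\<lambda>(x, y). (F x, F y))"
      by (intro pair_measure_distr) (auto intro: F.sigma_finite_measure)
    then show ?thesis unfolding hh_def by (simp add: integral_distr split_beta')
  qed
  have c: "(LINT x|\<nu>. h\<mu> x) = (LINT p|?UU. h (?Y (fst p) - ?X (snd p)))"
  proof -
    have "h\<mu> x = (LINT v|?U. h (x - ?X v))" for x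
      unfolding h\<mu>_def by (subst dX[symmetric], subst integral_distr) auto
    moreover have "(LINT x|\<nu>. h\<mu> x) = (LINT u|?U. h\<mu> (?Y u))"
      by (subst dY[symmetric], subst integral_distr) auto
    ultimately have "(LINT x|\<nu>. h\<mu> x) = (LINT u|?U. LINT v|?U. h (?Y u - ?X v))" by simp
    also have "\<dots> = (LINT p|?UU. h (?Y (fst p) - ?X (snd p)))"
      using UU.integral_fst'[OF hi[OF Y X]] by simp
    finally show ?thesis .
  qed
  have c': "(LINT p|?UU. h (?Y (fst p) - ?X (snd p))) = (LINT p|?UU. h (?X (fst p) - ?Y (snd p)))"
  proof -
    have "(LINT p|?UU. h (?Y (fst p) - ?X (snd p))) = (LINT p|?UU. h (?Y (snd p) - ?X (fst p)))"
      by (subst UU.distr_pair_swap, subst integral_distr) (auto simp: split_beta)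
    also have "\<dots> = (LINT p|?UU. h (?X (fst p) - ?Y (snd p)))"
      by (intro Bochner_Integration.integral_cong refl h_swap)
    finally show ?thesis .
  qed
  let ?d = "\<lambda>u. \<bar>?X u - ?Y u\<bar>"
  have fin: "(\<integral>\<^sup>+u. ennreal ((?X u - ?Y u)\<^sup>2) \<partial>?U) < \<infinity>" using D by (simp add: qdist_def)
  note di = integrable_abs_of_square[OF unit_measure.prob_space_axioms _ fin]
  have d2: "integrable ?U (\<lambda>u. (?X u - ?Y u)\<^sup>2)" and d1: "integrable ?U ?d" using di by auto
  have D': "(LINT u|?U. (?X u - ?Y u)\<^sup>2) = D"
    using D d2 by (subst integral_eq_nn_integral) (auto simp: qdist_def)
  have ddi: "integrable ?UU (\<lambda>p. ?d (fst p) * ?d (snd p))"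
  proof (rule UU.Fubini_integrable)
    have "(LINT v|?U. norm (?d u * ?d v)) = ?d u * (LINT v|?U. ?d v)" for u
      by (simp add: abs_mult)
    then show "integrable ?U (\<lambda>u. LINT v|?U. norm (?d (fst (u, v)) * ?d (snd (u, v))))" using d1 by simp
    show "AE u in ?U. integrable ?U (\<lambda>v. ?d (fst (u, v)) * ?d (snd (u, v)))" using d1 by simp
  qed measurable
  have dd: "(LINT p|?UU. ?d (fst p) * ?d (snd p)) = (LINT u|?U. ?d u) * (LINT u|?U. ?d u)"
    using UU.integral_fst'[OF ddi] by simp
  have "(LINT u|?U. ?d u)\<^sup>2 \<le> (LINT u|?U. (?X u - ?Y u)\<^sup>2)"
    using unit_measure.variance_eq[of ?d] d1 d2 unit_measure.variance_positive[of ?d] by simp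
  then have ddD: "(LINT p|?UU. ?d (fst p) * ?d (snd p)) \<le> D"
    unfolding dd D' by (simp only: power2_eq_square)
  \<comment> \<open>The second difference of h based at \<open>X u - X v\<close>, with the
    displacements \<open>Y u - X u\<close> and \<open>Y v - X v\<close> as steps.\<close>
  let ?G = "\<lambda>p. h (?X (fst p) - ?X (snd p)) - h (?X (fst p) - ?Y (snd p)) - h (?Y (fst p) - ?X (snd p)) + h (?Y (fst p) - ?Y (snd p))"
  have Gi: "integrable ?UU ?G" by (intro Bochner_Integration.integrable_add Bochner_Integration.integrable_diff hi X Y)
  have "(LINT p|?UU. ?G p) \<le> (LINT p|?UU. M * (?d (fst p) * ?d (snd p)))"
  proof (rule integral_mono[OF Gi])
    fix p
    show "?G p \<le> M * (?d (fst p) * ?d (snd p))"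
      using h_second_difference[of "?X (fst p) - ?X (snd p)" "?Y (snd p) - ?X (snd p)" "?Y (fst p) - ?X (fst p)"]
      by (simp add: abs_minus_commute algebra_simps)
  qed (use ddi in auto)
  also have "\<dots> \<le> M * D" using ddD M_nonneg by (simp add: mult_left_mono)
  finally have "(LINT p|?UU. ?G p) \<le> M * D" .
  moreover have "(LINT p|?UU. ?G p) = hh \<mu> - 2 * (LINT x|\<nu>. h\<mu> x) + hh \<nu>"
    unfolding c using hh[OF X] hh[OF Y] hi[OF X X] hi[OF X Y] hi[OF Y X] hi[OF Y Y]
    by (simp add: dX dY c')
  ultimately show ?thesis by linarith
qed

lemma LINT_h\<mu>: "(LINT x|\<mu>. h\<mu> x) = hh \<mu>"
proof -
  interpret UU: pair_prob_space \<mu> \<mu> ..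
  note [measurable] = borel_measurable_fst_snd[OF \<mu>.events_eq_borel]
  have "integrable (\<mu> \<Otimes>\<^sub>M \<mu>) (\<lambda>p. h (fst p - snd p))"
    by (intro UU.integrable_const_bound[where B=B]) (auto simp: h_bound)
  from UU.integral_fst'[OF this] show ?thesis by (simp add: h\<mu>_def hh_def)
qed

text \<open>A competitor at squared distance D gains \<open>(a - 2 * M) / 4 * D\<close> in the
  mean-field energy and can lose at most \<open>M / 2 * D\<close> in the h-terms. What remains is
  \<open>(a - 4 * M) / 4 * D\<close>, so no competitor does as well unless D = 0.\<close>

theorem equilibrium_\<mu>: "equilibrium_measure V \<mu>"
proof -
  have *: "\<nu> = \<mu>" if rd: "real_distribution \<nu>" and le: "energy V \<nu> \<le> energy V \<mu>" for \<nu>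
  proof -
    have em: "energy V \<mu> = ereal (E0 - C + hh \<mu> / 2)"
      using energy_finite[OF real_distribution_\<mu> En_\<mu>_finite] by (simp add: LINT_h\<mu> E0_def)
    then have fin: "En \<nu> < \<infinity>" using le by (intro energy_lt_top_imp[OF rd]) auto
    then obtain F where F: "En \<nu> = ennreal F" "0 \<le> F" by (cases "En \<nu>") auto
    have pos: "0 < (a - 2 * M) / 4" using a_gt M_nonneg by simp
    have gap: "ennreal E0 + ennreal ((a - 2 * M) / 4) * qdist \<mu> \<nu> \<le> ennreal F"
      using En_gap[OF rd] by (simp add: F En_\<mu>)
    have "qdist \<mu> \<nu> \<noteq> \<infinity>"
    proof
      assume "qdist \<mu> \<nu> = \<infinity>"
      then have "ennreal ((a - 2 * M) / 4) * qdist \<mu> \<nu> = \<infinity>" using pos by (simp add: ennreal_mult_top)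
      with gap show False by (simp add: top_unique)
    qed
    then obtain D where D: "qdist \<mu> \<nu> = ennreal D" "0 \<le> D" by (cases "qdist \<mu> \<nu>") auto
    have "ennreal (E0 + (a - 2 * M) / 4 * D) \<le> ennreal F"
      using gap pos D E0_nonneg by (simp add: ennreal_plus ennreal_mult del: times_divide_eq_left)
    then have g: "E0 + (a - 2 * M) / 4 * D \<le> F" using F by (subst (asm) ennreal_le_iff) auto
    have "energy V \<nu> = ereal (F - C + (LINT x|\<nu>. h\<mu> x) - hh \<nu> / 2)"
      using energy_finite[OF rd fin] F by simp
    then have "F + (LINT x|\<nu>. h\<mu> x) - hh \<nu> / 2 \<le> E0 + hh \<mu> / 2" using le em by simp
    with g hh_gap[OF rd D] have "(a - 2 * M) / 4 * D - M / 2 * D \<le> 0" by linarith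
    then have "(a - 4 * M) / 4 * D \<le> 0" by (simp add: algebra_simps)
    moreover have "0 < (a - 4 * M) / 4" using a_gt by simp
    ultimately have "D = 0" using D(2) by (simp add: mult_le_0_iff)
    then show ?thesis using qdist_eq_0[OF real_distribution_\<mu> rd] D by simp
  qed
  have m: "is_arg_min (energy V) real_distribution \<mu>"
    unfolding is_arg_min_def
  proof (intro conjI real_distribution_\<mu> notI)
    assume "\<exists>\<nu>. real_distribution \<nu> \<and> energy V \<nu> < energy V \<mu>"
    then obtain \<nu> where \<nu>: "real_distribution \<nu>" "energy V \<nu> < energy V \<mu>" by blast
    from *[OF \<nu>(1) less_imp_le[OF \<nu>(2)]] \<nu>(2) show False by simp
  qed
  moreover have "\<nu> = \<mu>" if "is_arg_min (energy V) real_distribution \<nu>" for \<nu>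
    using that m by (intro *) (auto simp: is_arg_min_def not_less)
  ultimately show ?thesis unfolding equilibrium_measure_def by blast
qed

end

section \<open>Partition function and concentration\<close>

interpretation lborel_product: product_sigma_finite "\<lambda>_::nat. lborel :: real measure"
  by (simp add: product_sigma_finite_def sigma_finite_lborel)

lemma nn_integral_gaussian_finite:
  assumes "0 < c"
  shows "(\<integral>\<^sup>+x. ennreal (exp (- (c * x\<^sup>2))) \<partial>lborel) < \<infinity>"
proof -
  define \<sigma> where "\<sigma> = 1 / sqrt (2 * c)"
  have s: "\<sigma>\<^sup>2 = 1 / (2 * c)" using assms by (simp add: \<sigma>_def power_divide)
  have "exp (- (c * x\<^sup>2)) = sqrt (2 * pi * \<sigma>\<^sup>2) * normal_density 0 \<sigma> x" for x
    using assms by (simp add: normal_density_def s)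
  then have "integrable lborel (\<lambda>x::real. exp (- (c * x\<^sup>2)))"
    using integrable_mult_right[OF integrable_normal_density[of \<sigma> 0], of "sqrt (2 * pi * \<sigma>\<^sup>2)"] assms
    by (simp add: \<sigma>_def)
  then show ?thesis by (subst nn_integral_eq_integral) auto
qed


lemma sum_pairs_add:
  "(\<Sum>j<N. \<Sum>i<j. f i + f j) = (real N - 1) * (\<Sum>j<N. f j)" for f :: "nat \<Rightarrow> real"
proof (induction N)
  case (Suc N)
  have "(\<Sum>i<N. f i + f N) = (\<Sum>i<N. f i) + real N * f N" by (simp add: sum.distrib)
  with Suc show ?case by (simp add: algebra_simps)
qed simp

lemma sum_pairs_const: "(\<Sum>j<N. \<Sum>i<j. c) = real N * (real N - 1) / 2 * (c::real)"
  using sum_pairs_add[of "\<lambda>_. c / 2" N] by (simp add: field_simps)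

lemma ensemble_weight_nonneg: "0 \<le> ensemble_weight h Q N x"
  by (auto simp: ensemble_weight_def intro!: mult_nonneg_nonneg prod_nonneg)

lemma ensemble_weight_eq_0:
  assumes "\<not> inj_on x {..<N}"
  shows "ensemble_weight h Q N x = 0"
proof -
  obtain i j where "i < N" "j < N" "x i = x j" "i \<noteq> j" using assms by (auto simp: inj_on_def)
  then obtain i j where ij: "i < j" "j < N" "x i = x j" by (metis nat_neq_iff)
  then have "(\<Prod>i<j. \<bar>x i - x j\<bar> ^ 2) = 0" by (intro prod_zero) auto
  then have "(\<Prod>j<N. \<Prod>i<j. \<bar>x i - x j\<bar> ^ 2) = 0" using ij by (intro prod_zero) auto
  then show ?thesis by (simp add: ensemble_weight_def)
qed

section \<open>Bounds on the weight and the partition function\<close>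

context convex_ensemble begin

abbreviation wt :: "nat \<Rightarrow> (nat \<Rightarrow> real) \<Rightarrow> real" where "wt \<equiv> ensemble_weight h Q"
abbreviation Z :: "nat \<Rightarrow> real" where "Z \<equiv> partition_function h Q"
abbreviation leb :: "nat \<Rightarrow> (nat \<Rightarrow> real) measure" where "leb N \<equiv> \<Pi>\<^sub>M i\<in>{..<N}. lborel"

text \<open>The minimum of I, because \<open>En\<close> exceeds I by \<open>C\<close>; it is the
  leading exponent of the partition function on the scale \<open>N\<^sup>2\<close>.\<close>

definition e0 :: real where "e0 = E0 - C"

text \<open>The negative logarithm of the weight; the term with \<open>Q\<close> appears because \<open>w\<close> distributes only
  \<open>N - 1\<close> of the \<open>N\<close> copies of \<open>Q\<close> over the pairs.\<close>

definition hamiltonian :: "nat \<Rightarrow> (nat \<Rightarrow> real) \<Rightarrow> real" where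
  "hamiltonian N x = 2 * (\<Sum>j<N. \<Sum>i<j. w (x i) (x j)) + (\<Sum>j<N. Q (x j)) - real N * (real N - 1) * C"

text \<open>Distinctness keeps the default value of \<open>ln 0\<close> out of the sum;
  configurations with coinciding particles have weight 0.\<close>

lemma weight_eq_exp_hamiltonian:
  assumes "inj_on x {..<N}"
  shows "wt N x = exp (- hamiltonian N x)"
proof -
  have "(\<Prod>i<j. \<bar>x i - x j\<bar> ^ 2) = exp (\<Sum>i<j. 2 * ln \<bar>x i - x j\<bar>)" if "j < N" for j
  proof -
    have "x i \<noteq> x j" if "i < j" for i using assms that \<open>j < N\<close> by (auto simp: inj_on_def)
    then show ?thesis
      unfolding exp_sum[OF finite_lessThan] by (intro prod.cong refl) (auto simp: exp_double)
  qed
  then have "(\<Prod>j<N. \<Prod>i<j. \<bar>x i - x j\<bar> ^ 2) = exp (\<Sum>j<N. \<Sum>i<j. 2 * ln \<bar>x i - x j\<bar>)"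
    by (simp add: exp_sum)
  then have "wt N x = exp ((\<Sum>j<N. \<Sum>i<j. 2 * ln \<bar>x i - x j\<bar>)
      + (- real N * (\<Sum>j<N. Q (x j)) - (\<Sum>j<N. \<Sum>i<j. h (x i - x j))))"
    unfolding ensemble_weight_def by (simp only: exp_add)
  also have "(\<Sum>j<N. \<Sum>i<j. 2 * ln \<bar>x i - x j\<bar>) + (- real N * (\<Sum>j<N. Q (x j)) - (\<Sum>j<N. \<Sum>i<j. h (x i - x j)))
     = - hamiltonian N x"
  proof -
    have "(\<Sum>j<N. \<Sum>i<j. 2 * w (x i) (x j)) = (\<Sum>j<N. \<Sum>i<j. (Q (x i) + Q (x j)) + h (x i - x j) + 2 * C - 2 * ln \<bar>x i - x j\<bar>)"
      by (intro sum.cong refl) (simp add: w_def w0_def field_simps)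
    also have "\<dots> = (real N - 1) * (\<Sum>j<N. Q (x j)) + (\<Sum>j<N. \<Sum>i<j. h (x i - x j)) + real N * (real N - 1) * C
        - (\<Sum>j<N. \<Sum>i<j. 2 * ln \<bar>x i - x j\<bar>)"
      using sum_pairs_add[of "\<lambda>j. Q (x j)" N] sum_pairs_const[of "2 * C" N]
      by (simp only: sum.distrib sum_subtractf) simp
    finally show ?thesis
      unfolding hamiltonian_def sum_distrib_left[of 2] by (simp only: algebra_simps)
  qed
  finally show ?thesis .
qed

text \<open>The pairs contribute \<open>a / 4\<close> times the sum of squares N - 1 times over, and
  the remaining sum of Q supplies the missing copy.\<close>

lemma hamiltonian_ge: "a / 4 * real N * (\<Sum>j<N. (x j)\<^sup>2) - (\<bar>C\<bar> + \<bar>Q 0\<bar>) * (real N)\<^sup>2 \<le> hamiltonian N x"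
proof -
  have "a / 4 * ((real N - 1) * (\<Sum>j<N. (x j)\<^sup>2)) = 2 * (\<Sum>j<N. \<Sum>i<j. a / 8 * ((x i)\<^sup>2 + (x j)\<^sup>2))"
    unfolding sum_pairs_add[of "\<lambda>j. (x j)\<^sup>2" N, symmetric] by (simp only: sum_distrib_left) simp
  also have "\<dots> \<le> 2 * (\<Sum>j<N. \<Sum>i<j. w (x i) (x j))"
    by (intro mult_left_mono sum_mono w_ge) auto
  finally have 1: "a / 4 * ((real N - 1) * (\<Sum>j<N. (x j)\<^sup>2)) \<le> 2 * (\<Sum>j<N. \<Sum>i<j. w (x i) (x j))" .
  have "(\<Sum>j<N. Q 0 + a / 2 * (x j)\<^sup>2) \<le> (\<Sum>j<N. Q (x j))" by (intro sum_mono Q_growth)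
  then have 2: "real N * Q 0 + a / 2 * (\<Sum>j<N. (x j)\<^sup>2) \<le> (\<Sum>j<N. Q (x j))"
    by (simp add: sum.distrib sum_distrib_left)
  have 3: "0 \<le> a * (\<Sum>j<N. (x j)\<^sup>2)" using a_pos by (auto intro!: mult_nonneg_nonneg sum_nonneg)
  have N2: "real N \<le> (real N)\<^sup>2" by (cases N) (auto simp: power2_eq_square)
  have "real N * (real N - 1) * C \<le> (real N)\<^sup>2 * \<bar>C\<bar>"
  proof -
    have "real N * (real N - 1) * C \<le> real N * (real N - 1) * \<bar>C\<bar>"
      by (cases N) (auto intro!: mult_left_mono)
    also have "\<dots> \<le> (real N)\<^sup>2 * \<bar>C\<bar>" by (intro mult_right_mono) (auto simp: power2_eq_square algebra_simps)
    finally show ?thesis .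
  qed
  moreover have "- ((real N)\<^sup>2 * \<bar>Q 0\<bar>) \<le> real N * Q 0"
  proof -
    have "- (real N * Q 0) \<le> real N * \<bar>Q 0\<bar>" by (simp add: abs_if mult_left_mono)
    also have "\<dots> \<le> (real N)\<^sup>2 * \<bar>Q 0\<bar>" using N2 by (intro mult_right_mono) auto
    finally show ?thesis by simp
  qed
  ultimately show ?thesis
    using 1 2 3 unfolding hamiltonian_def by (simp add: algebra_simps)
qed

lemma weight_le: "wt N x \<le> exp ((\<bar>C\<bar> + \<bar>Q 0\<bar>) * (real N)\<^sup>2 - a / 4 * real N * (\<Sum>j<N. (x j)\<^sup>2))"
proof (cases "inj_on x {..<N}")
  case True
  then show ?thesis using hamiltonian_ge[of N x] by (simp add: weight_eq_exp_hamiltonian)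
qed (simp add: ensemble_weight_eq_0)

lemma weight_measurable[measurable]: "wt N \<in> borel_measurable (leb N)"
proof -
  have [measurable]: "(\<lambda>x. x i) \<in> borel_measurable (leb N)" if "i < N" for i
    using measurable_component_singleton[of i "{..<N}" "\<lambda>_. lborel"] that by simp
  have "(\<lambda>x. (\<Prod>j<N. \<Prod>i<j. \<bar>x i - x j\<bar> ^ 2) *
     exp (- real N * (\<Sum>j<N. Q (x j)) - (\<Sum>j<N. \<Sum>i<j. h (x i - x j)))) \<in> borel_measurable (leb N)"
    by (intro borel_measurable_times borel_measurable_prod measurable_compose[OF _ borel_measurable_exp]
        borel_measurable_diff borel_measurable_sum borel_measurable_power borel_measurable_abs borel_measurable_const
        measurable_compose[OF _ Q_measurable] measurable_compose[OF _ h_measurable]) auto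
  then show ?thesis by (simp add: ensemble_weight_def[abs_def])
qed

lemma nn_integral_gaussian_weight:
  "(\<integral>\<^sup>+x. ennreal (exp (D - c * (\<Sum>j<N. (x j)\<^sup>2))) \<partial>leb N)
    = ennreal (exp D) * (\<integral>\<^sup>+x. ennreal (exp (- (c * x\<^sup>2))) \<partial>lborel) ^ N"
proof -
  have "ennreal (exp (D - c * (\<Sum>j<N. (x j)\<^sup>2))) = ennreal (exp D) * (\<Prod>j<N. ennreal (exp (- (c * (x j)\<^sup>2))))" for x :: "nat \<Rightarrow> real"
  proof -
    have "exp (D - c * (\<Sum>j<N. (x j)\<^sup>2)) = exp D * (\<Prod>j<N. exp (- (c * (x j)\<^sup>2)))"
      by (simp add: exp_sum[symmetric] sum_negf sum_distrib_left flip: exp_add)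
    then show ?thesis by (simp only: prod_ennreal exp_ge_zero ennreal_mult prod_nonneg)
  qed
  then have "(\<integral>\<^sup>+x. ennreal (exp (D - c * (\<Sum>j<N. (x j)\<^sup>2))) \<partial>leb N)
     = (\<integral>\<^sup>+x. ennreal (exp D) * (\<Prod>j<N. ennreal (exp (- (c * (x j)\<^sup>2)))) \<partial>leb N)" by simp
  also have "\<dots> = ennreal (exp D) * (\<integral>\<^sup>+x. (\<Prod>j<N. ennreal (exp (- (c * (x j)\<^sup>2)))) \<partial>leb N)"
    by (intro nn_integral_cmult borel_measurable_prod) auto
  also have "(\<integral>\<^sup>+x. (\<Prod>j<N. ennreal (exp (- (c * (x j)\<^sup>2)))) \<partial>leb N) = (\<Prod>j<N. \<integral>\<^sup>+x. ennreal (exp (- (c * x\<^sup>2))) \<partial>lborel)"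
    by (rule lborel_product.product_nn_integral_prod) auto
  finally show ?thesis by simp
qed

lemma nn_integral_weight_finite: "(\<integral>\<^sup>+x. ennreal (wt N x) \<partial>leb N) < \<infinity>"
\<comment> \<open>For N = 0 the Gaussian exponent \<open>a / 4 * real N\<close> vanishes, but then
  the underlying space is a single point.\<close>
proof (cases "N = 0")
  case False
  have "(\<integral>\<^sup>+x. ennreal (wt N x) \<partial>leb N)
      \<le> (\<integral>\<^sup>+x. ennreal (exp ((\<bar>C\<bar> + \<bar>Q 0\<bar>) * (real N)\<^sup>2 - a / 4 * real N * (\<Sum>j<N. (x j)\<^sup>2))) \<partial>leb N)"
    by (intro nn_integral_mono ennreal_leI weight_le)
  also have "\<dots> < \<infinity>"
    unfolding nn_integral_gaussian_weight
    using nn_integral_gaussian_finite[of "a / 4 * real N"] a_pos False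
    by (simp add: ennreal_mult_less_top power_less_top_ennreal)
  finally show ?thesis .
qed (simp add: PiM_empty nn_integral_count_space_finite)

lemma integrable_weight: "integrable (leb N) (wt N)"
  using nn_integral_weight_finite by (intro integrableI_nonneg) (auto simp: ensemble_weight_nonneg)

lemma nn_integral_weight: "(\<integral>\<^sup>+x. ennreal (wt N x) \<partial>leb N) = ennreal (Z N)"
  unfolding partition_function_def
  by (intro nn_integral_eq_integral integrable_weight) (auto simp: ensemble_weight_nonneg)

text \<open>Independent points with law \<mu> have mean energy \<open>E0\<close> per pair, so some
  sample inside the support does no worse than the mean. Its finite energy makes the points
  distinct.\<close>

lemma exists_low_energy_configuration:
  "\<exists>q. (\<forall>i<N. q i \<in> {-b..b}) \<and> inj_on q {..<N} \<and>
     2 * (\<Sum>j<N. \<Sum>i<j. w (q i) (q j)) \<le> real N * (real N - 1) * E0"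
proof -
  let ?P = "\<Pi>\<^sub>M i\<in>{..<N}. \<mu>"
  interpret P: product_prob_space "\<lambda>_::nat. \<mu>" "{..<N}" ..
  have [measurable]: "(\<lambda>x. x i) \<in> borel_measurable ?P" if "i < N" for i
    using measurable_component_singleton[of i "{..<N}" "\<lambda>_. \<mu>"] that
    by (simp add: measurable_cong_sets[OF refl \<mu>.events_eq_borel])
  have pair: "(\<integral>\<^sup>+x. K (x i) (x j) \<partial>?P) = ennreal E0" if ij: "i < j" "j < N" for i j
  proof -
    \<comment> \<open>Integrating out the i-th point first leaves \<Psi> at the j-th, whose mean is
      known.\<close>
    let ?I = "{..<N} - {i}"
    have I: "insert i ?I = {..<N}" using ij by auto
    have "(\<integral>\<^sup>+x. K (x i) (x j) \<partial>PiM (insert i ?I) (\<lambda>_. \<mu>))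
        = (\<integral>\<^sup>+x. \<integral>\<^sup>+y. K ((x(i := y)) i) ((x(i := y)) j) \<partial>\<mu> \<partial>PiM ?I (\<lambda>_. \<mu>))"
    proof (rule P.product_nn_integral_insert)
      show "(\<lambda>x. K (x i) (x j)) \<in> borel_measurable (PiM (insert i ?I) (\<lambda>_. \<mu>))"
        unfolding I using ij by (intro K_measurable') auto
    qed (use ij in auto)
    also have "\<dots> = (\<integral>\<^sup>+x. \<Psi> (x j) \<partial>PiM ?I (\<lambda>_. \<mu>))"
      using ij by (simp add: \<Psi>_def K_commute)
    also have "\<dots> = (\<integral>\<^sup>+y. \<Psi> y \<partial>distr (PiM ?I (\<lambda>_. \<mu>)) \<mu> (\<lambda>x. x j))"
      using ij by (subst nn_integral_distr) auto
    also have "distr (PiM ?I (\<lambda>_. \<mu>)) \<mu> (\<lambda>x. x j) = \<mu>"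
      using ij by (intro distr_PiM_component \<mu>.prob_space_axioms) auto
    finally show ?thesis unfolding I nn_integral_\<Psi> .
  qed
  let ?f = "\<lambda>x. (\<Sum>j<N. \<Sum>i<j. K (x i) (x j))"
  define c where "c = real N * (real N - 1) / 2 * E0"
  have c0: "0 \<le> c" unfolding c_def using E0_nonneg by (cases N) auto
  have fm[measurable]: "?f \<in> borel_measurable ?P"
    by (intro borel_measurable_sum K_measurable') auto
  have int: "(\<integral>\<^sup>+x. ?f x \<partial>?P) = ennreal c"
  proof -
    have "(\<integral>\<^sup>+x. ?f x \<partial>?P) = (\<Sum>j<N. \<Sum>i<j. \<integral>\<^sup>+x. K (x i) (x j) \<partial>?P)"
      by (subst nn_integral_sum) (auto intro!: borel_measurable_sum K_measurable' sum.cong nn_integral_sum)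
    also have "\<dots> = (\<Sum>j<N. \<Sum>i<j. ennreal E0)" by (intro sum.cong refl pair) auto
    also have "\<dots> = ennreal (\<Sum>j<N. \<Sum>i<j. E0)"       using E0_nonneg by (simp add: sum_ennreal sum_nonneg del: sum_constant)
    finally show ?thesis by (simp only: sum_pairs_const c_def)
  qed
  have aeS: "AE x in ?P. \<forall>i\<in>{..<N}. x i \<in> S"
  proof (intro AE_finite_allI)
    fix i assume "i \<in> {..<N}"
    then show "AE x in ?P. x i \<in> S"
      using AE_PiM_component[of "{..<N}" "\<lambda>_. \<mu>" i "\<lambda>x. x \<in> S"] AE_S \<mu>.prob_space_axioms by auto
  qed simp
  have "\<exists>x. (\<forall>i\<in>{..<N}. x i \<in> S) \<and> ?f x \<le> ennreal c"
  proof (rule ccontr)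
    assume "\<not> ?thesis"
    then have lt: "\<And>x. \<forall>i\<in>{..<N}. x i \<in> S \<Longrightarrow> ennreal c < ?f x" by (auto simp: not_le)
    have ae: "AE x in ?P. ennreal c < ?f x" using aeS by eventually_elim (rule lt)
    have "(\<integral>\<^sup>+x. ennreal c \<partial>?P) < (\<integral>\<^sup>+x. ?f x \<partial>?P)"
    proof (rule nn_integral_less)
      show "(\<integral>\<^sup>+x. ennreal c \<partial>?P) \<noteq> \<infinity>" by (simp add: P.emeasure_space_1)
      show "AE x in ?P. ennreal c \<le> ?f x" using ae by eventually_elim (rule less_imp_le)
      show "\<not> (AE x in ?P. ?f x \<le> ennreal c)"
      proof
        assume "AE x in ?P. ?f x \<le> ennreal c"
        with ae have "AE x in ?P. False" by eventually_elim auto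
        then show False by simp
      qed
    qed auto
    then show False by (simp add: int P.emeasure_space_1)
  qed
  then obtain q where q: "\<And>i. i < N \<Longrightarrow> q i \<in> S" "?f q \<le> ennreal c" by auto
  have fin: "?f q < \<infinity>" using q(2) by (rule le_less_trans) simp
  have ne: "q i \<noteq> q j" if "i < j" "j < N" for i j
  proof
    assume "q i = q j"
    then have "\<infinity> \<le> (\<Sum>i<j. K (q i) (q j))"
      using that member_le_sum[of i "{..<j}" "\<lambda>i. K (q i) (q j)"] by (auto simp: K_def)
    also have "\<dots> \<le> ?f q" using that by (intro member_le_sum) auto
    finally have "?f q = \<infinity>" by (simp only: infinity_ennreal_def top_unique)
    then show False using fin by (simp only: less_irrefl)
  qed
  then have inj: "inj_on q {..<N}"
    unfolding inj_on_def by (metis lessThan_iff nat_neq_iff)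
  have "?f q = (\<Sum>j<N. \<Sum>i<j. ennreal (w (q i) (q j)))"
    using ne by (intro sum.cong refl) (auto simp: K_def)
  also have "\<dots> = ennreal (\<Sum>j<N. \<Sum>i<j. w (q i) (q j))" by (simp add: sum_ennreal w_nonneg sum_nonneg)
  finally have "(\<Sum>j<N. \<Sum>i<j. w (q i) (q j)) \<le> c"
    using q(2) c0 by (simp add: ennreal_le_iff)
  then show ?thesis using q(1) inj unfolding c_def support_interval by (intro exI[of _ q]) auto
qed

text \<open>A low-energy configuration is thickened to a box with sides \<open>\<delta> / N\<close>.
  The volume is lost only on the scale exp(- N ln N), while the energy rises by at most a multiple
  of \<open>N\<^sup>2 * \<epsilon>\<close>; \<open>A\<close> absorbs the terms linear in N.\<close>

lemma partition_function_box:
  assumes \<epsilon>: "0 < \<epsilon>"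
  obtains \<delta> A where "0 < \<delta>" "\<delta> \<le> 1" "\<And>N. 0 < N \<Longrightarrow>
    (\<delta> / real N) ^ N * exp (- ((real N)\<^sup>2 * (e0 + \<epsilon>) + A * real N)) \<le> Z N"
proof -
  have "uniformly_continuous_on {-b..b + 1} Q"
    by (intro compact_uniformly_continuous continuous_on_subset[OF Q_continuous]) auto
  then obtain d where d: "d > 0" "\<And>x y. x \<in> {-b..b + 1} \<Longrightarrow> y \<in> {-b..b + 1} \<Longrightarrow> \<bar>y - x\<bar> < d \<Longrightarrow> \<bar>Q y - Q x\<bar> < \<epsilon> / 2"
    unfolding uniformly_continuous_on_def dist_real_def using \<epsilon> by (metis half_gt_zero)
  have "bounded (Q ` {-b..b + 1})"
    by (intro compact_imp_bounded compact_continuous_image continuous_on_subset[OF Q_continuous]) auto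
  then obtain D where D: "\<And>s. s \<in> {-b..b + 1} \<Longrightarrow> \<bar>Q s\<bar> \<le> D"
    unfolding bounded_iff by (metis image_eqI real_norm_def)
  \<comment> \<open>Small enough for the uniform continuity of Q and for
    \<open>L * \<delta> \<le> \<epsilon> / 2\<close>; the denominator has L + 1 because L may
    vanish.\<close>
  define \<delta> where "\<delta> = min 1 (min (d / 2) (\<epsilon> / (2 * (L + 1))))"
  have L: "0 < L + 1" using L_nonneg by simp
  have \<delta>: "0 < \<delta>" "\<delta> \<le> 1" "\<delta> < d" "L * \<delta> \<le> \<epsilon> / 2"
  proof -
    show "0 < \<delta>" "\<delta> \<le> 1" "\<delta> < d" using d \<epsilon> L by (auto simp: \<delta>_def)
    have "L * \<delta> \<le> (L + 1) * (\<epsilon> / (2 * (L + 1)))"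
      using L_nonneg \<epsilon> d by (intro mult_mono) (auto simp: \<delta>_def)
    also have "\<dots> = \<epsilon> / 2" using L by (simp add: field_simps)
    finally show "L * \<delta> \<le> \<epsilon> / 2" .
  qed
  have "(\<delta> / real N) ^ N * exp (- ((real N)\<^sup>2 * (e0 + \<epsilon>) + (\<bar>e0\<bar> + D) * real N)) \<le> Z N" if N: "0 < N" for N
  proof -
    obtain q where q: "\<And>i. i < N \<Longrightarrow> q i \<in> {-b..b}" "inj_on q {..<N}"
      "2 * (\<Sum>j<N. \<Sum>i<j. w (q i) (q j)) \<le> real N * (real N - 1) * E0"
      using exists_low_energy_configuration[of N] by blast
    \<comment> \<open>Shifting \<open>q i\<close> by an amount increasing in its rank only increases all mutual distances.\<close>
    define r where "r j = card {i \<in> {..<N}. q i < q j}" for j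
    have r: "r i + 1 \<le> r j" if "i < N" "q i < q j" for i j
    proof -
      have "insert i {k \<in> {..<N}. q k < q i} \<subseteq> {k \<in> {..<N}. q k < q j}" using that by auto
      then have "card (insert i {k \<in> {..<N}. q k < q i}) \<le> r j" unfolding r_def by (intro card_mono) auto
      then show ?thesis by (simp add: r_def)
    qed
    have rN: "r j + 1 \<le> N" if "j < N" for j
    proof -
      have "insert j {k \<in> {..<N}. q k < q j} \<subseteq> {..<N}" using that by auto
      then have "card (insert j {k \<in> {..<N}. q k < q j}) \<le> card {..<N}" by (intro card_mono) auto
      then show ?thesis by (simp add: r_def)
    qed
    define I where "I j = {q j + \<delta> * real (r j) / real N..q j + \<delta> * (real (r j) + 1) / real N}" for j
    have bound: "exp (- ((real N)\<^sup>2 * (e0 + \<epsilon>) + (\<bar>e0\<bar> + D) * real N)) \<le> wt N x" if x: "x \<in> Pi\<^sub>E {..<N} I" for x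
    proof -
      have xI: "q j + \<delta> * real (r j) / real N \<le> x j" "x j \<le> q j + \<delta> * (real (r j) + 1) / real N" if "j < N" for j
        using x that by (auto simp: I_def PiE_iff)
      have xq: "q j \<le> x j" "x j \<le> q j + \<delta>" if "j < N" for j
      proof -
        have "0 \<le> \<delta> * real (r j) / real N" using \<delta> by auto
        then show "q j \<le> x j" using xI(1)[OF that] by linarith
        have "real (r j) + 1 \<le> real N" using rN[OF that] by linarith
        then have "\<delta> * (real (r j) + 1) \<le> \<delta> * real N" using \<delta> by (intro mult_left_mono) auto
        then have "\<delta> * (real (r j) + 1) / real N \<le> \<delta>" using N by (subst pos_divide_le_eq) auto
        then show "x j \<le> q j + \<delta>" using xI(2)[OF that] by linarith
      qed
      have sep: "q j - q i \<le> x j - x i" if "i < N" "j < N" "q i < q j" for i j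
      proof -
        have "real (r i) + 1 \<le> real (r j)" using r[OF that(1,3)] by linarith
        then have "\<delta> * (real (r i) + 1) / real N \<le> \<delta> * real (r j) / real N"
          using \<delta> N by (intro divide_right_mono mult_left_mono) auto
        then show ?thesis using xI(1)[OF that(2)] xI(2)[OF that(1)] by linarith
      qed
      have dist: "\<bar>q i - q j\<bar> \<le> \<bar>x i - x j\<bar>" if "i < N" "j < N" for i j
        using sep[OF that] sep[OF that(2,1)] by (cases "q i" "q j" rule: linorder_cases) auto
      have qne: "q i \<noteq> q j" if "i < N" "j < N" "i \<noteq> j" for i j using q(2) that by (auto simp: inj_on_def)
      have xinj: "inj_on x {..<N}"
        using dist qne by (intro inj_onI) (metis abs_le_zero_iff diff_self eq_iff_diff_eq_0 abs_zero lessThan_iff)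
      have x_in: "x j \<in> {-b..b + 1}" and q_in: "q j \<in> {-b..b + 1}" if "j < N" for j
        using q(1)[OF that] xq[OF that] \<delta> by auto
      have Qd: "Q (x j) \<le> Q (q j) + \<epsilon> / 2" if "j < N" for j
        using d(2)[OF q_in[OF that] x_in[OF that]] xq[OF that] \<delta> by (simp add: abs_if split: if_splits)
      \<comment> \<open>The two halves of Q contribute \<open>\<epsilon> / 2\<close>, half of the
        change of h contributes \<open>\<epsilon> / 4\<close>, and the logarithm only helps.\<close>
      have wd: "w (x i) (x j) \<le> w (q i) (q j) + \<epsilon> * (3/4)" if "i < N" "j < N" "i \<noteq> j" for i j
      proof -
        have "ln \<bar>q i - q j\<bar> \<le> ln \<bar>x i - x j\<bar>"
          using dist[OF that(1,2)] qne[OF that] by (intro ln_mono) auto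
        moreover have "h (x i - x j) \<le> h (q i - q j) + L * \<delta>"
        proof -
          have "h (x i - x j) \<le> h (q i - q j) + L * \<bar>(x i - x j) - (q i - q j)\<bar>"
            using h_lipschitz[of "x i - x j" "q i - q j"] by linarith
          also have "L * \<bar>(x i - x j) - (q i - q j)\<bar> \<le> L * \<delta>"
            using L_nonneg xq[OF that(1)] xq[OF that(2)] by (intro mult_left_mono) (auto simp: abs_le_iff)
          finally show ?thesis by simp
        qed
        ultimately show ?thesis
          using Qd[OF that(1)] Qd[OF that(2)] \<delta>(4) \<epsilon> unfolding w_def w0_def by argo
      qed
      have "2 * (\<Sum>j<N. \<Sum>i<j. w (x i) (x j)) \<le> 2 * (\<Sum>j<N. \<Sum>i<j. w (q i) (q j) + \<epsilon> * (3/4))"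
        by (intro mult_left_mono sum_mono wd) auto
      also have "\<dots> = 2 * (\<Sum>j<N. \<Sum>i<j. w (q i) (q j)) + real N * (real N - 1) * (\<epsilon> * (3/4))"
        using sum_pairs_const[of "\<epsilon> * (3/4)" N] by (simp only: sum.distrib) simp
      also have "\<dots> \<le> real N * (real N - 1) * (E0 + \<epsilon> * (3/4))"
        using q(3) by (simp add: algebra_simps)
      finally have 1: "2 * (\<Sum>j<N. \<Sum>i<j. w (x i) (x j)) \<le> real N * (real N - 1) * (E0 + \<epsilon> * (3/4))" .
      have "(\<Sum>j<N. Q (x j)) \<le> (\<Sum>j<N. D)" using D x_in by (intro sum_mono) (force simp: abs_le_iff)
      then have 2: "(\<Sum>j<N. Q (x j)) \<le> D * real N" by (simp add: mult.commute)
      have "real N * (real N - 1) * (e0 + \<epsilon> * (3/4)) \<le> (real N)\<^sup>2 * (e0 + \<epsilon>) + \<bar>e0\<bar> * real N"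
      proof -
        have "real N * (real N - 1) * (\<epsilon> * (3/4)) \<le> (real N)\<^sup>2 * \<epsilon>"
          using \<epsilon> N by (intro mult_mono) (auto simp: power2_eq_square algebra_simps)
        moreover have "real N * (real N - 1) * e0 \<le> (real N)\<^sup>2 * e0 + \<bar>e0\<bar> * real N"
        proof -
          have "- e0 * real N \<le> \<bar>e0\<bar> * real N" by (intro mult_right_mono) auto
          then show ?thesis by (simp add: power2_eq_square algebra_simps)
        qed
        ultimately show ?thesis unfolding distrib_left by linarith
      qed
      then have "hamiltonian N x \<le> (real N)\<^sup>2 * (e0 + \<epsilon>) + (\<bar>e0\<bar> + D) * real N"
        using 1 2 unfolding hamiltonian_def e0_def by (simp add: algebra_simps)
      then show ?thesis by (simp add: weight_eq_exp_hamiltonian[OF xinj])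
    qed
    have "emeasure (leb N) (Pi\<^sub>E {..<N} I) = (\<Prod>j<N. emeasure lborel (I j))"
      by (rule lborel_product.emeasure_PiM) (auto simp: I_def)
    also have "\<dots> = (\<Prod>j<N. ennreal (\<delta> / real N))"
    proof (intro prod.cong refl)
      fix j
      have "(q j + \<delta> * (real (r j) + 1) / real N) - (q j + \<delta> * real (r j) / real N) = \<delta> / real N"
        by (simp add: distrib_left add_divide_distrib)
      moreover have "q j + \<delta> * real (r j) / real N \<le> q j + \<delta> * (real (r j) + 1) / real N"
        using \<delta> by (simp add: divide_right_mono)
      ultimately show "emeasure lborel (I j) = ennreal (\<delta> / real N)" by (simp add: I_def)
    qed
    also have "\<dots> = ennreal ((\<delta> / real N) ^ N)" using \<delta> by (simp add: ennreal_power)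
    finally have vol: "emeasure (leb N) (Pi\<^sub>E {..<N} I) = ennreal ((\<delta> / real N) ^ N)" .
    have Im: "Pi\<^sub>E {..<N} I \<in> sets (leb N)" by (intro sets_PiM_I_finite) (auto simp: I_def)
    let ?e = "exp (- ((real N)\<^sup>2 * (e0 + \<epsilon>) + (\<bar>e0\<bar> + D) * real N))"
    have "ennreal ((\<delta> / real N) ^ N * ?e) = (\<integral>\<^sup>+x. ennreal ?e * indicator (Pi\<^sub>E {..<N} I) x \<partial>leb N)"
      using \<delta> by (subst nn_integral_cmult_indicator[OF Im], subst vol)
        (simp add: mult.commute flip: ennreal_mult)
    also have "\<dots> \<le> (\<integral>\<^sup>+x. ennreal (wt N x) \<partial>leb N)"
    proof (intro nn_integral_mono)
      fix x
      show "ennreal ?e * indicator (Pi\<^sub>E {..<N} I) x \<le> ennreal (wt N x)"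
        using ennreal_leI[OF bound[of x]] by (cases "x \<in> Pi\<^sub>E {..<N} I") simp_all
    qed
    also have "\<dots> = ennreal (Z N)" by (rule nn_integral_weight)
    finally have le: "ennreal ((\<delta> / real N) ^ N * ?e) \<le> ennreal (Z N)" .
    have "0 \<le> Z N" unfolding partition_function_def by (intro Bochner_Integration.integral_nonneg) (simp add: ensemble_weight_nonneg)
    then show ?thesis using le by (subst (asm) ennreal_le_iff) auto
  qed
  then show ?thesis using that[of \<delta> "\<bar>e0\<bar> + D"] \<delta> by blast
qed

lemma Z_pos: "0 < Z N"
proof (cases "N = 0")
  case True
  have "ennreal (Z 0) = 1" unfolding nn_integral_weight[symmetric]
    by (simp add: PiM_empty nn_integral_count_space_finite ensemble_weight_def)
  then show ?thesis using True by (metis ennreal_eq_1 zero_less_one)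
next
  case False
  obtain \<delta> A where "0 < \<delta>" "(\<delta> / real N) ^ N * exp (- ((real N)\<^sup>2 * (e0 + 1) + A * real N)) \<le> Z N"
    using partition_function_box[of 1] False by (metis neq0_conv zero_less_one)
  moreover from this(1) have "0 < (\<delta> / real N) ^ N * exp (- ((real N)\<^sup>2 * (e0 + 1) + A * real N))"
    using False by (intro mult_pos_pos) auto
  ultimately show ?thesis by linarith
qed

section \<open>The ensemble and the probability of low weight\<close>

lemma prob_space_ensemble: "prob_space (ensemble h Q N)"
proof (rule prob_spaceI)
  have "emeasure (ensemble h Q N) (space (ensemble h Q N)) = (\<integral>\<^sup>+x. ennreal (wt N x / Z N) \<partial>leb N)"
    unfolding ensemble_def by (subst emeasure_density) (auto intro!: nn_integral_cong)
  also have "\<dots> = (\<integral>\<^sup>+x. ennreal (wt N x) / ennreal (Z N) \<partial>leb N)"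
    using Z_pos by (simp add: divide_ennreal ensemble_weight_nonneg)
  also have "\<dots> = ennreal (Z N) / ennreal (Z N)"
    by (subst nn_integral_divide) (auto simp: nn_integral_weight)
  also have "\<dots> = 1" using Z_pos[of N] by (simp add: divide_ennreal)
  finally show "emeasure (ensemble h Q N) (space (ensemble h Q N)) = 1" .
qed

lemma sets_ensemble[measurable_cong, simp]: "sets (ensemble h Q N) = sets (leb N)"
  by (simp add: ensemble_def)

lemma emeasure_ensemble:
  assumes [measurable]: "A \<in> sets (leb N)"
  shows "emeasure (ensemble h Q N) A = (\<integral>\<^sup>+x. ennreal (wt N x) * indicator A x \<partial>leb N) / ennreal (Z N)"
proof -
  have "emeasure (ensemble h Q N) A = (\<integral>\<^sup>+x. ennreal (wt N x) * indicator A x / ennreal (Z N) \<partial>leb N)"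
    unfolding ensemble_def using Z_pos[of N]
    by (subst emeasure_density)
       (auto intro!: nn_integral_cong simp: divide_ennreal[symmetric] ensemble_weight_nonneg indicator_def)
  also have "\<dots> = (\<integral>\<^sup>+x. ennreal (wt N x) * indicator A x \<partial>leb N) / ennreal (Z N)"
    by (intro nn_integral_divide) auto
  finally show ?thesis .
qed

text \<open>For distinct particles this says that the hamiltonian is at most
  \<open>N\<^sup>2 * (e0 + \<epsilon>)\<close>; configurations with coinciding particles are never
  good.\<close>

definition good :: "real \<Rightarrow> nat \<Rightarrow> (nat \<Rightarrow> real) \<Rightarrow> bool" where
  "good \<epsilon> N x \<longleftrightarrow> exp (- ((real N)\<^sup>2 * (e0 + \<epsilon>))) \<le> wt N x"

lemma good_measurable[measurable]: "Measurable.pred (leb N) (good \<epsilon> N)"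
  unfolding good_def by measurable

text \<open>The box estimate is applied with \<open>\<epsilon> / 2\<close>; the other half absorbs
  the volume factor, whose logarithm is only of order N ln N.\<close>

lemma Z_ge:
  assumes "0 < \<epsilon>"
  shows "\<forall>\<^sub>F N in sequentially. exp (- ((real N)\<^sup>2 * (e0 + \<epsilon>))) \<le> Z N"
proof -
  obtain \<delta> A where \<delta>: "0 < \<delta>" and Z: "\<And>N. 0 < N \<Longrightarrow>
    (\<delta> / real N) ^ N * exp (- ((real N)\<^sup>2 * (e0 + \<epsilon> / 2) + A * real N)) \<le> Z N"
    using partition_function_box[of "\<epsilon> / 2"] assms by (metis half_gt_zero)
  have "(\<lambda>N. ln \<delta> / real N - ln (real N) / real N - A / real N) \<longlonglongrightarrow> 0 - 0 - 0"
    by (intro tendsto_diff tendsto_divide_0[OF tendsto_const] lim_ln_over_n filterlim_at_top_imp_at_infinity filterlim_real_sequentially)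
  then have "\<forall>\<^sub>F N in sequentially. - \<epsilon> / 2 < ln \<delta> / real N - ln (real N) / real N - A / real N"
    using assms by (intro order_tendstoD(1)) auto
  then show ?thesis using eventually_gt_at_top[of 0]
  proof eventually_elim
    case (elim N)
    have "(real N)\<^sup>2 * (- \<epsilon> / 2) \<le> (real N)\<^sup>2 * (ln \<delta> / real N - ln (real N) / real N - A / real N)"
      using elim by (intro mult_left_mono) auto
    also have "\<dots> = real N * (ln \<delta> - ln (real N)) - A * real N"
      using elim by (simp add: power2_eq_square field_simps)
    finally have "- ((real N)\<^sup>2 * (e0 + \<epsilon>)) \<le> real N * (ln \<delta> - ln (real N)) + (- ((real N)\<^sup>2 * (e0 + \<epsilon> / 2) + A * real N))"
      by (simp add: algebra_simps)
    then have "exp (- ((real N)\<^sup>2 * (e0 + \<epsilon>))) \<le> exp (real N * (ln \<delta> - ln (real N))) * exp (- ((real N)\<^sup>2 * (e0 + \<epsilon> / 2) + A * real N))"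
      by (subst exp_add[symmetric]) simp
    also have "exp (real N * (ln \<delta> - ln (real N))) = (\<delta> / real N) ^ N"
      using elim \<delta> by (simp add: exp_of_nat_mult exp_diff)
    also have "(\<delta> / real N) ^ N * exp (- ((real N)\<^sup>2 * (e0 + \<epsilon> / 2) + A * real N)) \<le> Z N"
      by (rule Z[OF elim(2)])
    finally show ?case .
  qed
qed

text \<open>A small weight alone does not help, because the volume is infinite. The weight is split
  into its powers with exponents 1 - \<tau> and \<tau>: the first is bounded by the threshold, the
  second by an integrable Gaussian.\<close>

lemma prob_not_good:
  assumes \<epsilon>: "0 < \<epsilon>"
  shows "\<forall>\<^sub>F N in sequentially.
    measure (ensemble h Q N) {x \<in> space (leb N). \<not> good \<epsilon> N x} \<le> exp (- (\<epsilon> / 4 * real N))"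
proof -
  define C' where "C' = \<bar>C\<bar> + \<bar>Q 0\<bar>"
  define D where "D = \<bar>e0 + \<epsilon> + C'\<bar> + 1"
  \<comment> \<open>Makes the interpolation cost \<open>\<tau> * (e0 + \<epsilon> + C')\<close> at
    most \<open>\<epsilon> / 4\<close>. A second quarter of \<epsilon> is spent on \<open>Z\<close>,
    a third on the Gaussian integrals, and the last one remains as the rate.\<close>
  define \<tau> where "\<tau> = min (1/2) (\<epsilon> / (4 * D))"
  have D: "0 < D" by (simp add: D_def add_nonneg_pos)
  have \<tau>: "0 < \<tau>" "\<tau> < 1" using \<epsilon> D by (auto simp: \<tau>_def)
  have \<tau>D: "\<tau> * (e0 + \<epsilon> + C') \<le> \<epsilon> / 4"
  proof -
    have "\<tau> * (e0 + \<epsilon> + C') \<le> \<tau> * D" using \<tau> by (intro mult_left_mono) (auto simp: D_def)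
    also have "\<dots> \<le> \<epsilon> / (4 * D) * D" using D by (intro mult_right_mono) (auto simp: \<tau>_def)
    finally show ?thesis using D by simp
  qed
  define G where "G = enn2real (\<integral>\<^sup>+x. ennreal (exp (- (\<tau> * a / 4 * x\<^sup>2))) \<partial>lborel) + 1"
  have "0 < \<tau> * a / 4" using \<tau> a_pos by simp
  from nn_integral_gaussian_finite[OF this]
  have G: "(\<integral>\<^sup>+x. ennreal (exp (- (\<tau> * a / 4 * x\<^sup>2))) \<partial>lborel) \<le> ennreal G" and G1: "1 \<le> G"
    by (auto simp: G_def less_top)
  have bd: "measure (ensemble h Q N) {x \<in> space (leb N). \<not> good \<epsilon> N x}
      \<le> exp ((real N)\<^sup>2 * (\<tau> * C' - (1 - \<tau>) * (e0 + \<epsilon>)) + real N * ln G) / Z N" if N: "0 < N" for N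
  proof -
    let ?B = "{x \<in> space (leb N). \<not> good \<epsilon> N x}"
    let ?c = "exp (- ((1 - \<tau>) * ((real N)\<^sup>2 * (e0 + \<epsilon>))))"
    have pw: "wt N x * indicator ?B x \<le> ?c * exp (\<tau> * C' * (real N)\<^sup>2 - \<tau> * a / 4 * (\<Sum>j<N. (x j)\<^sup>2))" for x
    proof (cases "x \<in> ?B \<and> wt N x > 0")
      case True
      then have w: "0 < wt N x" "wt N x < exp (- ((real N)\<^sup>2 * (e0 + \<epsilon>)))" by (auto simp: good_def)
      have l1: "ln (wt N x) \<le> - ((real N)\<^sup>2 * (e0 + \<epsilon>))"
        using w by (metis exp_gt_zero less_imp_le ln_exp ln_le_cancel_iff)
      have l2: "ln (wt N x) \<le> C' * (real N)\<^sup>2 - a / 4 * real N * (\<Sum>j<N. (x j)\<^sup>2)"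
        using w weight_le[of N x] unfolding C'_def by (metis exp_gt_zero ln_exp ln_le_cancel_iff)
      \<comment> \<open>Giving up the factor N makes the Gaussian integral \<open>G\<close>
        independent of N.\<close>
      also have "\<dots> \<le> C' * (real N)\<^sup>2 - a / 4 * (\<Sum>j<N. (x j)\<^sup>2)"
      proof -
        have "1 * (a / 4 * (\<Sum>j<N. (x j)\<^sup>2)) \<le> real N * (a / 4 * (\<Sum>j<N. (x j)\<^sup>2))"
          using N a_pos by (intro mult_right_mono mult_nonneg_nonneg sum_nonneg) auto
        then show ?thesis by (simp add: algebra_simps)
      qed
      finally have l2: "ln (wt N x) \<le> C' * (real N)\<^sup>2 - a / 4 * (\<Sum>j<N. (x j)\<^sup>2)" .
      have "ln (wt N x) = (1 - \<tau>) * ln (wt N x) + \<tau> * ln (wt N x)" by (simp add: algebra_simps)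
      also have "\<dots> \<le> (1 - \<tau>) * (- ((real N)\<^sup>2 * (e0 + \<epsilon>))) + \<tau> * (C' * (real N)\<^sup>2 - a / 4 * (\<Sum>j<N. (x j)\<^sup>2))"
        using \<tau> by (intro add_mono mult_left_mono l1 l2) auto
      finally have "exp (ln (wt N x)) \<le> ?c * exp (\<tau> * C' * (real N)\<^sup>2 - \<tau> * a / 4 * (\<Sum>j<N. (x j)\<^sup>2))"
        by (subst exp_add[symmetric]) (simp add: algebra_simps)
      then show ?thesis using True w by simp
    next
      case False
      then have "wt N x * indicator ?B x = 0"
        using ensemble_weight_nonneg[of h Q N x] by (auto simp: indicator_def)
      then show ?thesis by (simp only: mult_nonneg_nonneg exp_ge_zero)
    qed
    have "(\<integral>\<^sup>+x. ennreal (wt N x) * indicator ?B x \<partial>leb N)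
       \<le> (\<integral>\<^sup>+x. ennreal ?c * ennreal (exp (\<tau> * C' * (real N)\<^sup>2 - \<tau> * a / 4 * (\<Sum>j<N. (x j)\<^sup>2))) \<partial>leb N)"
    proof (intro nn_integral_mono)
      fix x
      have "ennreal (wt N x) * indicator ?B x = ennreal (wt N x * indicator ?B x)" by (auto simp: indicator_def)
      also have "\<dots> \<le> ennreal (?c * exp (\<tau> * C' * (real N)\<^sup>2 - \<tau> * a / 4 * (\<Sum>j<N. (x j)\<^sup>2)))"
        by (rule ennreal_leI[OF pw])
      finally show "ennreal (wt N x) * indicator ?B x \<le> ennreal ?c * ennreal (exp (\<tau> * C' * (real N)\<^sup>2 - \<tau> * a / 4 * (\<Sum>j<N. (x j)\<^sup>2)))"
        by (simp add: ennreal_mult)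
    qed
    also have "\<dots> = ennreal ?c * (\<integral>\<^sup>+x. ennreal (exp (\<tau> * C' * (real N)\<^sup>2 - \<tau> * a / 4 * (\<Sum>j<N. (x j)\<^sup>2))) \<partial>leb N)"
      by (intro nn_integral_cmult) auto
    also have "\<dots> \<le> ennreal ?c * (ennreal (exp (\<tau> * C' * (real N)\<^sup>2)) * ennreal G ^ N)"
      unfolding nn_integral_gaussian_weight using G by (intro mult_left_mono power_mono) auto
    also have "\<dots> = ennreal (?c * (exp (\<tau> * C' * (real N)\<^sup>2) * G ^ N))"
      using G1 by (simp add: ennreal_power ennreal_mult)
    also have "?c * (exp (\<tau> * C' * (real N)\<^sup>2) * G ^ N)
       = exp ((real N)\<^sup>2 * (\<tau> * C' - (1 - \<tau>) * (e0 + \<epsilon>)) + real N * ln G)"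
    proof -
      have "G ^ N = exp (real N * ln G)" using G1 by (simp add: exp_of_nat_mult)
      then show ?thesis by (simp add: algebra_simps flip: exp_add)
    qed
    finally have int: "(\<integral>\<^sup>+x. ennreal (wt N x) * indicator ?B x \<partial>leb N)
      \<le> ennreal (exp ((real N)\<^sup>2 * (\<tau> * C' - (1 - \<tau>) * (e0 + \<epsilon>)) + real N * ln G))" .
    have "emeasure (ensemble h Q N) ?B \<le> ennreal (exp ((real N)\<^sup>2 * (\<tau> * C' - (1 - \<tau>) * (e0 + \<epsilon>)) + real N * ln G)) / ennreal (Z N)"
      by (subst emeasure_ensemble) (auto intro!: divide_right_mono_ennreal int)
    also have "\<dots> = ennreal (exp ((real N)\<^sup>2 * (\<tau> * C' - (1 - \<tau>) * (e0 + \<epsilon>)) + real N * ln G) / Z N)"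
      using Z_pos by (subst divide_ennreal) auto
    finally show ?thesis
      unfolding measure_def using Z_pos[of N] by (intro enn2real_leI) auto
  qed
  have "(\<lambda>N. ln G / real N) \<longlonglongrightarrow> 0"
    by (intro tendsto_divide_0[OF tendsto_const] filterlim_at_top_imp_at_infinity filterlim_real_sequentially)
  then have "\<forall>\<^sub>F N in sequentially. ln G / real N < \<epsilon> / 4" using \<epsilon> by (intro order_tendstoD(2)) auto
  moreover have "\<forall>\<^sub>F N in sequentially. exp (- ((real N)\<^sup>2 * (e0 + \<epsilon> / 4))) \<le> Z N"
    using \<epsilon> by (intro Z_ge) auto
  ultimately show ?thesis using eventually_gt_at_top[of 0]
  proof eventually_elim
    case (elim N)
    have "measure (ensemble h Q N) {x \<in> space (leb N). \<not> good \<epsilon> N x}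
      \<le> exp ((real N)\<^sup>2 * (\<tau> * C' - (1 - \<tau>) * (e0 + \<epsilon>)) + real N * ln G) / exp (- ((real N)\<^sup>2 * (e0 + \<epsilon> / 4)))"
      using elim by (intro order_trans[OF bd] divide_left_mono mult_pos_pos Z_pos) auto
    also have "\<dots> = exp ((real N)\<^sup>2 * (\<tau> * (e0 + \<epsilon> + C') - 3 / 4 * \<epsilon>) + real N * ln G)"
      by (simp add: algebra_simps flip: exp_diff)
    also have "\<dots> \<le> exp ((real N)\<^sup>2 * (\<epsilon> / 4 - 3 / 4 * \<epsilon>) + (real N)\<^sup>2 * (\<epsilon> / 4))"
    proof -
      have "real N * ln G \<le> (real N)\<^sup>2 * (\<epsilon> / 4)"
        using elim by (simp add: power2_eq_square field_simps)
      moreover have "(real N)\<^sup>2 * (\<tau> * (e0 + \<epsilon> + C') - 3 / 4 * \<epsilon>) \<le> (real N)\<^sup>2 * (\<epsilon> / 4 - 3 / 4 * \<epsilon>)"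
        using \<tau>D by (intro mult_left_mono) auto
      ultimately show ?thesis by (subst exp_le_cancel_iff) (rule add_mono)
    qed
    also have "\<dots> = exp (- (\<epsilon> / 4 * (real N)\<^sup>2))" by (simp add: algebra_simps)
    also have "\<dots> \<le> exp (- (\<epsilon> / 4 * real N))"
      using elim \<epsilon> by (simp add: power2_eq_square)
    finally show ?case .
  qed
qed

end

section \<open>Empirical measures\<close>

text \<open>The law of x at a uniformly chosen index. For N = 0 the index distribution is
  unspecified but still a probability, so \<open>real_distribution_emp\<close> needs no case
  distinction.\<close>

definition emp :: "nat \<Rightarrow> (nat \<Rightarrow> real) \<Rightarrow> real measure" where
  "emp N x = distr (measure_pmf (pmf_of_set {..<N})) borel x"

lemma real_distribution_emp: "real_distribution (emp N x)"
  unfolding emp_def by (intro real_distribution_distr prob_space_measure_pmf) auto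

lemma integral_emp:
  assumes "0 < N" "f \<in> borel_measurable borel"
  shows "(LINT t|emp N x. f t) = (\<Sum>i<N. f (x i)) / real N"
proof -
  have "{..<N} \<noteq> {}" using assms(1) by auto
  then show ?thesis
    using assms unfolding emp_def by (subst integral_distr) (auto simp: integral_pmf_of_set)
qed

lemma nn_integral_emp:
  assumes "0 < N" "f \<in> borel_measurable borel" "\<And>t. 0 \<le> f t"
  shows "(\<integral>\<^sup>+t. ennreal (f t) \<partial>emp N x) = ennreal ((\<Sum>i<N. f (x i)) / real N)"
proof -
  have "{..<N} \<noteq> {}" using assms(1) by auto
  then show ?thesis
    using assms unfolding emp_def
    by (subst nn_integral_distr)
      (auto simp: nn_integral_pmf_of_set sum_ennreal divide_ennreal sum_nonneg ennreal_of_nat_eq_real_of_nat)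
qed

lemma integral_emp_pair:
  fixes F :: "real \<times> real \<Rightarrow> real"
  assumes N: "0 < N" and F[measurable]: "F \<in> borel_measurable (borel \<Otimes>\<^sub>M borel)" and bd: "\<And>p. \<bar>F p\<bar> \<le> D"
  shows "(LINT p|(emp N x \<Otimes>\<^sub>M emp N x). F p) = (\<Sum>i<N. \<Sum>j<N. F (x i, x j)) / (real N)\<^sup>2"
proof -
  interpret E: real_distribution "emp N x" by (rule real_distribution_emp)
  interpret EE: pair_prob_space "emp N x" "emp N x" ..
  have [measurable]: "F \<in> borel_measurable (emp N x \<Otimes>\<^sub>M emp N x)"
    using F by (simp cong: measurable_cong_sets)
  have "integrable (emp N x \<Otimes>\<^sub>M emp N x) F"
    by (intro EE.integrable_const_bound[where B=D]) (auto simp: bd)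
  from EE.integral_fst'[OF this]
  have "(LINT p|(emp N x \<Otimes>\<^sub>M emp N x). F p) = (LINT s|emp N x. LINT t|emp N x. F (s, t))" ..
  also have "\<dots> = (LINT s|emp N x. (\<Sum>j<N. F (s, x j)) / real N)"
    using N by (intro Bochner_Integration.integral_cong refl integral_emp) auto
  also have "\<dots> = (\<Sum>i<N. (\<Sum>j<N. F (x i, x j)) / real N) / real N"
    using N by (intro integral_emp) auto
  also have "\<dots> = (\<Sum>i<N. \<Sum>j<N. F (x i, x j)) / (real N)\<^sup>2"
    by (simp add: sum_divide_distrib power2_eq_square field_simps)
  finally show ?thesis .
qed

lemma double_sum_pairs:
  "(\<Sum>i<N. \<Sum>j<N. f i j) = (\<Sum>j<N. \<Sum>i<j. f i j + f j i) + (\<Sum>i<N. f i i)" for f :: "nat \<Rightarrow> nat \<Rightarrow> real"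
proof (induction N)
  case (Suc N)
  have "(\<Sum>i<Suc N. \<Sum>j<Suc N. f i j) = (\<Sum>i<N. \<Sum>j<N. f i j) + (\<Sum>i<N. f i N) + (\<Sum>j<N. f N j) + f N N"
    by (simp add: sum.distrib)
  then show ?case by (simp add: Suc.IH sum.distrib)
qed simp

text \<open>Bounded second moments make the Skorohod coupling converge in mean. The mean distance of
  the coupled variables, times \<Lambda>, bounds the difference for every f simultaneously, so this
  is convergence in the first-order Wasserstein distance.\<close>

lemma weak_conv_lipschitz_uniform:
  assumes rd: "\<And>n. real_distribution (\<nu> n)" and rd': "real_distribution \<nu>'"
    and wc: "weak_conv_m \<nu> \<nu>'"
    and sq: "\<And>n. (\<integral>\<^sup>+x. ennreal (x\<^sup>2) \<partial>\<nu> n) \<le> ennreal A" and sq': "(\<integral>\<^sup>+x. ennreal (x\<^sup>2) \<partial>\<nu>') \<le> ennreal A"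
    and A: "0 \<le> A" and \<eta>: "0 < \<eta>"
  shows "\<forall>\<^sub>F n in sequentially. \<forall>\<Lambda>\<ge>0. \<forall>f. (\<forall>s t. \<bar>f s - f t\<bar> \<le> \<Lambda> * \<bar>s - t\<bar>) \<longrightarrow>
    \<bar>(LINT x|\<nu> n. f x) - (LINT x|\<nu>'. f x)\<bar> \<le> \<Lambda> * \<eta>"
proof -
  from Skorohod[OF rd rd' wc] obtain \<Omega> :: "real measure" and Yn Y where
    O: "prob_space \<Omega>" and Yn[measurable]: "\<And>n. Yn n \<in> borel_measurable \<Omega>"
    and dn: "\<And>n. distr \<Omega> borel (Yn n) = \<nu> n"
    and Y[measurable]: "Y \<in> borel_measurable \<Omega>" and d: "distr \<Omega> borel Y = \<nu>'"
    and lim: "\<And>x. x \<in> space \<Omega> \<Longrightarrow> (\<lambda>n. Yn n x) \<longlonglongrightarrow> Y x"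
    by force
  interpret O: prob_space \<Omega> by fact
  have sn: "(\<integral>\<^sup>+u. ennreal ((Yn n u)\<^sup>2) \<partial>\<Omega>) \<le> ennreal A" for n
    using sq[of n] unfolding dn[symmetric] by (subst (asm) nn_integral_distr) auto
  have s: "(\<integral>\<^sup>+u. ennreal ((Y u)\<^sup>2) \<partial>\<Omega>) \<le> ennreal A"
    using sq' unfolding d[symmetric] by (subst (asm) nn_integral_distr) auto
  have fin: "(\<integral>\<^sup>+u. ennreal ((Yn n u)\<^sup>2) \<partial>\<Omega>) < \<infinity>" "(\<integral>\<^sup>+u. ennreal ((Y u)\<^sup>2) \<partial>\<Omega>) < \<infinity>" for n
    using le_less_trans[OF sn] le_less_trans[OF s] by auto
  note in1 = integrable_abs_of_square[OF O _ fin(1)] and in2 = integrable_abs_of_square[OF O _ fin(2)]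
  have i1: "integrable \<Omega> (\<lambda>u. (Yn n u)\<^sup>2)" "integrable \<Omega> (Yn n)" for n
    using in1[of n] by (auto simp: integrable_abs_iff)
  have i2: "integrable \<Omega> (\<lambda>u. (Y u)\<^sup>2)" "integrable \<Omega> Y"
    using in2 by (auto simp: integrable_abs_iff)
  have I1: "(LINT u|\<Omega>. (Yn n u)\<^sup>2) \<le> A" for n
    using sn[of n] i1(1)[of n] A by (subst (asm) nn_integral_eq_integral) (auto simp: ennreal_le_iff)
  have I2: "(LINT u|\<Omega>. (Y u)\<^sup>2) \<le> A"
    using s i2(1) A by (subst (asm) nn_integral_eq_integral) (auto simp: ennreal_le_iff)
  \<comment> \<open>A distance beyond \<kappa> is at most its square over \<kappa>; this \<kappa>
    makes the resulting term \<open>4 * A / \<kappa>\<close> at most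
    \<open>\<eta> / 2\<close>.\<close>
  define \<kappa> where "\<kappa> = 8 * (A + 1) / \<eta>"
  have \<kappa>: "0 < \<kappa>" using A \<eta> by (simp add: \<kappa>_def)
  let ?d = "\<lambda>n u. \<bar>Yn n u - Y u\<bar>"
  have di: "integrable \<Omega> (?d n)" for n using i1 i2 by auto
  have "(\<lambda>n. LINT u|\<Omega>. min (?d n u) \<kappa>) \<longlonglongrightarrow> (LINT u|\<Omega>. 0)"
  proof (rule integral_dominated_convergence[where w="\<lambda>_. \<kappa>"])
    show "AE u in \<Omega>. (\<lambda>n. min (?d n u) \<kappa>) \<longlonglongrightarrow> 0"
    proof (intro AE_I2)
      fix u assume "u \<in> space \<Omega>"
      then have "(\<lambda>n. min (?d n u) \<kappa>) \<longlonglongrightarrow> min \<bar>Y u - Y u\<bar> \<kappa>" by (intro tendsto_intros lim)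
      then show "(\<lambda>n. min (?d n u) \<kappa>) \<longlonglongrightarrow> 0" using \<kappa> by simp
    qed
  qed (use \<kappa> in auto)
  then have "(\<lambda>n. LINT u|\<Omega>. min (?d n u) \<kappa>) \<longlonglongrightarrow> 0" by simp
  then have "\<forall>\<^sub>F n in sequentially. (LINT u|\<Omega>. min (?d n u) \<kappa>) < \<eta> / 2"
    using \<eta> by (intro order_tendstoD(2)) auto
  then show ?thesis
  proof eventually_elim
    case (elim n)
    have mi: "integrable \<Omega> (\<lambda>u. min (?d n u) \<kappa>)"
      using \<kappa> by (intro O.integrable_const_bound[where B=\<kappa>]) auto
    have "(LINT u|\<Omega>. ?d n u) \<le> (LINT u|\<Omega>. min (?d n u) \<kappa> + 2 / \<kappa> * ((Yn n u)\<^sup>2 + (Y u)\<^sup>2))"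
    proof (rule integral_mono)
      fix u
      have "z \<le> min z \<kappa> + z\<^sup>2 / \<kappa>" if "0 \<le> z" for z :: real
      proof (cases "z \<le> \<kappa>")
        case False
        then have "z * \<kappa> \<le> z * z" by (intro mult_left_mono that) auto
        then have "z \<le> z\<^sup>2 / \<kappa>" using \<kappa> by (simp add: power2_eq_square field_simps)
        then show ?thesis using False \<kappa> by simp
      qed (use \<kappa> in simp)
      from this[of "?d n u"] have "?d n u \<le> min (?d n u) \<kappa> + (Yn n u - Y u)\<^sup>2 / \<kappa>" by simp
      moreover have "(Yn n u - Y u)\<^sup>2 / \<kappa> \<le> 2 / \<kappa> * ((Yn n u)\<^sup>2 + (Y u)\<^sup>2)"
      proof -
        have "0 \<le> (Yn n u + Y u)\<^sup>2" by simp
        then have "(Yn n u - Y u)\<^sup>2 \<le> 2 * ((Yn n u)\<^sup>2 + (Y u)\<^sup>2)"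
          by (simp add: power2_eq_square algebra_simps)
        then show ?thesis using \<kappa> by (simp add: field_simps)
      qed
      ultimately show "?d n u \<le> min (?d n u) \<kappa> + 2 / \<kappa> * ((Yn n u)\<^sup>2 + (Y u)\<^sup>2)" by linarith
    qed (use di mi i1 i2 in auto)
    also have "\<dots> = (LINT u|\<Omega>. min (?d n u) \<kappa>) + 2 / \<kappa> * ((LINT u|\<Omega>. (Yn n u)\<^sup>2) + (LINT u|\<Omega>. (Y u)\<^sup>2))"
      using mi i1 i2 by simp
    also have "\<dots> \<le> \<eta> / 2 + 2 / \<kappa> * (A + A)"
      using elim I1[of n] I2 \<kappa> by (intro add_mono mult_left_mono) auto
    also have "2 / \<kappa> * (A + A) \<le> \<eta> / 2"
      using A \<eta> by (simp add: \<kappa>_def field_simps)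
    finally have dle: "(LINT u|\<Omega>. ?d n u) \<le> \<eta>" by simp
    show ?case
    proof (intro allI impI)
      fix \<Lambda> :: real and f :: "real \<Rightarrow> real"
      assume \<Lambda>: "0 \<le> \<Lambda>" and f: "\<forall>s t. \<bar>f s - f t\<bar> \<le> \<Lambda> * \<bar>s - t\<bar>"
      have "\<Lambda>-lipschitz_on UNIV f" using f \<Lambda> by (intro lipschitz_onI) (auto simp: dist_real_def)
      then have [measurable]: "f \<in> borel_measurable borel"
        by (intro borel_measurable_continuous_onI lipschitz_on_continuous_on)
      have fi: "integrable \<Omega> (\<lambda>u. f (X u))" if [measurable]: "X \<in> borel_measurable \<Omega>" and "integrable \<Omega> X" for X
      proof (rule Bochner_Integration.integrable_bound)
        show "integrable \<Omega> (\<lambda>u. \<bar>f 0\<bar> + \<Lambda> * \<bar>X u\<bar>)" using that by auto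
        show "AE u in \<Omega>. norm (f (X u)) \<le> norm (\<bar>f 0\<bar> + \<Lambda> * \<bar>X u\<bar>)"
        proof (intro AE_I2)
          fix u
          have "\<bar>f (X u) - f 0\<bar> \<le> \<Lambda> * \<bar>X u - 0\<bar>" using f by blast
          moreover have "0 \<le> \<Lambda> * \<bar>X u\<bar>" using \<Lambda> by simp
          ultimately show "norm (f (X u)) \<le> norm (\<bar>f 0\<bar> + \<Lambda> * \<bar>X u\<bar>)" by simp
        qed
      qed measurable
      have "(LINT x|\<nu> n. f x) = (LINT u|\<Omega>. f (Yn n u))" unfolding dn[symmetric] by (subst integral_distr) auto
      moreover have "(LINT x|\<nu>'. f x) = (LINT u|\<Omega>. f (Y u))" unfolding d[symmetric] by (subst integral_distr) auto
      ultimately have "(LINT x|\<nu> n. f x) - (LINT x|\<nu>'. f x) = (LINT u|\<Omega>. f (Yn n u) - f (Y u))"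
        using fi[OF Yn i1(2)] fi[OF Y i2(2)] by simp
      also have "\<bar>\<dots>\<bar> \<le> (LINT u|\<Omega>. \<bar>f (Yn n u) - f (Y u)\<bar>)" by (rule integral_abs_bound)
      also have "\<dots> \<le> (LINT u|\<Omega>. \<Lambda> * ?d n u)"
        using fi[OF Yn i1(2), of n] fi[OF Y i2(2)] di[of n] f by (intro integral_mono) auto
      also have "\<dots> \<le> \<Lambda> * \<eta>" using dle \<Lambda> by (simp add: mult_left_mono)
      finally show "\<bar>(LINT x|\<nu> n. f x) - (LINT x|\<nu>'. f x)\<bar> \<le> \<Lambda> * \<eta>" .
    qed
  qed
qed

section \<open>Good configurations have empirical measures close to the minimizer\<close>

context convex_ensemble begin

text \<open>The first summand bounds the second moments of good empirical measures with \<epsilon>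
  \<le> 1, the second one that of \<mu>; a common constant is needed when the two are
  compared.\<close>

definition A2 :: real where "A2 = 4 / a * (\<bar>C\<bar> + \<bar>Q 0\<bar> + \<bar>e0\<bar> + 1) + b\<^sup>2"

lemma A2_nonneg: "0 \<le> A2" unfolding A2_def using a_pos by (intro add_nonneg_nonneg mult_nonneg_nonneg) auto

lemma good_second_moment:
  assumes g: "good \<epsilon> N x" and N: "0 < N" and \<epsilon>: "\<epsilon> \<le> 1"
  shows "(\<Sum>j<N. (x j)\<^sup>2) \<le> A2 * real N"
proof -
  have "exp (- ((real N)\<^sup>2 * (e0 + \<epsilon>))) \<le> exp ((\<bar>C\<bar> + \<bar>Q 0\<bar>) * (real N)\<^sup>2 - a / 4 * real N * (\<Sum>j<N. (x j)\<^sup>2))"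
    using g weight_le[of N x] unfolding good_def by (rule order_trans)
  then have "a / 4 * real N * (\<Sum>j<N. (x j)\<^sup>2) \<le> (real N)\<^sup>2 * (\<bar>C\<bar> + \<bar>Q 0\<bar> + e0 + \<epsilon>)"
    by (simp add: algebra_simps)
  also have "\<dots> \<le> (real N)\<^sup>2 * (\<bar>C\<bar> + \<bar>Q 0\<bar> + \<bar>e0\<bar> + 1)" using \<epsilon> by (intro mult_left_mono) auto
  finally have "real N * (a / 4 * (\<Sum>j<N. (x j)\<^sup>2)) \<le> real N * (real N * (\<bar>C\<bar> + \<bar>Q 0\<bar> + \<bar>e0\<bar> + 1))"
    by (simp add: power2_eq_square algebra_simps)
  then have "a / 4 * (\<Sum>j<N. (x j)\<^sup>2) \<le> real N * (\<bar>C\<bar> + \<bar>Q 0\<bar> + \<bar>e0\<bar> + 1)"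
    using N by (subst (asm) mult_le_cancel_left_pos) auto
  then have "(\<Sum>j<N. (x j)\<^sup>2) \<le> (4 / a * (\<bar>C\<bar> + \<bar>Q 0\<bar> + \<bar>e0\<bar> + 1)) * real N"
    using a_pos by (simp add: field_simps)
  also have "\<dots> \<le> A2 * real N" unfolding A2_def by (intro mult_right_mono) auto
  finally show ?thesis .
qed

lemma good_second_moment_emp:
  assumes "good \<epsilon> N x" "0 < N" "\<epsilon> \<le> 1"
  shows "(\<integral>\<^sup>+t. ennreal (t\<^sup>2) \<partial>emp N x) \<le> ennreal A2"
  using good_second_moment[OF assms] assms(2)
  by (subst nn_integral_emp) (auto simp: field_simps intro!: ennreal_leI)

lemma second_moment_\<mu>: "(\<integral>\<^sup>+t. ennreal (t\<^sup>2) \<partial>\<mu>) \<le> ennreal A2"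
proof -
  have "(\<integral>\<^sup>+t. ennreal (t\<^sup>2) \<partial>\<mu>) \<le> (\<integral>\<^sup>+t. ennreal (b\<^sup>2) \<partial>\<mu>)"
  proof (rule nn_integral_mono_AE)
    show "AE t in \<mu>. ennreal (t\<^sup>2) \<le> ennreal (b\<^sup>2)"
      using AE_S
    proof eventually_elim
      case (elim t)
      have "\<bar>t\<bar> \<le> \<bar>b\<bar>" using S_le_b[OF elim] by simp
      then show ?case by (intro ennreal_leI) (simp add: abs_le_square_iff)
    qed
  qed
  also have "\<dots> \<le> ennreal A2"
    using \<mu>.emeasure_space_1 a_pos unfolding A2_def by (auto intro!: ennreal_leI add_nonneg_nonneg mult_nonneg_nonneg)
  finally show ?thesis .
qed

lemma good_inj:
  assumes "good \<epsilon> N x"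
  shows "inj_on x {..<N}"
proof (rule ccontr)
  assume "\<not> ?thesis"
  then have "wt N x = 0" by (rule ensemble_weight_eq_0)
  then show False using assms exp_gt_zero[of "- ((real N)\<^sup>2 * (e0 + \<epsilon>))"] unfolding good_def by linarith
qed

text \<open>Off the diagonal the truncated kernel is at most w, which is summed by the hamiltonian.
  On the diagonal each of the N terms equals k, and division by \<open>N\<^sup>2\<close> turns them
  into the error k/N.\<close>

lemma good_truncated_energy:
  assumes g: "good \<epsilon> N x" and N: "0 < N"
  shows "(LINT p|(emp N x \<Otimes>\<^sub>M emp N x). wtrunc k (fst p) (snd p)) \<le> E0 + (\<epsilon> + (\<bar>Q 0\<bar> + \<bar>C\<bar> + real k) / real N)"
proof -
  have inj: "inj_on x {..<N}" by (rule good_inj[OF g])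
  have H: "hamiltonian N x \<le> (real N)\<^sup>2 * (e0 + \<epsilon>)"
    using g unfolding good_def weight_eq_exp_hamiltonian[OF inj] by simp
  have [measurable]: "(\<lambda>p. wtrunc k (fst p) (snd p)) \<in> borel_measurable (borel \<Otimes>\<^sub>M borel)"
    using wtrunc_measurable[of k] by (simp add: split_beta)
  have "(\<Sum>i<N. \<Sum>j<N. wtrunc k (x i) (x j))
      = (\<Sum>j<N. \<Sum>i<j. wtrunc k (x i) (x j) + wtrunc k (x j) (x i)) + (\<Sum>i<N. wtrunc k (x i) (x i))"
    by (rule double_sum_pairs)
  also have "\<dots> \<le> (\<Sum>j<N. \<Sum>i<j. w (x i) (x j) + w (x i) (x j)) + (\<Sum>i<N. real k)"
  proof (intro add_mono sum_mono)
    fix i j assume "j \<in> {..<N}" "i \<in> {..<j}"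
    then have "i \<in> {..<N}" "i \<noteq> j" by auto
    then have ne: "x i \<noteq> x j" using inj_onD[OF inj, of i j] \<open>j \<in> {..<N}\<close> by blast
    have *: "wtrunc k s t \<le> w s t" if "s \<noteq> t" for s t using that by (simp add: wtrunc_eq)
    show "wtrunc k (x i) (x j) \<le> w (x i) (x j)" using ne by (rule *)
    show "wtrunc k (x j) (x i) \<le> w (x i) (x j)" using *[OF ne[symmetric]] unfolding w_commute[of "x j" "x i"] .
  qed (simp add: wtrunc_eq)
  also have "\<dots> = 2 * (\<Sum>j<N. \<Sum>i<j. w (x i) (x j)) + real N * real k"
    by (simp add: sum_distrib_left)
  also have "\<dots> = hamiltonian N x - (\<Sum>j<N. Q (x j)) + real N * (real N - 1) * C + real N * real k"
    by (simp add: hamiltonian_def)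
  also have "\<dots> \<le> (real N)\<^sup>2 * (e0 + \<epsilon>) + real N * \<bar>Q 0\<bar> + ((real N)\<^sup>2 * C + real N * \<bar>C\<bar>) + real N * real k"
  proof -
    have "(\<Sum>j<N. - \<bar>Q 0\<bar>) \<le> (\<Sum>j<N. Q (x j))"
    proof (intro sum_mono)
      fix j
      have "0 \<le> a / 2 * (x j)\<^sup>2" using a_pos by simp
      then show "- \<bar>Q 0\<bar> \<le> Q (x j)" using Q_growth[of "x j"] by linarith
    qed
    then have "- (\<Sum>j<N. Q (x j)) \<le> real N * \<bar>Q 0\<bar>" by simp
    moreover have "real N * (real N - 1) * C \<le> (real N)\<^sup>2 * C + real N * \<bar>C\<bar>"
    proof -
      have "real N * (- C) \<le> real N * \<bar>C\<bar>" by (intro mult_left_mono) auto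
      then show ?thesis by (simp add: power2_eq_square algebra_simps)
    qed
    ultimately show ?thesis using H by linarith
  qed
  also have "\<dots> = (E0 + (\<epsilon> + (\<bar>Q 0\<bar> + \<bar>C\<bar> + real k) / real N)) * (real N)\<^sup>2"
    using N by (simp add: e0_def power2_eq_square field_simps)
  finally have *: "(\<Sum>i<N. \<Sum>j<N. wtrunc k (x i) (x j)) \<le> \<dots>" .
  have "(LINT p|(emp N x \<Otimes>\<^sub>M emp N x). wtrunc k (fst p) (snd p)) = (\<Sum>i<N. \<Sum>j<N. wtrunc k (x i) (x j)) / (real N)\<^sup>2"
    using N by (subst integral_emp_pair[where D="real k"]) (auto simp: abs_of_nonneg wtrunc_nonneg wtrunc_le)
  also have "\<dots> \<le> E0 + (\<epsilon> + (\<bar>Q 0\<bar> + \<bar>C\<bar> + real k) / real N)"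
    using * N by (subst pos_divide_le_eq) auto
  finally show ?thesis .
qed

text \<open>The second moments give a weak limit, the truncated energies show that its energy is at
  most \<open>E0\<close>, and uniqueness of the minimizer identifies it.\<close>

lemma good_sequence_converges:
  assumes N: "\<And>n. n < N n" and g: "\<And>n. good (1 / real (Suc n)) (N n) (x n)"
  shows "\<exists>r. strict_mono r \<and> weak_conv_m (\<lambda>n. emp (N (r n)) (x (r n))) \<mu>"
proof -
  have N0: "0 < N n" for n using N[of n] by simp
  have "tight (\<lambda>n. emp (N n) (x n))"
    by (intro tight_second_moment[OF real_distribution_emp _ A2_nonneg] good_second_moment_emp[OF g N0]) auto
  from tight_imp_convergent_subsubsequence[OF this strict_mono_id]
  obtain r M where r: "strict_mono r" and M: "real_distribution M"
    and wc: "weak_conv_m (\<lambda>n. emp (N (r n)) (x (r n))) M"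
    by (auto simp: comp_def)
  have "En M \<le> ennreal E0"
  proof (rule En_lower_semicontinuous[OF real_distribution_emp M wc])
    fix k
    let ?e = "\<lambda>n. 1 / real (Suc (r n)) + (\<bar>Q 0\<bar> + \<bar>C\<bar> + real k) / real (N (r n))"
    have rn: "filterlim r at_top sequentially" by (rule filterlim_subseq[OF r])
    have Nr: "filterlim (\<lambda>n. N (r n)) at_top sequentially"
      using rn by (rule filterlim_at_top_mono) (auto intro!: always_eventually less_imp_le N)
    have 1: "(\<lambda>n. 1 / real (Suc (r n))) \<longlonglongrightarrow> 0"
      using filterlim_compose[OF LIMSEQ_Suc[OF lim_1_over_n] rn] .
    have 2: "(\<lambda>n. (\<bar>Q 0\<bar> + \<bar>C\<bar> + real k) / real (N (r n))) \<longlonglongrightarrow> 0"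
      by (intro tendsto_divide_0[OF tendsto_const] filterlim_at_top_imp_at_infinity filterlim_compose[OF filterlim_real_sequentially Nr])
    have "?e \<longlonglongrightarrow> 0 + 0" using 1 2 by (rule tendsto_add)
    then show "\<exists>e. e \<longlonglongrightarrow> 0 \<and> (\<forall>\<^sub>F n in sequentially.
       (LINT p|(emp (N (r n)) (x (r n)) \<Otimes>\<^sub>M emp (N (r n)) (x (r n))). wtrunc k (fst p) (snd p)) \<le> E0 + e n)"
      by (intro exI[of _ ?e] conjI always_eventually allI good_truncated_energy[OF g N0]) simp
  qed
  then have "M = \<mu>" using En_\<mu> by (intro En_minimizer_unique M) simp
  with r wc show ?thesis by blast
qed

text \<open>Compactness turns a statement about sequences into thresholds valid for all good
  configurations. P need only hold once along each sequence, because a failure of the conclusion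
  produces a sequence on which P never holds.\<close>

lemma good_eventually:
  assumes P: "\<And>N x. (\<And>n. 0 < N n) \<Longrightarrow> filterlim N at_top sequentially \<Longrightarrow> weak_conv_m (\<lambda>n. emp (N n) (x n)) \<mu> \<Longrightarrow>
      (\<And>n. (\<integral>\<^sup>+t. ennreal (t\<^sup>2) \<partial>emp (N n) (x n)) \<le> ennreal A2) \<Longrightarrow> \<exists>n. P (N n) (x n)"
  obtains \<epsilon> N0 where "0 < \<epsilon>" "\<epsilon> \<le> 1" "0 < N0" "\<And>N x. N0 \<le> N \<Longrightarrow> good \<epsilon> N x \<Longrightarrow> P N x"
proof -
  have "\<exists>n. \<forall>N x. n < N \<longrightarrow> good (1 / real (Suc n)) N x \<longrightarrow> P N x"
  proof (rule ccontr)
    assume "\<not> ?thesis"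
    then obtain N x where N: "\<And>n. n < N n" and g: "\<And>n. good (1 / real (Suc n)) (N n) (x n)" and nP: "\<And>n. \<not> P (N n) (x n)"
      by metis
    obtain r where r: "strict_mono r" "weak_conv_m (\<lambda>n. emp (N (r n)) (x (r n))) \<mu>"
      using good_sequence_converges[OF N g] by blast
    have Nr: "filterlim (\<lambda>n. N (r n)) at_top sequentially"
      using filterlim_subseq[OF r(1)] by (rule filterlim_at_top_mono) (auto intro!: always_eventually less_imp_le N)
    have "\<exists>n. P (N (r n)) (x (r n))"
    proof (rule P[OF _ Nr r(2)])
      fix n
      show "0 < N (r n)" using N[of "r n"] by simp
      then show "(\<integral>\<^sup>+t. ennreal (t\<^sup>2) \<partial>emp (N (r n)) (x (r n))) \<le> ennreal A2"
        by (intro good_second_moment_emp[OF g]) auto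
    qed
    with nP show False by blast
  qed
  then obtain n where "\<And>N x. n < N \<Longrightarrow> good (1 / real (Suc n)) N x \<Longrightarrow> P N x" by blast
  then show ?thesis by (intro that[of "1 / real (Suc n)" "Suc n"]) auto
qed

text \<open>\<epsilon> and N0 are fixed before \<Lambda> and f, so that f may depend on the
  configuration and on an extra parameter.\<close>

lemma good_lipschitz:
  assumes \<eta>: "0 < \<eta>"
  obtains \<epsilon> N0 where "0 < \<epsilon>" "\<epsilon> \<le> 1" "0 < N0" "\<And>N x \<Lambda> f. N0 \<le> N \<Longrightarrow> good \<epsilon> N x \<Longrightarrow> 0 \<le> \<Lambda> \<Longrightarrow>
    (\<And>s t. \<bar>f s - f t\<bar> \<le> \<Lambda> * \<bar>s - t\<bar>) \<Longrightarrow>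
    \<bar>(\<Sum>i<N. f (x i)) / real N - (LINT t|\<mu>. f t)\<bar> \<le> \<Lambda> * \<eta>"
proof -
  let ?P = "\<lambda>N x. \<forall>\<Lambda>\<ge>0. \<forall>f. (\<forall>s t. \<bar>f s - f t\<bar> \<le> \<Lambda> * \<bar>s - t\<bar>) \<longrightarrow>
    \<bar>(LINT t|emp N x. f t) - (LINT t|\<mu>. f t)\<bar> \<le> \<Lambda> * \<eta>"
  have "\<exists>n. ?P (N n) (x n)" if wc: "weak_conv_m (\<lambda>n. emp (N n) (x n)) \<mu>"
    and sq: "\<And>n. (\<integral>\<^sup>+t. ennreal (t\<^sup>2) \<partial>emp (N n) (x n)) \<le> ennreal A2" for N x
    by (rule eventually_happens'[OF _ weak_conv_lipschitz_uniform[OF real_distribution_emp real_distribution_\<mu> wc sq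
      second_moment_\<mu> A2_nonneg \<eta>]]) simp
  note P' = this
  obtain \<epsilon> N0 where e: "0 < \<epsilon>" "\<epsilon> \<le> 1" "0 < N0" and P: "\<And>N x. N0 \<le> N \<Longrightarrow> good \<epsilon> N x \<Longrightarrow> ?P N x"
  proof (rule good_eventually[of ?P])
    fix N :: "nat \<Rightarrow> nat" and x
    assume "weak_conv_m (\<lambda>n. emp (N n) (x n)) \<mu>"
      and "\<And>n. (\<integral>\<^sup>+t. ennreal (t\<^sup>2) \<partial>emp (N n) (x n)) \<le> ennreal A2"
    then show "\<exists>n. ?P (N n) (x n)" by (rule P')
  next
    fix \<epsilon> N0
    assume "0 < \<epsilon>" "\<epsilon> \<le> 1" "0 < N0" "\<And>N x. N0 \<le> N \<Longrightarrow> good \<epsilon> N x \<Longrightarrow> ?P N x"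
    then show thesis by (rule that)
  qed
  show ?thesis
  proof (rule that[OF e])
    fix N x \<Lambda> and f :: "real \<Rightarrow> real"
    assume N: "N0 \<le> N" and g: "good \<epsilon> N x" and \<Lambda>: "0 \<le> \<Lambda>" and f: "\<And>s t. \<bar>f s - f t\<bar> \<le> \<Lambda> * \<bar>s - t\<bar>"
    have "\<Lambda>-lipschitz_on UNIV f" using f \<Lambda> by (intro lipschitz_onI) (auto simp: dist_real_def)
    then have "f \<in> borel_measurable borel"
      by (intro borel_measurable_continuous_onI lipschitz_on_continuous_on)
    then have "(LINT t|emp N x. f t) = (\<Sum>i<N. f (x i)) / real N" using N e by (intro integral_emp) auto
    then show "\<bar>(\<Sum>i<N. f (x i)) / real N - (LINT t|\<mu>. f t)\<bar> \<le> \<Lambda> * \<eta>"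
      using P[OF N g, rule_format, OF \<Lambda> f] by (simp only:)
  qed
qed

end

section \<open>Correlation measures\<close>

lemma tendsto_coordinatewise:
  fixes f :: "nat \<Rightarrow> 'a \<Rightarrow> real"
  assumes "\<And>i. (\<lambda>n. f n i) \<longlonglongrightarrow> l i"
  shows "f \<longlonglongrightarrow> l"
proof -
  have "limitin (product_topology (\<lambda>_. euclidean) UNIV) f l sequentially"
    unfolding limitin_componentwise using assms by auto
  then show ?thesis by (simp add: euclidean_product_topology limitin_canonical_iff)
qed

text \<open>Sampling with replacement: an integral against a power of the empirical measure is an
  average over all index maps \<tau>, including non-injective ones. The induction samples one more
  coordinate at a time.\<close>

lemma integral_PiM_emp:
  fixes g :: "(nat \<Rightarrow> real) \<Rightarrow> real"
  assumes N: "0 < N" and I: "finite I" and g: "g \<in> borel_measurable (PiM I (\<lambda>_. borel))" and bd: "\<And>y. \<bar>g y\<bar> \<le> D"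
  shows "(LINT y|PiM I (\<lambda>_. emp N x). g y) = (\<Sum>\<tau>\<in>I \<rightarrow>\<^sub>E {..<N}. g (compose I x \<tau>)) / real N ^ card I"
  using I g bd
proof (induction I arbitrary: g)
  case empty
  have "compose {} x \<tau> = (\<lambda>_. undefined)" for \<tau> :: "nat \<Rightarrow> nat" by (auto simp: compose_def)
  then show ?case by (simp add: PiM_empty lebesgue_integral_count_space_finite)
next
  case (insert i I)
  interpret E: real_distribution "emp N x" by (rule real_distribution_emp)
  interpret P: product_sigma_finite "\<lambda>_::nat. emp N x"
    by (simp add: product_sigma_finite_def E.sigma_finite_measure)
  have prob: "prob_space (PiM J (\<lambda>_. emp N x))" for J :: "nat set"
    by (intro prob_space_PiM E.prob_space_axioms)
  have s: "sets (PiM J (\<lambda>_. emp N x)) = sets (PiM J (\<lambda>_. borel))" for J :: "nat set"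
    by (intro sets_PiM_cong) auto
  have gm[measurable]: "g \<in> borel_measurable (PiM (insert i I) (\<lambda>_. emp N x))"
    using insert.prems by (simp add: measurable_cong_sets[OF s refl])
  have int: "integrable (PiM (insert i I) (\<lambda>_. emp N x)) g"
    by (intro finite_measure.integrable_const_bound[where B=D] prob_space.finite_measure prob) (auto simp: insert.prems)
  have upd: "(\<lambda>t. g (y(i := t))) \<in> borel_measurable borel" if "y \<in> space (PiM I (\<lambda>_. emp N x))" for y
  proof -
    have "(\<lambda>t. y(i := t)) \<in> measurable borel (PiM (insert i I) (\<lambda>_. borel))"
      using that by (intro measurable_fun_upd[where J=I]) (auto simp: space_PiM)
    then show ?thesis using insert.prems(1) by (rule measurable_compose)
  qed
  have upd': "(\<lambda>y. g (y(i := t))) \<in> borel_measurable (PiM I (\<lambda>_. borel))" for t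
  proof -
    have "(\<lambda>y. y(i := t)) \<in> measurable (PiM I (\<lambda>_. borel)) (PiM (insert i I) (\<lambda>_. borel))"
      by (intro measurable_fun_upd[where J=I]) auto
    then show ?thesis using insert.prems(1) by (rule measurable_compose)
  qed
  have "0 \<le> D" using insert.prems(2)[of undefined] by simp
  have "(LINT y|PiM (insert i I) (\<lambda>_. emp N x). g y) = (LINT y|PiM I (\<lambda>_. emp N x). LINT t|emp N x. g (y(i := t)))"
    using insert.hyps int by (rule P.product_integral_insert)
  also have "\<dots> = (LINT y|PiM I (\<lambda>_. emp N x). (\<Sum>j<N. g (y(i := x j))) / real N)"
    using N upd by (intro Bochner_Integration.integral_cong refl integral_emp) auto
  also have "\<dots> = (\<Sum>\<tau>\<in>I \<rightarrow>\<^sub>E {..<N}. (\<Sum>j<N. g ((compose I x \<tau>)(i := x j))) / real N) / real N ^ card I"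
  proof (rule insert.IH)
    show "(\<lambda>y. (\<Sum>j<N. g (y(i := x j))) / real N) \<in> borel_measurable (PiM I (\<lambda>_. borel))"
      using upd' by measurable
    fix y
    have "\<bar>\<Sum>j<N. g (y(i := x j))\<bar> \<le> (\<Sum>j<N. D)"
      by (intro order_trans[OF sum_abs] sum_mono insert.prems)
    then show "\<bar>(\<Sum>j<N. g (y(i := x j))) / real N\<bar> \<le> D" using N by (simp add: field_simps)
  qed
  also have "\<dots> = (\<Sum>\<tau>\<in>I \<rightarrow>\<^sub>E {..<N}. \<Sum>j<N. g ((compose I x \<tau>)(i := x j))) / real N ^ card (insert i I)"
    using insert.hyps N by (simp add: sum_divide_distrib[symmetric])
  also have "(\<Sum>\<tau>\<in>I \<rightarrow>\<^sub>E {..<N}. \<Sum>j<N. g ((compose I x \<tau>)(i := x j)))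
     = (\<Sum>\<tau>\<in>insert i I \<rightarrow>\<^sub>E {..<N}. g (compose (insert i I) x \<tau>))"
  proof -
    have eq: "compose (insert i I) x (\<tau>(i := j)) = (compose I x \<tau>)(i := x j)" for \<tau> j
      using insert.hyps by (auto simp: compose_def fun_eq_iff)
    have "(\<Sum>\<tau>\<in>insert i I \<rightarrow>\<^sub>E {..<N}. g (compose (insert i I) x \<tau>))
       = (\<Sum>p\<in>{..<N} \<times> (I \<rightarrow>\<^sub>E {..<N}). g (compose (insert i I) x (case p of (j, \<tau>) \<Rightarrow> \<tau>(i := j))))"
      unfolding PiE_insert_eq by (subst sum.reindex) (use insert.hyps inj_combinator[of i I "\<lambda>_. {..<N}"] in auto)
    also have "\<dots> = (\<Sum>j<N. \<Sum>\<tau>\<in>I \<rightarrow>\<^sub>E {..<N}. g ((compose I x \<tau>)(i := x j)))"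
      unfolding sum.cartesian_product by (intro sum.cong refl) (auto simp: eq)
    also have "\<dots> = (\<Sum>\<tau>\<in>I \<rightarrow>\<^sub>E {..<N}. \<Sum>j<N. g ((compose I x \<tau>)(i := x j)))"
      by (rule sum.swap)
    finally show ?thesis ..
  qed
  finally show ?case .
qed

lemma restrict_continuous: "continuous_on UNIV (\<lambda>x::nat \<Rightarrow> real. restrict x {..<k})"
proof (intro continuous_on_coordinatewise_then_product)
  fix i
  show "continuous_on UNIV (\<lambda>x::nat \<Rightarrow> real. restrict x {..<k} i)"
    by (cases "i < k") (auto simp: restrict_def intro: continuous_on_product_coordinates)
qed

lemma restrict_measurable_borel:
  "(\<lambda>x::nat \<Rightarrow> real. restrict x {..<k}) \<in> measurable (PiM {..<k} (\<lambda>_. borel)) borel"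
proof -
  have "(\<lambda>x::nat \<Rightarrow> real. restrict x {..<k}) \<in> measurable (PiM {..<k} (\<lambda>_. borel)) (PiM UNIV (\<lambda>_. borel))"
  proof (rule measurable_PiM_single')
    fix i :: nat
    show "(\<lambda>x. restrict x {..<k} i) \<in> borel_measurable (PiM {..<k} (\<lambda>_. borel :: real measure))"
      by (cases "i < k") (auto simp: restrict_def)
  qed auto
  then show ?thesis by (simp add: measurable_cong_sets[OF refl sets_PiM_equal_borel])
qed

text \<open>The Skorohod coupling again, now with coordinatewise convergence on a finite power of
  \<Omega>. Restricting before G is applied fixes the coordinates outside
  \<open>{..<k}\<close>.\<close>

lemma weak_conv_PiM_integral:
  fixes G :: "(nat \<Rightarrow> real) \<Rightarrow> real"
  assumes rd: "\<And>n. real_distribution (\<nu> n)" and rd': "real_distribution \<nu>'"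
    and wc: "weak_conv_m \<nu> \<nu>'"
    and G: "continuous_on UNIV G" and bd: "\<And>p. \<bar>G p\<bar> \<le> D"
  shows "(\<lambda>n. LINT x|PiM {..<k} (\<lambda>_. \<nu> n). G (restrict x {..<k})) \<longlonglongrightarrow> (LINT x|PiM {..<k} (\<lambda>_. \<nu>'). G (restrict x {..<k}))"
proof -
  from Skorohod[OF rd rd' wc] obtain \<Omega> :: "real measure" and Yn Y where
    O: "prob_space \<Omega>" and Yn[measurable]: "\<And>n. Yn n \<in> borel_measurable \<Omega>"
    and dn: "\<And>n. distr \<Omega> borel (Yn n) = \<nu> n"
    and Y[measurable]: "Y \<in> borel_measurable \<Omega>" and d: "distr \<Omega> borel Y = \<nu>'"
    and lim: "\<And>x. x \<in> space \<Omega> \<Longrightarrow> (\<lambda>n. Yn n x) \<longlonglongrightarrow> Y x"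
    by force
  let ?r = "\<lambda>x::nat \<Rightarrow> real. restrict x {..<k}"
  let ?P = "PiM {..<k} (\<lambda>_. \<Omega>)" and ?B = "PiM {..<k} (\<lambda>_. borel :: real measure)"
  interpret P: prob_space ?P by (intro prob_space_PiM O)
  have GB: "(\<lambda>x. G (?r x)) \<in> borel_measurable ?B"
    by (rule measurable_compose[OF restrict_measurable_borel borel_measurable_continuous_onI[OF G]])
  have cm: "compose {..<k} X \<in> measurable ?P ?B" if [measurable]: "X \<in> borel_measurable \<Omega>" for X
    unfolding compose_def[abs_def] by measurable
  have eq: "(LINT x|PiM {..<k} (\<lambda>_. distr \<Omega> borel X). G (?r x)) = (LINT \<omega>|?P. G (?r (compose {..<k} X \<omega>)))"
    if X: "X \<in> borel_measurable \<Omega>" for X :: "real \<Rightarrow> real"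
  proof -
    let ?D = "distr \<Omega> borel X"
    have "prob_space ?D" using X by (intro prob_space.prob_space_distr O)
    then have "distr ?P (PiM {..<k} (\<lambda>_. ?D)) (compose {..<k} X) = PiM {..<k} (\<lambda>_. distr \<Omega> ?D X)"
      using X by (intro distr_PiM_finite_prob_space' O) auto
    also have "distr \<Omega> ?D X = ?D" by (intro distr_cong) auto
    finally have D: "PiM {..<k} (\<lambda>_. ?D) = distr ?P (PiM {..<k} (\<lambda>_. ?D)) (compose {..<k} X)" ..
    have s: "sets (PiM {..<k} (\<lambda>_. ?D)) = sets ?B" by (intro sets_PiM_cong) auto
    show ?thesis
      by (subst D, subst integral_distr) (use cm[OF X] GB in \<open>auto simp: measurable_cong_sets[OF refl s] measurable_cong_sets[OF s refl]\<close>)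
  qed
  have "(\<lambda>n. LINT \<omega>|?P. G (?r (compose {..<k} (Yn n) \<omega>))) \<longlonglongrightarrow> (LINT \<omega>|?P. G (?r (compose {..<k} Y \<omega>)))"
  proof (rule integral_dominated_convergence[where w="\<lambda>_. D"])
    show "AE \<omega> in ?P. (\<lambda>n. G (?r (compose {..<k} (Yn n) \<omega>))) \<longlonglongrightarrow> G (?r (compose {..<k} Y \<omega>))"
    proof (intro AE_I2)
      fix \<omega> assume "\<omega> \<in> space ?P"
      then have "(\<lambda>n. ?r (compose {..<k} (Yn n) \<omega>)) \<longlonglongrightarrow> ?r (compose {..<k} Y \<omega>)"
        by (intro tendsto_coordinatewise) (auto simp: compose_def restrict_def space_PiM intro!: lim)
      moreover have "isCont G (?r (compose {..<k} Y \<omega>))" using G by (simp add: continuous_on_eq_continuous_at)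
      ultimately show "(\<lambda>n. G (?r (compose {..<k} (Yn n) \<omega>))) \<longlonglongrightarrow> G (?r (compose {..<k} Y \<omega>))"
        by (rule isCont_tendsto_compose[rotated])
    qed
  qed (use measurable_compose[OF cm GB] Y Yn in \<open>auto simp: bd\<close>)
  then show ?thesis by (simp only: eq[symmetric] Y Yn dn d)
qed

text \<open>If two indices share a value, the map is determined by its restriction to all indices
  but one. Summing over the pairs shows that non-injective maps are a fraction of order 1/N.\<close>

lemma card_non_injective:
  "card {\<tau> \<in> {..<k} \<rightarrow>\<^sub>E {..<N}. \<not> inj_on \<tau> {..<k}} \<le> k\<^sup>2 * N ^ (k - 1)"
proof -
  let ?T = "{..<k} \<rightarrow>\<^sub>E {..<N}"
  let ?A = "\<lambda>(a, b). {\<tau> \<in> ?T. a \<noteq> b \<and> \<tau> a = \<tau> b}"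
  have fin: "finite ?T" by (intro finite_PiE) auto
  have le: "card (?A p) \<le> N ^ (k - 1)" if pk: "p \<in> {..<k} \<times> {..<k}" for p
  proof -
    obtain a b where p: "p = (a, b)" "a < k" "b < k" using pk by (cases p) auto
    show ?thesis
    proof (cases "a = b")
      case False
      let ?J = "{..<k} - {b}"
      have "card (?A p) \<le> card (?J \<rightarrow>\<^sub>E {..<N})"
      proof (rule card_inj_on_le[of "\<lambda>\<tau>. restrict \<tau> ?J"])
        show "inj_on (\<lambda>\<tau>. restrict \<tau> ?J) (?A p)"
        proof (rule inj_onI)
          fix \<tau> \<sigma> assume t: "\<tau> \<in> ?A p" "\<sigma> \<in> ?A p" and e: "restrict \<tau> ?J = restrict \<sigma> ?J"
          have *: "\<tau> i = \<sigma> i" if "i \<in> ?J" for i using fun_cong[OF e, of i] that by simp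
          have "\<tau> b = \<sigma> b" using *[of a] t p False by auto
          then have "\<tau> i = \<sigma> i" if "i \<in> {..<k}" for i using *[of i] that by (cases "i = b") auto
          moreover have "\<tau> \<in> ?T" "\<sigma> \<in> ?T" using t p by auto
          ultimately show "\<tau> = \<sigma>" by (intro PiE_ext[of \<tau> "{..<k}" "\<lambda>_. {..<N}" \<sigma>])
        qed
        show "(\<lambda>\<tau>. restrict \<tau> ?J) ` ?A p \<subseteq> ?J \<rightarrow>\<^sub>E {..<N}"
          by (rule image_subsetI) (simp add: p PiE_iff)
        show "finite (?J \<rightarrow>\<^sub>E {..<N})" by (intro finite_PiE) auto
      qed
      also have "\<dots> = N ^ (k - 1)" using p by (simp add: card_funcsetE)
      finally show ?thesis .
    qed (simp add: p)
  qed
  have "{\<tau> \<in> ?T. \<not> inj_on \<tau> {..<k}} \<subseteq> (\<Union>p\<in>{..<k} \<times> {..<k}. ?A p)"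
    by (auto simp: inj_on_def)
  then have "card {\<tau> \<in> ?T. \<not> inj_on \<tau> {..<k}} \<le> card (\<Union>p\<in>{..<k} \<times> {..<k}. ?A p)"
    using fin by (intro card_mono) auto
  also have "\<dots> \<le> (\<Sum>p\<in>{..<k} \<times> {..<k}. card (?A p))" by (intro card_UN_le) auto
  also have "\<dots> \<le> (\<Sum>p\<in>{..<k} \<times> {..<k}. N ^ (k - 1))" by (intro sum_mono le)
  also have "\<dots> = k\<^sup>2 * N ^ (k - 1)" by (simp add: power2_eq_square)
  finally show ?thesis .
qed

text \<open>Lets an injective choice of k particles be carried to the first k by a permutation of
  all particles; the complements are matched arbitrarily because they have the same size.\<close>

lemma extend_injection_to_bijection:
  assumes "finite B" "A \<subseteq> B" "inj_on \<tau> A" "\<tau> ` A \<subseteq> B"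
  obtains \<pi> where "bij_betw \<pi> B B" "\<And>i. i \<in> A \<Longrightarrow> \<pi> i = \<tau> i"
proof -
  have fA: "finite A" using assms finite_subset by blast
  have "card (B - A) = card (B - \<tau> ` A)"
    using assms fA by (simp add: card_Diff_subset card_image)
  then obtain g where g: "bij_betw g (B - A) (B - \<tau> ` A)"
    using assms finite_same_card_bij[of "B - A" "B - \<tau> ` A"] by auto
  let ?p = "\<lambda>i. if i \<in> A then \<tau> i else g i"
  have "bij_betw ?p A (\<tau> ` A)" using assms by (auto simp: bij_betw_def inj_on_def)
  moreover have "bij_betw ?p (B - A) (B - \<tau> ` A)"
    using g by (subst bij_betw_cong[of _ _ g]) auto
  ultimately have "bij_betw ?p (A \<union> (B - A)) (\<tau> ` A \<union> (B - \<tau> ` A))"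
    by (rule bij_betw_combine) auto
  moreover have "A \<union> (B - A) = B" "\<tau> ` A \<union> (B - \<tau> ` A) = B" using assms by auto
  ultimately show ?thesis by (intro that[of ?p]) auto
qed

lemma distr_PiM_lborel_permute:
  fixes \<pi> :: "nat \<Rightarrow> nat"
  assumes p: "bij_betw \<pi> {..<N} {..<N}"
  shows "distr (\<Pi>\<^sub>M i\<in>{..<N}. lborel) (\<Pi>\<^sub>M i\<in>{..<N}. lborel) (\<lambda>x. \<lambda>i\<in>{..<N}. x (\<pi> i))
    = (\<Pi>\<^sub>M i\<in>{..<N}. lborel :: real measure)"
proof (rule lborel_product.PiM_eqI)
  let ?L = "\<Pi>\<^sub>M i\<in>{..<N}. lborel :: real measure"
  let ?T = "\<lambda>x::nat \<Rightarrow> real. \<lambda>i\<in>{..<N}. x (\<pi> i)"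
  have pN: "\<pi> i < N" if "i < N" for i using p that by (auto simp: bij_betw_def)
  have T[measurable]: "?T \<in> measurable ?L ?L"
    using pN by (intro measurable_restrict measurable_component_singleton) auto
  fix A :: "nat \<Rightarrow> real set" assume A: "\<And>i. i \<in> {..<N} \<Longrightarrow> A i \<in> sets lborel"
  define q where "q = the_inv_into {..<N} \<pi>"
  have q: "bij_betw q {..<N} {..<N}" unfolding q_def by (rule bij_betw_the_inv_into[OF p])
  have qp: "q (\<pi> i) = i" if "i < N" for i
    unfolding q_def using p that by (simp add: bij_betw_def the_inv_into_f_f)
  have pq: "\<pi> (q i) = i" and qN: "q i < N" if "i < N" for i
    using p q that by (auto simp: q_def bij_betw_def f_the_inv_into_f)
  have pre: "?T -` (Pi\<^sub>E {..<N} A) \<inter> space ?L = Pi\<^sub>E {..<N} (\<lambda>i. A (q i))"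
  proof (intro set_eqI iffI)
    fix x assume "x \<in> ?T -` (Pi\<^sub>E {..<N} A) \<inter> space ?L"
    then have x: "x \<in> {..<N} \<rightarrow>\<^sub>E UNIV" "\<And>i. i < N \<Longrightarrow> x (\<pi> i) \<in> A i" by (auto simp: space_PiM PiE_iff)
    then have "x i \<in> A (q i)" if "i < N" for i using x(2)[of "q i"] that by (simp add: pq qN)
    then show "x \<in> Pi\<^sub>E {..<N} (\<lambda>i. A (q i))" using x(1) by (auto simp: PiE_iff)
  next
    fix x assume x: "x \<in> Pi\<^sub>E {..<N} (\<lambda>i. A (q i))"
    have "x (\<pi> i) \<in> A i" if "i < N" for i
      using PiE_mem[OF x, of "\<pi> i"] pN[OF that] qp[OF that] by simp
    then show "x \<in> ?T -` (Pi\<^sub>E {..<N} A) \<inter> space ?L" using x by (auto simp: space_PiM PiE_iff)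
  qed
  have "emeasure (distr ?L ?L ?T) (Pi\<^sub>E {..<N} A) = emeasure ?L (Pi\<^sub>E {..<N} (\<lambda>i. A (q i)))"
    using A by (subst emeasure_distr) (auto simp: pre intro!: sets_PiM_I_finite)
  also have "\<dots> = (\<Prod>i<N. emeasure lborel (A (q i)))"
    using A qN by (intro lborel_product.emeasure_PiM) auto
  also have "\<dots> = (\<Prod>i<N. emeasure lborel (A i))"
    by (rule prod.reindex_bij_betw[OF q])
  finally show "emeasure (distr ?L ?L ?T) (Pi\<^sub>E {..<N} A) = (\<Prod>i<N. emeasure lborel (A i))" .
qed auto

section \<open>Exchangeability and convergence of the correlation measures\<close>

context convex_ensemble begin

text \<open>Written as a full double sum minus its diagonal, the hamiltonian is visibly symmetric.
  The meaningless diagonal values of w, with \<open>ln 0 = 0\<close>, cancel.\<close>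

lemma weight_permute:
  assumes p: "bij_betw \<pi> {..<N} {..<N}"
  shows "wt N (\<lambda>i\<in>{..<N}. x (\<pi> i)) = wt N x"
proof -
  let ?y = "\<lambda>i\<in>{..<N}. x (\<pi> i)"
  have inj: "inj_on ?y {..<N} \<longleftrightarrow> inj_on x {..<N}"
  proof -
    have "inj_on ?y {..<N} \<longleftrightarrow> inj_on (x \<circ> \<pi>) {..<N}" by (intro inj_on_cong) auto
    also have "\<dots> \<longleftrightarrow> inj_on x {..<N}" using comp_inj_on_iff[of \<pi> "{..<N}" x] p by (simp add: bij_betw_def)
    finally show ?thesis .
  qed
  show ?thesis
  proof (cases "inj_on x {..<N}")
    case True
    have H: "hamiltonian N x = (\<Sum>i<N. \<Sum>j<N. w (x i) (x j)) - (\<Sum>i<N. w (x i) (x i)) + (\<Sum>j<N. Q (x j)) - real N * (real N - 1) * C" for x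
    proof -
      have "(\<Sum>j<N. \<Sum>i<j. w (x i) (x j) + w (x j) (x i)) = 2 * (\<Sum>j<N. \<Sum>i<j. w (x i) (x j))"
        unfolding sum_distrib_left by (intro sum.cong refl) (simp add: w_commute)
      then show ?thesis unfolding hamiltonian_def by (simp add: double_sum_pairs)
    qed
    have r: "(\<Sum>i<N. f (?y i)) = (\<Sum>i<N. f (x i))" for f :: "real \<Rightarrow> real"
      using sum.reindex_bij_betw[OF p, of "\<lambda>i. f (x i)"] by simp
    have "(\<Sum>i<N. \<Sum>j<N. w (?y i) (?y j)) = (\<Sum>i<N. \<Sum>j<N. w (x i) (x j))"
      unfolding r[of "w _"] using r[of "\<lambda>s. \<Sum>j<N. w s (x j)"] by simp
    then have "hamiltonian N ?y = hamiltonian N x"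
      unfolding H using r[of "\<lambda>s. w s s"] r[of Q] by simp
    then show ?thesis using True inj by (simp add: weight_eq_exp_hamiltonian)
  next
    case False
    then show ?thesis using inj by (simp add: ensemble_weight_eq_0)
  qed
qed

lemma distr_ensemble_permute:
  assumes p: "bij_betw \<pi> {..<N} {..<N}"
  shows "distr (ensemble h Q N) (leb N) (\<lambda>x. \<lambda>i\<in>{..<N}. x (\<pi> i)) = ensemble h Q N"
proof (rule measure_eqI)
  let ?T = "\<lambda>x::nat \<Rightarrow> real. \<lambda>i\<in>{..<N}. x (\<pi> i)"
  have pN: "\<pi> i < N" if "i < N" for i using p that by (auto simp: bij_betw_def)
  have T[measurable]: "?T \<in> measurable (leb N) (leb N)"
    using pN by (intro measurable_restrict measurable_component_singleton) auto
  fix A assume "A \<in> sets (distr (ensemble h Q N) (leb N) ?T)"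
  then have A[measurable]: "A \<in> sets (leb N)" by simp
  have sp: "space (ensemble h Q N) = space (leb N)" by (simp add: ensemble_def)
  have "emeasure (distr (ensemble h Q N) (leb N) ?T) A = emeasure (ensemble h Q N) (?T -` A \<inter> space (leb N))"
    by (subst emeasure_distr) (auto simp: sp measurable_cong_sets[OF sets_ensemble refl])
  also have "\<dots> = (\<integral>\<^sup>+x. ennreal (wt N x) * indicator (?T -` A \<inter> space (leb N)) x \<partial>leb N) / ennreal (Z N)"
    by (intro emeasure_ensemble measurable_sets[OF T A])
  also have "(\<integral>\<^sup>+x. ennreal (wt N x) * indicator (?T -` A \<inter> space (leb N)) x \<partial>leb N)
     = (\<integral>\<^sup>+x. ennreal (wt N (?T x)) * indicator A (?T x) \<partial>leb N)"
    by (intro nn_integral_cong) (auto simp: weight_permute[OF p] indicator_def)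
  also have "\<dots> = (\<integral>\<^sup>+x. ennreal (wt N x) * indicator A x \<partial>distr (leb N) (leb N) ?T)"
    by (subst nn_integral_distr) auto
  also have "\<dots> = (\<integral>\<^sup>+x. ennreal (wt N x) * indicator A x \<partial>leb N)"
    by (simp add: distr_PiM_lborel_permute[OF p])
  finally show "emeasure (distr (ensemble h Q N) (leb N) ?T) A = emeasure (ensemble h Q N) A"
    unfolding emeasure_ensemble[OF A] .
qed simp

text \<open>By exchangeability all injective index maps have the same expectation, so the
  expectation of G differs from that of the average over all maps by O(1/N). This average is an
  integral against a power of the empirical measure: close to its limit on good configurations, and
  bounded on the remaining, exponentially unlikely ones.\<close>

lemma correlation_convergence:
  fixes G :: "(nat \<Rightarrow> real) \<Rightarrow> real"
  assumes G: "continuous_on UNIV G" and bd: "\<And>p. \<bar>G p\<bar> \<le> D"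
  shows "(\<lambda>N. LINT x|ensemble h Q N. G (restrict x {..<k})) \<longlonglongrightarrow> (LINT x|PiM {..<k} (\<lambda>_. \<mu>). G (restrict x {..<k}))"
proof -
  let ?r = "\<lambda>x::nat \<Rightarrow> real. restrict x {..<k}"
  let ?I = "LINT x|PiM {..<k} (\<lambda>_. \<mu>). G (?r x)"
  let ?T = "\<lambda>N. {..<k} \<rightarrow>\<^sub>E {..<N}"
  let ?V = "\<lambda>N x. (\<Sum>\<tau>\<in>?T N. G (compose {..<k} x \<tau>)) / real N ^ k"
  have D0: "0 \<le> D" using bd[of undefined] by simp
  have GB: "(\<lambda>x. G (?r x)) \<in> borel_measurable (PiM {..<k} (\<lambda>_. borel))"
    by (rule measurable_compose[OF restrict_measurable_borel borel_measurable_continuous_onI[OF G]])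
  have rc: "?r (compose {..<k} x \<tau>) = compose {..<k} x \<tau>" for x and \<tau> :: "nat \<Rightarrow> nat"
    by (auto simp: compose_def)
  have V: "?V N x = (LINT y|PiM {..<k} (\<lambda>_. emp N x). G (?r y))" if "0 < N" for N x
    using integral_PiM_emp[OF that finite_lessThan GB bd] by (simp add: rc)
  have I_bd: "\<bar>?I\<bar> \<le> D"
  proof (rule bounded_LINT)
    show "prob_space (PiM {..<k} (\<lambda>_. \<mu>))" by (intro prob_space_PiM \<mu>.prob_space_axioms)
    have "sets (PiM {..<k} (\<lambda>_. \<mu>)) = sets (PiM {..<k} (\<lambda>_. borel))" by (intro sets_PiM_cong) auto
    then show "(\<lambda>x. G (?r x)) \<in> borel_measurable (PiM {..<k} (\<lambda>_. \<mu>))"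
      using GB by (simp cong: measurable_cong_sets)
  qed (rule bd)
  have V_bd: "\<bar>?V N x\<bar> \<le> D" if "0 < N" for N x
  proof -
    have "\<bar>\<Sum>\<tau>\<in>?T N. G (compose {..<k} x \<tau>)\<bar> \<le> (\<Sum>\<tau>\<in>?T N. D)"
      by (intro order_trans[OF sum_abs] sum_mono bd)
    also have "\<dots> = real N ^ k * D" by (simp add: card_funcsetE)
    finally show ?thesis using that by (simp add: field_simps)
  qed
  show ?thesis
  proof (rule LIMSEQ_I)
    fix \<delta> :: real assume \<delta>: "0 < \<delta>"
    obtain \<epsilon> N0 where e: "0 < \<epsilon>" "\<epsilon> \<le> 1" "0 < N0" and Vg: "\<And>N x. N0 \<le> N \<Longrightarrow> good \<epsilon> N x \<Longrightarrow> \<bar>?V N x - ?I\<bar> \<le> \<delta> / 4"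
    proof (rule good_eventually[of "\<lambda>N x. \<bar>?V N x - ?I\<bar> \<le> \<delta> / 4"])
      fix N :: "nat \<Rightarrow> nat" and x
      assume N: "\<And>n. 0 < N n" and wc: "weak_conv_m (\<lambda>n. emp (N n) (x n)) \<mu>"
      have "(\<lambda>n. ?V (N n) (x n)) \<longlonglongrightarrow> ?I"
        unfolding V[OF N] by (rule weak_conv_PiM_integral[OF real_distribution_emp real_distribution_\<mu> wc G bd])
      then have "\<forall>\<^sub>F n in sequentially. dist (?V (N n) (x n)) ?I < \<delta> / 4" using \<delta> by (intro tendstoD) auto
      then have "\<exists>n. dist (?V (N n) (x n)) ?I < \<delta> / 4" by (rule eventually_happens'[rotated]) simp
      then show "\<exists>n. \<bar>?V (N n) (x n) - ?I\<bar> \<le> \<delta> / 4" by (auto simp: dist_real_def intro: less_imp_le)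
    next
      fix \<epsilon> N0
      assume "0 < \<epsilon>" "\<epsilon> \<le> 1" "0 < N0" "\<And>N x. N0 \<le> N \<Longrightarrow> good \<epsilon> N x \<Longrightarrow> \<bar>?V N x - ?I\<bar> \<le> \<delta> / 4"
      then show thesis by (rule that)
    qed
    have "(\<lambda>N. 2 * D * exp (- (\<epsilon> / 4 * real N))) \<longlonglongrightarrow> 2 * D * 0"
    proof (intro tendsto_mult tendsto_const)
      have "filterlim (\<lambda>N. \<epsilon> / 4 * real N) at_top sequentially"
        using e by (intro filterlim_tendsto_pos_mult_at_top[OF tendsto_const] filterlim_real_sequentially) auto
      then have "filterlim (\<lambda>N. - (\<epsilon> / 4 * real N)) at_bot sequentially"
        unfolding filterlim_uminus_at_bot minus_minus .
      then show "(\<lambda>N. exp (- (\<epsilon> / 4 * real N))) \<longlonglongrightarrow> 0" by (rule filterlim_compose[OF exp_at_bot])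
    qed
    then have ev1: "\<forall>\<^sub>F N in sequentially. 2 * D * exp (- (\<epsilon> / 4 * real N)) < \<delta> / 4" using \<delta> by (intro order_tendstoD(2)) auto
    have "(\<lambda>N. 2 * D * real (k\<^sup>2) / real N) \<longlonglongrightarrow> 0"
      by (intro tendsto_divide_0[OF tendsto_const] filterlim_at_top_imp_at_infinity filterlim_real_sequentially)
    then have ev2: "\<forall>\<^sub>F N in sequentially. 2 * D * real (k\<^sup>2) / real N < \<delta> / 4" using \<delta> by (intro order_tendstoD(2)) auto
    have "\<forall>\<^sub>F N in sequentially. norm ((LINT x|ensemble h Q N. G (?r x)) - ?I) < \<delta>"
      using ev1 ev2 prob_not_good[OF e(1)] eventually_ge_at_top[of N0] eventually_ge_at_top[of k] eventually_gt_at_top[of 0]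
    proof eventually_elim
      case (elim N)
      let ?P = "ensemble h Q N"
      interpret P: prob_space ?P by (rule prob_space_ensemble)
      have sp: "space ?P = space (leb N)" by (simp add: ensemble_def)
      have comp: "(\<lambda>x. compose {..<k} x \<tau>) \<in> measurable (leb N) (PiM {..<k} (\<lambda>_. borel))" if "\<tau> \<in> ?T N" for \<tau>
        unfolding compose_def using that measurable_component_singleton[of _ "{..<N}" "\<lambda>_. lborel :: real measure"]
        by (intro measurable_restrict) (auto simp: measurable_lborel1 PiE_iff)
      have GT: "(\<lambda>x. G (compose {..<k} x \<tau>)) \<in> borel_measurable ?P" if "\<tau> \<in> ?T N" for \<tau>
        using measurable_compose[OF comp[OF that] GB] by (simp add: rc measurable_cong_sets[OF sets_ensemble refl])
      have Gi: "integrable ?P (\<lambda>x. G (compose {..<k} x \<tau>))" if "\<tau> \<in> ?T N" for \<tau>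
        using GT[OF that] by (intro P.integrable_const_bound[where B=D]) (auto simp: bd)
      have G0m: "(\<lambda>x. G (?r x)) \<in> borel_measurable (leb N)"
      proof -
        have id: "restrict id {..<k} \<in> ?T N" using elim by (auto simp: PiE_iff)
        have "compose {..<k} x (restrict id {..<k}) = ?r x" for x by (auto simp: compose_def fun_eq_iff)
        then show ?thesis using measurable_compose[OF comp[OF id] GB] by simp
      qed
      let ?E = "LINT x|?P. G (?r x)"
      have inj_eq: "(LINT x|?P. G (compose {..<k} x \<tau>)) = ?E" if t: "\<tau> \<in> ?T N" "inj_on \<tau> {..<k}" for \<tau>
      proof -
        have "\<tau> ` {..<k} \<subseteq> {..<N}" using t by auto
        then obtain \<pi> where p: "bij_betw \<pi> {..<N} {..<N}" and e: "\<And>i. i \<in> {..<k} \<Longrightarrow> \<pi> i = \<tau> i"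
          using extend_injection_to_bijection[of "{..<N}" "{..<k}" \<tau>] t elim by auto
        let ?S = "\<lambda>x::nat \<Rightarrow> real. \<lambda>i\<in>{..<N}. x (\<pi> i)"
        have pN: "\<pi> i < N" if "i < N" for i using p that by (auto simp: bij_betw_def)
        have S: "?S \<in> measurable ?P (leb N)"
          unfolding measurable_cong_sets[OF sets_ensemble refl]
          using pN by (intro measurable_restrict measurable_component_singleton) auto
        have "?E = (LINT x|distr ?P (leb N) ?S. G (?r x))" by (simp add: distr_ensemble_permute[OF p])
        also have "\<dots> = (LINT x|?P. G (?r (?S x)))" by (rule integral_distr[OF S G0m])
        also have "\<dots> = (LINT x|?P. G (compose {..<k} x \<tau>))"
        proof -
          have "?r (?S x) = compose {..<k} x \<tau>" for x
            using e elim by (auto simp: fun_eq_iff compose_def restrict_def)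
          then show ?thesis by (simp only:)
        qed
        finally show ?thesis by (rule sym)
      qed
      have E_bd: "\<bar>?E\<bar> \<le> D"
        using G0m by (intro bounded_LINT P.prob_space_axioms bd) (simp add: measurable_cong_sets[OF sets_ensemble refl])
      have T_bd: "\<bar>LINT x|?P. G (compose {..<k} x \<tau>)\<bar> \<le> D" if "\<tau> \<in> ?T N" for \<tau>
        using GT[OF that] by (intro bounded_LINT P.prob_space_axioms bd)
      have finT: "finite (?T N)" by (intro finite_PiE) auto
      have Vi: "integrable ?P (?V N)" using Gi by auto
      have EV: "(LINT x|?P. ?V N x) = (\<Sum>\<tau>\<in>?T N. LINT x|?P. G (compose {..<k} x \<tau>)) / real N ^ k"
        using Gi by simp
      have "\<bar>real N ^ k * ?E - (\<Sum>\<tau>\<in>?T N. LINT x|?P. G (compose {..<k} x \<tau>))\<bar> \<le> 2 * D * real (k\<^sup>2 * N ^ (k - 1))"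
      proof -
        have "real N ^ k * ?E = (\<Sum>\<tau>\<in>?T N. ?E)" by (simp add: card_funcsetE)
        then have "real N ^ k * ?E - (\<Sum>\<tau>\<in>?T N. LINT x|?P. G (compose {..<k} x \<tau>))
          = (\<Sum>\<tau>\<in>?T N. ?E - (LINT x|?P. G (compose {..<k} x \<tau>)))" by (simp only: sum_subtractf)
        also have "\<dots> = (\<Sum>\<tau>\<in>{\<tau>\<in>?T N. \<not> inj_on \<tau> {..<k}}. ?E - (LINT x|?P. G (compose {..<k} x \<tau>)))"
          using finT inj_eq by (intro sum.mono_neutral_right) auto
        also have "\<bar>\<dots>\<bar> \<le> (\<Sum>\<tau>\<in>{\<tau>\<in>?T N. \<not> inj_on \<tau> {..<k}}. 2 * D)"
        proof (intro order_trans[OF sum_abs] sum_mono)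
          fix \<tau> assume "\<tau> \<in> {\<tau>\<in>?T N. \<not> inj_on \<tau> {..<k}}"
          then show "\<bar>?E - (LINT x|?P. G (compose {..<k} x \<tau>))\<bar> \<le> 2 * D" using T_bd[of \<tau>] E_bd by auto
        qed
        also have "\<dots> = real (card {\<tau>\<in>?T N. \<not> inj_on \<tau> {..<k}}) * (2 * D)" by simp
        also have "\<dots> \<le> real (k\<^sup>2 * N ^ (k - 1)) * (2 * D)"
          using D0 by (intro mult_right_mono of_nat_mono card_non_injective) auto
        finally show ?thesis by (simp add: mult.commute)
      qed
      also have "\<dots> \<le> real N ^ k * (2 * D * real (k\<^sup>2) / real N)"
      proof (cases k)
        case (Suc m)
        then show ?thesis using elim by simp
      qed simp
      finally have *: "\<bar>real N ^ k * ?E - (\<Sum>\<tau>\<in>?T N. LINT x|?P. G (compose {..<k} x \<tau>))\<bar> \<le> real N ^ k * (2 * D * real (k\<^sup>2) / real N)" .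
      have "real N ^ k * \<bar>?E - (LINT x|?P. ?V N x)\<bar> \<le> real N ^ k * (2 * D * real (k\<^sup>2) / real N)"
      proof -
        have scale: "A * \<bar>y - s / A\<bar> = \<bar>A * y - s\<bar>" if "0 < A" for A y s :: real
        proof -
          have "A * \<bar>y - s / A\<bar> = \<bar>A * (y - s / A)\<bar>" using that by (simp add: abs_mult)
          also have "A * (y - s / A) = A * y - s" using that by (simp add: right_diff_distrib)
          finally show ?thesis .
        qed
        have "0 < real N ^ k" using elim by simp
        from scale[OF this] show ?thesis unfolding EV using * by (simp only:)
      qed
      then have 1: "\<bar>?E - (LINT x|?P. ?V N x)\<bar> \<le> 2 * D * real (k\<^sup>2) / real N"
        using elim by (subst (asm) mult_le_cancel_left_pos) auto
      let ?B = "{x \<in> space (leb N). \<not> good \<epsilon> N x}"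
      have B[measurable]: "?B \<in> sets ?P" by simp
      have "(LINT x|?P. ?V N x) - ?I = (LINT x|?P. ?V N x - ?I)"
        by (subst Bochner_Integration.integral_diff[OF Vi P.integrable_const]) (simp add: P.prob_space)
      then have "\<bar>(LINT x|?P. ?V N x) - ?I\<bar> \<le> (LINT x|?P. \<bar>?V N x - ?I\<bar>)"
        by (simp only: integral_abs_bound)
      also have "\<dots> \<le> (LINT x|?P. \<delta> / 4 + 2 * D * indicator ?B x)"
      proof (rule integral_mono)
        fix x assume x: "x \<in> space ?P"
        show "\<bar>?V N x - ?I\<bar> \<le> \<delta> / 4 + 2 * D * indicator ?B x"
        proof (cases "good \<epsilon> N x")
          case True
          then show ?thesis using Vg[of N x] elim D0 by (auto simp: indicator_def)
        next
          case False
          then have "indicator ?B x = (1::real)" using x by (simp add: sp)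
          moreover have "\<bar>?V N x - ?I\<bar> \<le> D + D"
            using V_bd[of N x] I_bd elim by (intro order_trans[OF abs_triangle_ineq4] add_mono) auto
          ultimately show ?thesis using \<delta> by simp
        qed
      qed (use Vi in \<open>auto simp: P.emeasure_eq_measure\<close>)
      also have "\<dots> = \<delta> / 4 + 2 * D * measure ?P ?B"
        by (simp add: P.prob_space P.emeasure_eq_measure)
      also have "\<dots> \<le> \<delta> / 4 + 2 * D * exp (- (\<epsilon> / 4 * real N))"
        using elim D0 by (intro add_left_mono mult_left_mono) auto
      finally show ?case using 1 elim by simp
    qed
    then show "\<exists>no. \<forall>n\<ge>no. norm ((LINT x|ensemble h Q n. G (?r x)) - ?I) < \<delta>"
      by (simp add: eventually_sequentially)
  qed
qed

text \<open>A test function is continuous only on the extensional functions; composed with the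
  restriction it becomes continuous everywhere with the same integrals. The correlation measures are
  marginals from N = k on, which is enough for the limit.\<close>

lemma limiting_measure_\<mu>: "limiting_measure h Q \<mu>"
  unfolding limiting_measure_def
proof (intro conjI allI impI)
  show "real_distribution \<mu>" by (rule real_distribution_\<mu>)
  show "compact (measure_support \<mu>)" by (simp add: support_interval)
  fix k :: nat
  show "converges_weakly (\<lambda>N. correlation_measure h Q N k) (\<Pi>\<^sub>M i\<in>{..<k}. \<mu>)"
    unfolding converges_weakly_def
  proof (intro allI impI)
    let ?r = "\<lambda>x::nat \<Rightarrow> real. restrict x {..<k}"
    fix f :: "(nat \<Rightarrow> real) \<Rightarrow> real"
    assume "continuous_on (space (\<Pi>\<^sub>M i\<in>{..<k}. \<mu>)) f \<and> bounded (f ` space (\<Pi>\<^sub>M i\<in>{..<k}. \<mu>))"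
    then have f: "continuous_on ({..<k} \<rightarrow>\<^sub>E UNIV) f" and fb: "bounded (f ` ({..<k} \<rightarrow>\<^sub>E UNIV))"
      by (simp_all add: space_PiM)
    obtain D where D: "\<And>x. x \<in> {..<k} \<rightarrow>\<^sub>E UNIV \<Longrightarrow> \<bar>f x\<bar> \<le> D"
      using fb unfolding bounded_iff by (metis image_eqI real_norm_def)
    have G: "continuous_on UNIV (\<lambda>x. f (?r x))"
      by (rule continuous_on_compose2[OF f restrict_continuous]) (simp add: image_subset_iff PiE_iff)
    have bd: "\<bar>f (?r x)\<bar> \<le> D" for x by (intro D) (simp add: PiE_iff)
    have lim: "(\<lambda>N. LINT x|ensemble h Q N. f (?r x)) \<longlonglongrightarrow> (LINT x|(\<Pi>\<^sub>M i\<in>{..<k}. \<mu>). f (?r x))"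
      using correlation_convergence[OF G bd, of k] by simp
    have GB: "(\<lambda>x. f (?r x)) \<in> borel_measurable (PiM {..<k} (\<lambda>_. borel))"
      using measurable_compose[OF restrict_measurable_borel borel_measurable_continuous_onI[OF G], of k] by simp
    have fB: "f \<in> borel_measurable (PiM {..<k} (\<lambda>_. borel))"
      using GB by (subst measurable_cong[of _ _ "\<lambda>x. f (?r x)"]) (auto simp: space_PiM PiE_restrict)
    have "(LINT x|(\<Pi>\<^sub>M i\<in>{..<k}. \<mu>). f (?r x)) = (LINT x|(\<Pi>\<^sub>M i\<in>{..<k}. \<mu>). f x)"
      by (intro Bochner_Integration.integral_cong refl) (auto simp: space_PiM PiE_restrict)
    moreover have "\<forall>\<^sub>F N in sequentially. (LINT x|ensemble h Q N. f (?r x)) = (LINT x|correlation_measure h Q N k. f x)"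
      using eventually_ge_at_top[of k]
    proof eventually_elim
      case (elim N)
      have "?r \<in> measurable (ensemble h Q N) (PiM {..<k} (\<lambda>_. borel))"
        unfolding measurable_cong_sets[OF sets_ensemble refl]
        using elim measurable_component_singleton[of _ "{..<N}" "\<lambda>_. lborel :: real measure"]
        by (intro measurable_restrict) (auto simp: measurable_lborel1)
      then show ?case unfolding correlation_measure_def by (subst integral_distr) (use fB in auto)
    qed
    ultimately show "(\<lambda>N. LINT x|correlation_measure h Q N k. f x) \<longlonglongrightarrow> (LINT x|(\<Pi>\<^sub>M i\<in>{..<k}. \<mu>). f x)"
      using lim by (auto intro: Lim_transform_eventually)
  qed
qed

end

section \<open>The largest particle\<close>

lemma ln_max_lipschitz:
  fixes s t \<epsilon> :: real
  assumes "0 < \<epsilon>"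
  shows "\<bar>ln (max \<bar>s\<bar> \<epsilon>) - ln (max \<bar>t\<bar> \<epsilon>)\<bar> \<le> 1 / \<epsilon> * \<bar>s - t\<bar>"
proof -
  have *: "ln x - ln y \<le> 1 / \<epsilon> * \<bar>x - y\<bar>" if "\<epsilon> \<le> x" "\<epsilon> \<le> y" for x y
  proof -
    have "ln x - ln y = ln (x / y)" using that assms by (simp add: ln_div)
    also have "\<dots> \<le> x / y - 1" using that assms by (intro ln_le_minus_one) auto
    also have "\<dots> = (x - y) / y" using that assms by (simp add: field_simps)
    also have "\<dots> \<le> \<bar>x - y\<bar> / y" using that assms by (intro divide_right_mono) auto
    also have "\<dots> \<le> \<bar>x - y\<bar> / \<epsilon>" using that assms by (intro divide_left_mono) auto
    finally show ?thesis by simp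
  qed
  have "\<bar>ln (max \<bar>s\<bar> \<epsilon>) - ln (max \<bar>t\<bar> \<epsilon>)\<bar> \<le> 1 / \<epsilon> * \<bar>max \<bar>s\<bar> \<epsilon> - max \<bar>t\<bar> \<epsilon>\<bar>"
    using *[of "max \<bar>s\<bar> \<epsilon>" "max \<bar>t\<bar> \<epsilon>"] *[of "max \<bar>t\<bar> \<epsilon>" "max \<bar>s\<bar> \<epsilon>"]
    by (simp add: abs_le_iff abs_minus_commute)
  also have "\<dots> \<le> 1 / \<epsilon> * \<bar>s - t\<bar>" using assms by (intro mult_left_mono) auto
  finally show ?thesis .
qed

lemma abs_le_abs: "x \<le> y \<Longrightarrow> 0 \<le> x \<Longrightarrow> \<bar>x\<bar> \<le> \<bar>y\<bar>" for x y :: real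
  by simp

lemma AE_lborel_avoid_finite: "finite F \<Longrightarrow> AE x in lborel. (x::real) \<notin> F"
  by (intro AE_not_in) (simp add: countable_imp_null_set_lborel countable_finite)

lemma (in prob_space) exp_integral_le:
  assumes X: "integrable M (X :: 'a \<Rightarrow> real)"
  shows "ennreal (exp (LINT x|M. X x)) \<le> (\<integral>\<^sup>+x. ennreal (exp (X x)) \<partial>M)"
proof (cases "(\<integral>\<^sup>+x. ennreal (exp (X x)) \<partial>M) = \<infinity>")
  case False
  let ?m = "LINT x|M. X x"
  have i: "integrable M (\<lambda>x. exp (X x))"
    using False X by (intro integrableI_nonneg) (auto simp: less_top)
  have "exp ?m = (LINT x|M. exp ?m * (1 + (X x - ?m)))"
    using X by (simp add: prob_space)
  also have "\<dots> \<le> (LINT x|M. exp (X x))"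
  proof (rule integral_mono)
    fix x
    have "exp ?m * (1 + (X x - ?m)) \<le> exp ?m * exp (X x - ?m)"
      by (intro mult_left_mono exp_ge_add_one_self) auto
    then show "exp ?m * (1 + (X x - ?m)) \<le> exp (X x)" by (simp flip: exp_add)
  qed (use X i in auto)
  finally show ?thesis using i by (subst nn_integral_eq_integral) (auto intro!: ennreal_leI)
qed simp

lemma lipschitz_measurable:
  fixes f :: "real \<Rightarrow> real"
  assumes "0 \<le> \<Lambda>" "\<And>s t. \<bar>f s - f t\<bar> \<le> \<Lambda> * \<bar>s - t\<bar>"
  shows "f \<in> borel_measurable borel"
proof -
  have "\<Lambda>-lipschitz_on UNIV f" using assms by (intro lipschitz_onI) (auto simp: dist_real_def)
  then show ?thesis by (intro borel_measurable_continuous_onI lipschitz_on_continuous_on)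
qed

section \<open>Lower bound for the largest particle and potentials for a single particle\<close>

context convex_ensemble begin

text \<open>The Lipschitz function \<open>max 0 (t - (b - \<delta>))\<close> has positive \<mu>-mean
  because b lies in the support. A positive empirical mean requires a particle beyond b -
  \<delta>.\<close>

lemma max_lower:
  assumes \<delta>: "0 < \<delta>"
  obtains \<epsilon> N0 where "0 < \<epsilon>" "\<epsilon> \<le> 1" "0 < N0" "\<And>N x. N0 \<le> N \<Longrightarrow> good \<epsilon> N x \<Longrightarrow> \<exists>i<N. b - \<delta> < x i"
proof -
  define f where "f t = max 0 (t - (b - \<delta>))" for t
  have f_lip: "\<bar>f s - f t\<bar> \<le> 1 * \<bar>s - t\<bar>" for s t by (auto simp: f_def)
  have fm[measurable]: "f \<in> borel_measurable borel" using f_lip by (intro lipschitz_measurable[of 1]) auto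
  have fi: "integrable \<mu> f"
  proof (rule \<mu>.integrable_const_bound[where B="\<delta>"])
    show "AE t in \<mu>. norm (f t) \<le> \<delta>" using AE_S
    proof eventually_elim
      case (elim t)
      then show ?case using S_le_b[OF elim] \<delta> by (auto simp: f_def)
    qed
  qed simp
  have pos: "0 < (LINT t|\<mu>. f t)"
  proof (rule ccontr)
    assume "\<not> ?thesis"
    moreover have "0 \<le> (LINT t|\<mu>. f t)" by (intro Bochner_Integration.integral_nonneg) (simp add: f_def)
    ultimately have "(LINT t|\<mu>. f t) = 0" by simp
    then have "AE t in \<mu>. f t = 0"
      by (subst (asm) integral_nonneg_eq_0_iff_AE[OF fi]) (auto simp: f_def)
    then have "AE t in \<mu>. t \<notin> {b - \<delta><..}" by eventually_elim (auto simp: f_def max_def split: if_splits)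
    then have "emeasure \<mu> {b - \<delta><..} = 0"
      by (subst (asm) AE_iff_measurable[of "{b - \<delta><..}"]) auto
    moreover have "emeasure \<mu> {b - \<delta><..} > 0" using b_in_S \<delta> by (auto simp: measure_support_def)
    ultimately show False by simp
  qed
  define m where "m = (LINT t|\<mu>. f t)"
  obtain \<epsilon> N0 where e: "0 < \<epsilon>" "\<epsilon> \<le> 1" "0 < N0" and g: "\<And>N x \<Lambda> f. N0 \<le> N \<Longrightarrow> good \<epsilon> N x \<Longrightarrow> 0 \<le> \<Lambda> \<Longrightarrow>
    (\<And>s t. \<bar>f s - f t\<bar> \<le> \<Lambda> * \<bar>s - t\<bar>) \<Longrightarrow> \<bar>(\<Sum>i<N. f (x i)) / real N - (LINT t|\<mu>. f t)\<bar> \<le> \<Lambda> * (m / 2)"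
    using good_lipschitz[of "m / 2"] pos unfolding m_def by (metis half_gt_zero)
  show ?thesis
  proof (rule that[OF e])
    fix N x assume N: "N0 \<le> N" "good \<epsilon> N x"
    have "\<bar>(\<Sum>i<N. f (x i)) / real N - m\<bar> \<le> 1 * (m / 2)" unfolding m_def
      by (rule g[OF N, unfolded m_def]) (auto intro: f_lip[simplified])
    moreover have "0 < m" using pos by (simp add: m_def)
    ultimately have "0 < (\<Sum>i<N. f (x i)) / real N" by linarith
    then have "(\<Sum>i<N. f (x i)) \<noteq> 0" by auto
    then obtain i where "i < N" "f (x i) \<noteq> 0" by (meson lessThan_iff sum.not_neutral_contains_not_neutral)
    then show "\<exists>i<N. b - \<delta> < x i" by (auto simp: f_def max_def split: if_splits)
  qed
qed

text \<open>A probability density that is Lipschitz and supported in \<open>[-b, b]\<close>: averaging \<open>log |s - t|\<close> against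
  it yields the Lipschitz function \<open>g\<close>, to which the convergence of empirical measures applies.\<close>

definition r0 :: real where "r0 = (LINT s|lborel. max 0 (b - \<bar>s\<bar>))"
definition \<rho> :: "real \<Rightarrow> real" where "\<rho> s = max 0 (b - \<bar>s\<bar>) / r0"
definition R :: "real measure" where "R = density lborel (\<lambda>s. ennreal (\<rho> s))"

lemma tent_integrable: "integrable lborel (\<lambda>s::real. max 0 (b - \<bar>s\<bar>))"
proof (rule Bochner_Integration.integrable_bound)
  show "integrable lborel (\<lambda>s::real. b * indicator {-b..b} s)" using b_pos by simp
  show "AE s in lborel. norm (max 0 (b - \<bar>s\<bar>)) \<le> norm (b * indicator {-b..b} s)"
    using b_pos by (auto simp: indicator_def max_def)
qed measurable

lemma r0_pos: "0 < r0"
proof -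
  have "integrable lborel (\<lambda>s::real. b / 2 * indicator {-(b/2)..b/2} s)"
    using b_pos by (intro integrable_mult_right integrable_real_indicator) auto
  then have "(LINT s|lborel. b / 2 * indicator {-(b/2)..b/2} s) \<le> r0" unfolding r0_def
    by (rule integral_mono[OF _ tent_integrable]) (use b_pos in \<open>auto simp: indicator_def\<close>)
  moreover have "0 < (LINT s|lborel. b / 2 * indicator {-(b/2)..b/2} s)" using b_pos by simp
  ultimately show ?thesis by linarith
qed

lemma \<rho>_nonneg: "0 \<le> \<rho> s" using r0_pos by (simp add: \<rho>_def)
lemma \<rho>_le: "\<rho> s \<le> b / r0" using r0_pos b_pos by (auto simp: \<rho>_def intro!: divide_right_mono)
lemma \<rho>_lipschitz: "\<bar>\<rho> s - \<rho> t\<bar> \<le> 1 / r0 * \<bar>s - t\<bar>"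
proof -
  have "\<bar>max 0 (b - \<bar>s\<bar>) - max 0 (b - \<bar>t\<bar>)\<bar> \<le> \<bar>s - t\<bar>" by auto
  then show ?thesis using r0_pos by (simp add: \<rho>_def diff_divide_distrib[symmetric] divide_right_mono)
qed
lemma \<rho>_measurable[measurable]: "\<rho> \<in> borel_measurable borel"
  unfolding \<rho>_def[abs_def] by measurable

lemma \<rho>_integrable: "integrable lborel \<rho>"
  unfolding \<rho>_def[abs_def] using tent_integrable by simp

lemma real_distribution_R: "real_distribution R"
proof -
  have "(\<integral>\<^sup>+s. ennreal (\<rho> s) \<partial>lborel) = ennreal (LINT s|lborel. \<rho> s)"
    by (intro nn_integral_eq_integral \<rho>_integrable) (simp add: \<rho>_nonneg)
  also have "(LINT s|lborel. \<rho> s) = 1" using r0_pos unfolding \<rho>_def[abs_def] by (simp add: r0_def)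
  finally have "prob_space R" unfolding R_def
    by (intro prob_spaceI) (subst emeasure_density, auto cong: nn_integral_cong)
  then show ?thesis by (simp add: real_distribution_def real_distribution_axioms_def R_def)
qed

sublocale R: real_distribution R by (rule real_distribution_R)

lemma nn_integral_R: "f \<in> borel_measurable borel \<Longrightarrow> (\<integral>\<^sup>+s. f s \<partial>R) = (\<integral>\<^sup>+s. ennreal (\<rho> s) * f s \<partial>lborel)"
  unfolding R_def by (intro nn_integral_density) auto

lemma nn_integral_R_le:
  assumes [measurable]: "f \<in> borel_measurable borel"
  shows "(\<integral>\<^sup>+s. f s \<partial>R) \<le> ennreal (b / r0) * (\<integral>\<^sup>+s. f s \<partial>lborel)"
proof -
  have "(\<integral>\<^sup>+s. f s \<partial>R) \<le> (\<integral>\<^sup>+s. ennreal (b / r0) * f s \<partial>lborel)"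
    unfolding nn_integral_R[OF assms] by (intro nn_integral_mono mult_right_mono ennreal_leI \<rho>_le) auto
  then show ?thesis by (simp add: nn_integral_cmult)
qed

lemma AE_R: "AE s in R. s \<in> S"
  unfolding R_def
proof (subst AE_density)
  show "AE s in lborel. 0 < ennreal (\<rho> s) \<longrightarrow> s \<in> S"
  proof (intro AE_I2 impI)
    fix s assume "0 < ennreal (\<rho> s)"
    then have "0 < b - \<bar>s\<bar>" using r0_pos by (auto simp: \<rho>_def zero_less_divide_iff max_def split: if_splits)
    then show "s \<in> S" by (auto simp: support_interval)
  qed
qed measurable

lemma AE_R_lborel: "AE s in lborel. P s \<Longrightarrow> AE s in R. P s"
  unfolding R_def by (subst AE_density) (auto elim: eventually_mono)

lemma Q_bounded_S: "\<exists>D. \<forall>s\<in>S. \<bar>Q s\<bar> \<le> D"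
proof -
  have "bounded (Q ` S)" unfolding support_interval
    by (intro compact_imp_bounded compact_continuous_image continuous_on_subset[OF Q_continuous]) auto
  then show ?thesis unfolding bounded_iff by auto
qed

lemma integrable_S:
  assumes rd: "real_distribution P" and S: "AE s in P. s \<in> S" and f: "f \<in> borel_measurable borel"
    and bd: "\<And>s. s \<in> S \<Longrightarrow> \<bar>f s\<bar> \<le> D"
  shows "integrable P (f :: real \<Rightarrow> real)"
proof -
  interpret real_distribution P by fact
  show ?thesis
    using f by (intro integrable_const_bound[where B=D] eventually_mono[OF S]) (auto simp: bd)
qed

lemma integrable_lipschitz:
  assumes rd: "real_distribution P" and S: "AE s in P. s \<in> S" and "0 \<le> \<Lambda>"
    and f: "\<And>s t. \<bar>f s - f t\<bar> \<le> \<Lambda> * \<bar>s - t\<bar>"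
  shows "integrable P (f :: real \<Rightarrow> real)"
proof (rule integrable_S[OF rd S])
  show "f \<in> borel_measurable borel" using assms(3) f by (rule lipschitz_measurable)
  fix s assume "s \<in> S"
  then have "\<Lambda> * \<bar>s - 0\<bar> \<le> \<Lambda> * b" using assms(3) S_le_b by (intro mult_left_mono) auto
  then show "\<bar>f s\<bar> \<le> \<bar>f 0\<bar> + \<Lambda> * b" using f[of s 0] by linarith
qed

lemma integrable_Q: "integrable \<mu> Q" "integrable R Q"
  using Q_bounded_S integrable_S[OF real_distribution_\<mu> AE_S Q_measurable]
    integrable_S[OF real_distribution_R AE_R Q_measurable] by blast+

abbreviation neg_ln :: "real \<Rightarrow> real" where "neg_ln u \<equiv> max 0 (- ln \<bar>u\<bar>)"
abbreviation pos_ln :: "real \<Rightarrow> real" where "pos_ln u \<equiv> ln (max \<bar>u\<bar> 1)"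

lemma ln_split: "ln \<bar>u\<bar> = pos_ln u - neg_ln u" for u :: real
proof (cases "u = 0")
  case False
  then show ?thesis
    using ln_ge_zero_iff[of "\<bar>u\<bar>"] by (cases "\<bar>u\<bar> \<le> 1") (auto simp: max_def)
qed simp

lemma neg_ln_integrable: "integrable lborel (\<lambda>u. neg_ln u)" and neg_ln_integral: "(LINT u|lborel. neg_ln u) \<le> 8"
proof -
  have le: "(\<integral>\<^sup>+u. ennreal (neg_ln u) \<partial>lborel) \<le> ennreal 8"
    using nn_integral_neg_ln[of 0] by simp
  then show i: "integrable lborel (\<lambda>u. neg_ln u)"
    by (intro integrableI_nonneg) (auto intro: le_less_trans)
  show "(LINT u|lborel. neg_ln u) \<le> 8"
  proof -
    have "(\<integral>\<^sup>+u. ennreal (neg_ln u) \<partial>lborel) = ennreal (LINT u|lborel. neg_ln u)"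
      by (rule nn_integral_eq_integral[OF i]) auto
    with le have "ennreal (LINT u|lborel. neg_ln u) \<le> ennreal 8" by (simp only:)
    then show ?thesis by (subst (asm) ennreal_le_iff) auto
  qed
qed

lemma neg_ln_R: "integrable R (\<lambda>s. neg_ln (s - t))"
proof (rule integrableI_nonneg)
  have "(\<integral>\<^sup>+s. ennreal (neg_ln (s - t)) \<partial>R) \<le> ennreal (b / r0) * (\<integral>\<^sup>+s. ennreal (neg_ln (s - t)) \<partial>lborel)"
    by (rule nn_integral_R_le) measurable
  also have "(\<integral>\<^sup>+s. ennreal (neg_ln (s - t)) \<partial>lborel) \<le> 8"
    using nn_integral_neg_ln[of t] by (simp add: abs_minus_commute)
  finally show "(\<integral>\<^sup>+s. ennreal (neg_ln (s - t)) \<partial>R) < \<infinity>"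
    by (auto simp: ennreal_mult_less_top mult_left_mono intro: le_less_trans)
qed auto

text \<open>The shift moves the dependence on t from the singular logarithm to the Lipschitz density
  \<rho>.\<close>

lemma LINT_neg_ln_R: "(LINT s|R. neg_ln (s - t)) = (LINT u|lborel. \<rho> (u + t) * neg_ln u)"
proof -
  have "(LINT s|R. neg_ln (s - t)) = (LINT s|lborel. \<rho> s * neg_ln (s - t))"
    unfolding R_def by (subst integral_density) (auto simp: \<rho>_nonneg)
  also have "\<dots> = (LINT u|lborel. \<rho> (u + t) * neg_ln u)"
    by (subst lborel_integral_real_affine[where c=1 and t=t]) (auto simp: add.commute)
  finally show ?thesis .
qed

text \<open>The mean interaction of a particle at t with a particle distributed according to
  \<open>R\<close>; the factor 2 stems from the squared differences in the weight.\<close>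

definition g :: "real \<Rightarrow> real" where "g t = (LINT s|R. h (s - t) - 2 * ln \<bar>s - t\<bar>)"

text \<open>L comes from h and 2 from the logarithm cut at distance 1. The singular part, also
  doubled, contributes the Lipschitz constant \<open>1 / r0\<close> of \<rho> times the mass bound 8
  of \<open>neg_ln\<close>.\<close>

definition \<Lambda>g :: real where "\<Lambda>g = L + 2 + 16 / r0"

lemma \<Lambda>g_nonneg: "0 \<le> \<Lambda>g" using L_nonneg r0_pos by (simp add: \<Lambda>g_def)

lemma smooth_part_lipschitz: "\<bar>(h (s - t) - 2 * pos_ln (s - t)) - (h (s' - t') - 2 * pos_ln (s' - t'))\<bar>
    \<le> (L + 2) * \<bar>(s - t) - (s' - t')\<bar>"
  using h_lipschitz[of "s - t" "s' - t'"] ln_max_lipschitz[of 1 "s - t" "s' - t'"]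
  by (simp add: distrib_right abs_le_iff)

lemma smooth_part_R: "integrable R (\<lambda>s. h (s - t) - 2 * pos_ln (s - t))"
  by (rule integrable_lipschitz[OF real_distribution_R AE_R, of "L + 2"])
     (use smooth_part_lipschitz[of _ t _ t] L_nonneg in auto)

lemma log_R: "integrable R (\<lambda>s. h (s - t) - 2 * ln \<bar>s - t\<bar>)"
proof -
  have "h (s - t) - 2 * ln \<bar>s - t\<bar> = (h (s - t) - 2 * pos_ln (s - t)) + 2 * neg_ln (s - t)" for s
    by (subst ln_split) simp
  then show ?thesis using smooth_part_R[of t] neg_ln_R[of t] by (simp only:) auto
qed

lemma g_eq: "g t = (LINT s|R. h (s - t) - 2 * pos_ln (s - t)) + 2 * (LINT s|R. neg_ln (s - t))"
proof -
  have "h (s - t) - 2 * ln \<bar>s - t\<bar> = (h (s - t) - 2 * pos_ln (s - t)) + 2 * neg_ln (s - t)" for s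
    by (subst ln_split) simp
  then have "g t = (LINT s|R. (h (s - t) - 2 * pos_ln (s - t)) + 2 * neg_ln (s - t))"
    unfolding g_def by (simp only:)
  also have "\<dots> = (LINT s|R. h (s - t) - 2 * pos_ln (s - t)) + (LINT s|R. 2 * neg_ln (s - t))"
    by (rule Bochner_Integration.integral_add[OF smooth_part_R]) (use neg_ln_R in auto)
  finally show ?thesis by simp
qed

lemma g_lipschitz: "\<bar>g t - g t'\<bar> \<le> \<Lambda>g * \<bar>t - t'\<bar>"
proof -
  have "(LINT s|R. h (s - t) - 2 * pos_ln (s - t)) - (LINT s|R. h (s - t') - 2 * pos_ln (s - t'))
      = (LINT s|R. (h (s - t) - 2 * pos_ln (s - t)) - (h (s - t') - 2 * pos_ln (s - t')))"
    by (rule Bochner_Integration.integral_diff[symmetric]) (rule smooth_part_R)+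
  then have "\<bar>(LINT s|R. h (s - t) - 2 * pos_ln (s - t)) - (LINT s|R. h (s - t') - 2 * pos_ln (s - t'))\<bar>
      = \<bar>LINT s|R. (h (s - t) - 2 * pos_ln (s - t)) - (h (s - t') - 2 * pos_ln (s - t'))\<bar>" by (simp only:)
  also have "\<dots> \<le> (L + 2) * \<bar>t - t'\<bar>"
  proof (rule bounded_LINT[OF R.prob_space_axioms])
    fix s show "\<bar>(h (s - t) - 2 * pos_ln (s - t)) - (h (s - t') - 2 * pos_ln (s - t'))\<bar> \<le> (L + 2) * \<bar>t - t'\<bar>"
      using smooth_part_lipschitz[of s t s t'] by (simp add: abs_minus_commute)
  qed measurable
  finally have 1: "\<bar>(LINT s|R. h (s - t) - 2 * pos_ln (s - t)) - (LINT s|R. h (s - t') - 2 * pos_ln (s - t'))\<bar> \<le> (L + 2) * \<bar>t - t'\<bar>" .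
  have i: "integrable lborel (\<lambda>u. \<rho> (u + t) * neg_ln u)" for t
  proof (rule Bochner_Integration.integrable_bound)
    show "integrable lborel (\<lambda>u. b / r0 * neg_ln u)" using neg_ln_integrable by auto
    show "AE u in lborel. norm (\<rho> (u + t) * neg_ln u) \<le> norm (b / r0 * neg_ln u)"
    proof (intro AE_I2)
      fix u
      have "\<rho> (u + t) * neg_ln u \<le> b / r0 * neg_ln u" by (intro mult_right_mono \<rho>_le) auto
      moreover have "0 \<le> \<rho> (u + t) * neg_ln u" by (intro mult_nonneg_nonneg \<rho>_nonneg) auto
      ultimately show "norm (\<rho> (u + t) * neg_ln u) \<le> norm (b / r0 * neg_ln u)"
        unfolding real_norm_def by (rule abs_le_abs[OF _ _])
    qed
  qed measurable
  have "(LINT s|R. neg_ln (s - t)) - (LINT s|R. neg_ln (s - t')) = (LINT u|lborel. \<rho> (u + t) * neg_ln u - \<rho> (u + t') * neg_ln u)"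
    unfolding LINT_neg_ln_R by (rule Bochner_Integration.integral_diff[symmetric]) (rule i)+
  then have "\<bar>(LINT s|R. neg_ln (s - t)) - (LINT s|R. neg_ln (s - t'))\<bar>
     \<le> (LINT u|lborel. \<bar>\<rho> (u + t) * neg_ln u - \<rho> (u + t') * neg_ln u\<bar>)"
    by (simp only: integral_abs_bound)
  also have "\<dots> \<le> (LINT u|lborel. 1 / r0 * \<bar>t - t'\<bar> * neg_ln u)"
  proof (rule integral_mono)
    fix u
    have "\<bar>\<rho> (u + t) * neg_ln u - \<rho> (u + t') * neg_ln u\<bar> = \<bar>\<rho> (u + t) - \<rho> (u + t')\<bar> * neg_ln u"
      by (simp add: abs_mult flip: left_diff_distrib)
    also have "\<dots> \<le> 1 / r0 * \<bar>t - t'\<bar> * neg_ln u"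
      using \<rho>_lipschitz[of "u + t" "u + t'"] by (intro mult_right_mono) auto
    finally show "\<bar>\<rho> (u + t) * neg_ln u - \<rho> (u + t') * neg_ln u\<bar> \<le> 1 / r0 * \<bar>t - t'\<bar> * neg_ln u" .
  qed (use i neg_ln_integrable in auto)
  also have "\<dots> = 1 / r0 * \<bar>t - t'\<bar> * (LINT u|lborel. neg_ln u)" by simp
  also have "\<dots> \<le> 1 / r0 * \<bar>t - t'\<bar> * 8"
    using neg_ln_integral r0_pos by (intro mult_left_mono) auto
  finally have 2: "\<bar>(LINT s|R. neg_ln (s - t)) - (LINT s|R. neg_ln (s - t'))\<bar> \<le> 8 / r0 * \<bar>t - t'\<bar>"
    by (simp add: mult.commute)
  have "\<Lambda>g * \<bar>t - t'\<bar> = (L + 2) * \<bar>t - t'\<bar> + 2 * (8 / r0 * \<bar>t - t'\<bar>)" by (simp add: \<Lambda>g_def distrib_right)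
  then show ?thesis using 1 2 unfolding g_eq by linarith
qed

definition q0 :: real where "q0 = (LINT t|\<mu>. Q t)"
text \<open>The \<mu>-almost sure value of the effective potential \<open>Q s\<close> plus the
  \<mu>-integral of \<open>h (s - t) - 2 * ln \<bar>s - t\<bar>\<close>. It is obtained by doubling
  \<open>\<Psi> s = E0\<close> and removing the terms that do not depend on s.\<close>

definition l0 :: real where "l0 = 2 * E0 - q0 - 2 * C"

lemma w_le_K: "ennreal (w s t) \<le> K s t" by (simp add: K_def)

lemma w_R: "integrable R (\<lambda>s. w s t)"
proof -
  have "w s t = (Q s + Q t) / 2 + C + (h (s - t) - 2 * ln \<bar>s - t\<bar>) / 2" for s
    by (simp add: w_def w0_def field_simps)
  then show ?thesis using integrable_Q(2) log_R[of t] by simp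
qed

text \<open>The bound \<open>\<Psi> \<le> E0\<close> is averaged over \<open>R\<close>, which lives
  on the support; Fubini turns the result into a \<mu>-integral of g.\<close>

lemma bulk_potential: "(LINT s|R. Q s) + (LINT t|\<mu>. g t) \<le> l0"
proof -
  interpret RM: pair_prob_space R \<mu> ..
  note fsR[measurable] = borel_measurable_fst_snd[OF R.events_eq_borel]
  have wm[measurable]: "(\<lambda>p. w (fst p) (snd p)) \<in> borel_measurable (R \<Otimes>\<^sub>M \<mu>)"
  proof -
    have "(\<lambda>p. w (fst p) (snd p)) \<in> borel_measurable (borel \<Otimes>\<^sub>M borel)"
      unfolding w_def w0_def by measurable
    then show ?thesis by (simp cong: measurable_cong_sets)
  qed
  have "(\<integral>\<^sup>+p. ennreal (w (fst p) (snd p)) \<partial>(R \<Otimes>\<^sub>M \<mu>)) = (\<integral>\<^sup>+s. \<integral>\<^sup>+t. ennreal (w s t) \<partial>\<mu> \<partial>R)"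
    by (subst \<mu>.nn_integral_fst[symmetric]) auto
  also have "\<dots> \<le> (\<integral>\<^sup>+s. \<Psi> s \<partial>R)" unfolding \<Psi>_def by (intro nn_integral_mono w_le_K)
  also have "\<dots> \<le> (\<integral>\<^sup>+s. ennreal E0 \<partial>R)"
    by (intro nn_integral_mono_AE eventually_mono[OF AE_R]) (rule \<Psi>_le_support)
  also have "\<dots> = ennreal E0" using R.emeasure_space_1 by simp
  finally have le: "(\<integral>\<^sup>+p. ennreal (w (fst p) (snd p)) \<partial>(R \<Otimes>\<^sub>M \<mu>)) \<le> ennreal E0" .
  have wi: "integrable (R \<Otimes>\<^sub>M \<mu>) (\<lambda>p. w (fst p) (snd p))"
    using le by (intro integrableI_nonneg) (auto simp: w_nonneg intro: le_less_trans)
  have wle: "(LINT p|(R \<Otimes>\<^sub>M \<mu>). w (fst p) (snd p)) \<le> E0"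
    using le E0_nonneg by (subst (asm) nn_integral_eq_integral[OF wi]) (auto simp: w_nonneg ennreal_le_iff)
  have wi2: "integrable (R \<Otimes>\<^sub>M \<mu>) (case_prod (\<lambda>s t. w s t))" using wi by (simp add: case_prod_beta')
  have sw: "(LINT t|\<mu>. LINT s|R. w s t) = (LINT p|(R \<Otimes>\<^sub>M \<mu>). w (fst p) (snd p))"
    using RM.integral_snd[OF wi2] by (simp add: case_prod_beta')
  have si: "integrable \<mu> (\<lambda>t. LINT s|R. w s t)" by (rule RM.integrable_snd[OF wi2])
  have g: "g t = 2 * (LINT s|R. w s t) - (LINT s|R. Q s) - Q t - 2 * C" for t
  proof -
    have "h (s - t) - 2 * ln \<bar>s - t\<bar> = 2 * w s t - Q s - (Q t + 2 * C)" for s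
      by (simp add: w_def w0_def field_simps)
    then have "g t = (LINT s|R. 2 * w s t - Q s - (Q t + 2 * C))" unfolding g_def by (simp only:)
    also have "\<dots> = 2 * (LINT s|R. w s t) - (LINT s|R. Q s) - (Q t + 2 * C)"
      using w_R[of t] integrable_Q(2) R.prob_space by simp
    finally show ?thesis by simp
  qed
  have "(LINT t|\<mu>. g t) = 2 * (LINT t|\<mu>. LINT s|R. w s t) - (LINT s|R. Q s) - q0 - 2 * C"
    unfolding g q0_def using si integrable_Q(1) \<mu>.prob_space by simp
  then show ?thesis using wle unfolding sw l0_def by linarith
qed

text \<open>For \<open>s \<ge> b + \<delta>\<close> the truncation is invisible to \<open>\<mu>\<close>, but it bounds the interaction with stray
  particles from below.\<close>

definition fo :: "real \<Rightarrow> real \<Rightarrow> real \<Rightarrow> real" where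
  "fo \<delta> s t = h (s - t) - 2 * ln (max \<bar>s - t\<bar> \<delta>)"

lemma fo_lipschitz:
  assumes "0 < \<delta>"
  shows "\<bar>fo \<delta> s t - fo \<delta> s t'\<bar> \<le> (L + 2 / \<delta>) * \<bar>t - t'\<bar>"
  using h_lipschitz[of "s - t" "s - t'"] ln_max_lipschitz[OF assms, of "s - t" "s - t'"]
  unfolding fo_def by (simp add: distrib_right abs_le_iff abs_minus_commute[of t'])

text \<open>Doubling \<open>\<Psi>_growth\<close> gives the quadratic excess over \<open>l0\<close>.
  The truncation is inactive almost surely, because the support is at distance at least \<delta>
  from s.\<close>

lemma outer_potential:
  assumes \<delta>: "0 < \<delta>" and s: "b + \<delta> \<le> s"
  shows "l0 + (a - 2 * M) / 4 * (s - b)\<^sup>2 \<le> Q s + (LINT t|\<mu>. fo \<delta> s t)"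
proof -
  have fi: "integrable \<mu> (\<lambda>t. fo \<delta> s t)"
    using fo_lipschitz[OF \<delta>] \<delta> L_nonneg by (intro integrable_lipschitz[OF real_distribution_\<mu> AE_S, of "L + 2 / \<delta>"]) auto
  have ae: "AE t in \<mu>. w s t = (Q s + Q t) / 2 + fo \<delta> s t / 2 + C \<and> t \<noteq> s"
    using AE_S
  proof eventually_elim
    case (elim t)
    then have "\<delta> \<le> \<bar>s - t\<bar>" "t \<noteq> s" using S_le_b[OF elim] s \<delta> by auto
    then show ?case by (simp add: w_def w0_def fo_def max_def field_simps)
  qed
  have wi: "integrable \<mu> (\<lambda>t. w s t)"
  proof (subst integrable_cong_AE)
    show "AE t in \<mu>. w s t = (Q s + Q t) / 2 + fo \<delta> s t / 2 + C" using ae by eventually_elim auto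
    show "integrable \<mu> (\<lambda>t. (Q s + Q t) / 2 + fo \<delta> s t / 2 + C)" using fi integrable_Q(1) by simp
  qed (unfold w_def w0_def fo_def, measurable)
  have "(LINT t|\<mu>. w s t) = (LINT t|\<mu>. (Q s + Q t) / 2 + fo \<delta> s t / 2 + C)"
    by (intro integral_cong_AE eventually_mono[OF ae]) (unfold w_def w0_def fo_def, auto)
  also have "\<dots> = (Q s + q0) / 2 + (LINT t|\<mu>. fo \<delta> s t) / 2 + C"
    using fi integrable_Q(1) \<mu>.prob_space by (simp add: q0_def add_divide_distrib)
  finally have eq: "(LINT t|\<mu>. w s t) = (Q s + q0) / 2 + (LINT t|\<mu>. fo \<delta> s t) / 2 + C" .
  have "\<Psi> s = (\<integral>\<^sup>+t. ennreal (w s t) \<partial>\<mu>)" unfolding \<Psi>_def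
    by (intro nn_integral_cong_AE eventually_mono[OF ae]) (auto simp: K_def)
  also have "\<dots> = ennreal (LINT t|\<mu>. w s t)" using wi by (intro nn_integral_eq_integral) (auto simp: w_nonneg)
  finally have "ennreal (E0 + (a - 2 * M) / 8 * (s - b)\<^sup>2) \<le> ennreal (LINT t|\<mu>. w s t)"
    using \<Psi>_growth[of s] s \<delta> by simp
  moreover have "0 \<le> (LINT t|\<mu>. w s t)" by (intro Bochner_Integration.integral_nonneg w_nonneg)
  ultimately have "E0 + (a - 2 * M) / 8 * (s - b)\<^sup>2 \<le> (LINT t|\<mu>. w s t)" by (simp add: ennreal_le_iff)
  then show ?thesis unfolding eq l0_def by (simp add: field_simps)
qed

text \<open>The weight as a function of the last particle, and the remaining factor.\<close>

definition pw :: "nat \<Rightarrow> (nat \<Rightarrow> real) \<Rightarrow> real \<Rightarrow> real" where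
  "pw m y s = (\<Prod>k<m. \<bar>y k - s\<bar> ^ 2) * exp (- real (Suc m) * Q s - (\<Sum>k<m. h (y k - s)))"

definition cw :: "nat \<Rightarrow> (nat \<Rightarrow> real) \<Rightarrow> real" where
  "cw m y = (\<Prod>j<m. \<Prod>i<j. \<bar>y i - y j\<bar> ^ 2) *
     exp (- real (Suc m) * (\<Sum>j<m. Q (y j)) - (\<Sum>j<m. \<Sum>i<j. h (y i - y j)))"

text \<open>The factor \<open>cw\<close> is common to all positions of the last particle, so
  estimates comparing these positions involve only \<open>pw\<close>.\<close>

lemma weight_last: "wt (Suc m) (y(m := s)) = cw m y * pw m y s"
proof -
  have 1: "(\<Prod>j<Suc m. \<Prod>i<j. \<bar>(y(m := s)) i - (y(m := s)) j\<bar> ^ 2)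
      = (\<Prod>j<m. \<Prod>i<j. \<bar>y i - y j\<bar> ^ 2) * (\<Prod>k<m. \<bar>y k - s\<bar> ^ 2)"
    unfolding lessThan_Suc by (simp add: mult.commute)
  have 2: "(\<Sum>j<Suc m. \<Sum>i<j. h ((y(m := s)) i - (y(m := s)) j))
      = (\<Sum>j<m. \<Sum>i<j. h (y i - y j)) + (\<Sum>k<m. h (y k - s))"
    unfolding lessThan_Suc by (simp add: add.commute)
  have 3: "(\<Sum>j<Suc m. Q ((y(m := s)) j)) = (\<Sum>j<m. Q (y j)) + Q s"
    unfolding lessThan_Suc by (simp add: add.commute)
  have e: "- real (Suc m) * (A + q) - (H + H') = (- real (Suc m) * A - H) + (- real (Suc m) * q - H')" for A q H H'
    by (simp only: algebra_simps)
  show ?thesis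
    unfolding ensemble_weight_def 1 2 3 e exp_add cw_def pw_def by (simp only: ac_simps)
qed

lemma cw_nonneg: "0 \<le> cw m y" and pw_nonneg: "0 \<le> pw m y s"
  by (auto simp: cw_def pw_def intro!: mult_nonneg_nonneg prod_nonneg)

lemma pw_measurable[measurable]: "pw m y \<in> borel_measurable borel"
  unfolding pw_def[abs_def] by measurable

lemma pw_numerator:
  assumes \<delta>: "0 < \<delta>"
  shows "pw m y s \<le> exp (- (real (Suc m) * Q s + (\<Sum>k<m. fo \<delta> s (y k))))"
proof -
  have "(\<Prod>k<m. \<bar>y k - s\<bar> ^ 2) \<le> (\<Prod>k<m. exp (2 * ln (max \<bar>s - y k\<bar> \<delta>)))"
  proof (intro prod_mono conjI)
    fix k
    have "\<bar>y k - s\<bar> ^ 2 \<le> (max \<bar>s - y k\<bar> \<delta>)\<^sup>2" by (intro power_mono) (auto simp: abs_minus_commute)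
    also have "\<dots> = exp (2 * ln (max \<bar>s - y k\<bar> \<delta>))"
      using \<delta> by (simp add: exp_double max_def)
    finally show "\<bar>y k - s\<bar> ^ 2 \<le> exp (2 * ln (max \<bar>s - y k\<bar> \<delta>))" .
  qed auto
  also have "\<dots> = exp (\<Sum>k<m. 2 * ln (max \<bar>s - y k\<bar> \<delta>))" by (simp add: exp_sum)
  finally have "pw m y s \<le> exp (\<Sum>k<m. 2 * ln (max \<bar>s - y k\<bar> \<delta>)) * exp (- real (Suc m) * Q s - (\<Sum>k<m. h (y k - s)))"
    unfolding pw_def by (intro mult_right_mono) auto
  also have "\<dots> = exp (- (real (Suc m) * Q s + (\<Sum>k<m. fo \<delta> s (y k))))"
  proof -
    have "(\<Sum>k<m. fo \<delta> s (y k)) = (\<Sum>k<m. h (y k - s)) - (\<Sum>k<m. 2 * ln (max \<bar>s - y k\<bar> \<delta>))"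
      unfolding fo_def by (simp add: sum_subtractf h_swap[of s])
    then show ?thesis by (simp add: algebra_simps flip: exp_add)
  qed
  finally show ?thesis .
qed

text \<open>Jensen's inequality under \<open>R\<close> replaces the mass by the exponential of a
  mean energy in which the other particles enter only through g. The density bound
  \<open>b / r0\<close> leads back to Lebesgue measure; positions that hit another particle form a
  null set.\<close>

lemma pw_denominator:
  "ennreal (exp (- (real (Suc m) * (LINT s|R. Q s) + (\<Sum>k<m. g (y k))))) \<le> ennreal (b / r0) * (\<integral>\<^sup>+s. ennreal (pw m y s) \<partial>lborel)"
proof -
  let ?X = "\<lambda>s. - real (Suc m) * Q s - (\<Sum>k<m. h (s - y k) - 2 * ln \<bar>s - y k\<bar>)"
  have Xi: "integrable R ?X"
    by (rule Bochner_Integration.integrable_diff[OF integrable_mult_right[OF integrable_Q(2)] Bochner_Integration.integrable_sum])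
       (rule log_R)
  have "(LINT s|R. ?X s) = - real (Suc m) * (LINT s|R. Q s) - (\<Sum>k<m. g (y k))"
    unfolding g_def
  proof -
    have 1: "integrable R (\<lambda>s. - real (Suc m) * Q s)" using integrable_Q(2) by (rule integrable_mult_right)
    have 2: "integrable R (\<lambda>s. \<Sum>k<m. h (s - y k) - 2 * ln \<bar>s - y k\<bar>)"
      by (intro Bochner_Integration.integrable_sum log_R)
    have 3: "(LINT s|R. (\<Sum>k<m. h (s - y k) - 2 * ln \<bar>s - y k\<bar>)) = (\<Sum>k<m. LINT s|R. h (s - y k) - 2 * ln \<bar>s - y k\<bar>)"
      by (intro Bochner_Integration.integral_sum log_R)
    show "(LINT s|R. ?X s) = - real (Suc m) * (LINT s|R. Q s) - (\<Sum>k<m. LINT s|R. h (s - y k) - 2 * ln \<bar>s - y k\<bar>)"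
      unfolding Bochner_Integration.integral_diff[OF 1 2] 3 by simp
  qed
  then have "ennreal (exp (- (real (Suc m) * (LINT s|R. Q s) + (\<Sum>k<m. g (y k))))) = ennreal (exp (LINT s|R. ?X s))"
    by (simp add: algebra_simps)
  also have "\<dots> \<le> (\<integral>\<^sup>+s. ennreal (exp (?X s)) \<partial>R)" by (rule R.exp_integral_le[OF Xi])
  also have "\<dots> = (\<integral>\<^sup>+s. ennreal (pw m y s) \<partial>R)"
  proof (rule nn_integral_cong_AE, rule eventually_mono[OF AE_R_lborel[OF AE_lborel_avoid_finite[of "y ` {..<m}"]]])
    fix s assume s: "s \<notin> y ` {..<m}"
    have "(\<Prod>k<m. \<bar>y k - s\<bar> ^ 2) = (\<Prod>k<m. exp (2 * ln \<bar>s - y k\<bar>))"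
    proof (intro prod.cong refl)
      fix k assume "k \<in> {..<m}"
      then have "0 < \<bar>s - y k\<bar>" using s by auto
      then show "\<bar>y k - s\<bar> ^ 2 = exp (2 * ln \<bar>s - y k\<bar>)" by (simp add: exp_double power2_commute)
    qed
    then have "pw m y s = exp (\<Sum>k<m. 2 * ln \<bar>s - y k\<bar>) * exp (- real (Suc m) * Q s - (\<Sum>k<m. h (s - y k)))"
      unfolding pw_def by (simp add: exp_sum h_swap[of s])
    also have "\<dots> = exp (?X s)" by (simp add: sum_subtractf flip: exp_add)
    finally show "ennreal (exp (?X s)) = ennreal (pw m y s)" by simp
  qed simp
  also have "\<dots> \<le> ennreal (b / r0) * (\<integral>\<^sup>+s. ennreal (pw m y s) \<partial>lborel)"
    by (rule nn_integral_R_le) measurable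
  finally show ?thesis .
qed

end

section \<open>Upper bound for the largest particle\<close>

context convex_ensemble begin

definition \<kappa> :: real where "\<kappa> = (a - 2 * M) / 4"

lemma \<kappa>_pos: "0 < \<kappa>" using a_gt M_nonneg by (simp add: \<kappa>_def)

definition G1 :: real where "G1 = enn2real (\<integral>\<^sup>+s. ennreal (exp (- (\<kappa> / 2 * s\<^sup>2))) \<partial>lborel)"

lemma G1: "(\<integral>\<^sup>+s. ennreal (exp (- (\<kappa> / 2 * (s - b)\<^sup>2))) \<partial>lborel) = ennreal G1"
proof -
  have "(\<integral>\<^sup>+s. ennreal (exp (- (\<kappa> / 2 * (s - b)\<^sup>2))) \<partial>lborel) = (\<integral>\<^sup>+s. ennreal (exp (- (\<kappa> / 2 * s\<^sup>2))) \<partial>lborel)"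
    by (subst nn_integral_real_affine[where c=1 and t=b]) auto
  then show ?thesis unfolding G1_def
    using nn_integral_gaussian_finite[of "\<kappa> / 2"] \<kappa>_pos by simp
qed

lemma G1_nonneg: "0 \<le> G1" by (simp add: G1_def)

definition B1 :: "real \<Rightarrow> real" where "B1 \<delta> = B + 2 * \<bar>ln \<delta>\<bar>"

text \<open>The logarithm of the ratio of outer mass to total mass, up to constant factors: the gain
  from the potential, the two empirical approximation errors, and the corrections for the one
  particle that the empirical mean contains but the sums over the others do not.\<close>

definition rate :: "real \<Rightarrow> real \<Rightarrow> nat \<Rightarrow> real" where
  "rate \<delta> \<eta> N = - (real N * \<kappa> * \<delta>\<^sup>2 / 2) + real N * ((L + 2 / \<delta>) + \<Lambda>g) * \<eta> + B1 \<delta> + \<bar>g 0\<bar> + \<Lambda>g * sqrt (A2 * real N)"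

text \<open>Here s0 only witnesses that the other particles belong to some good configuration, so
  that their averages are known. Neither side of the estimate depends on it, and the total mass is
  not restricted to good positions.\<close>

lemma section_bound:
  assumes \<delta>: "0 < \<delta>" and \<eta>: "0 < \<eta>"
  obtains \<epsilon> N0 where "0 < \<epsilon>" "\<epsilon> \<le> 1" "0 < N0"
    "\<And>m y s0. N0 \<le> Suc m \<Longrightarrow> good \<epsilon> (Suc m) (y(m := s0)) \<Longrightarrow>
      (\<integral>\<^sup>+s. ennreal (pw m y s) * indicator {b + \<delta>..} s \<partial>lborel)
        \<le> ennreal (exp (rate \<delta> \<eta> (Suc m)) * G1 * (b / r0)) * (\<integral>\<^sup>+s. ennreal (pw m y s) \<partial>lborel)"
proof -
  obtain \<epsilon> N0 where e: "0 < \<epsilon>" "\<epsilon> \<le> 1" "0 < N0" and lip: "\<And>N x \<Lambda> f. N0 \<le> N \<Longrightarrow> good \<epsilon> N x \<Longrightarrow> 0 \<le> \<Lambda> \<Longrightarrow>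
    (\<And>s t. \<bar>f s - f t\<bar> \<le> \<Lambda> * \<bar>s - t\<bar>) \<Longrightarrow>
    \<bar>(\<Sum>i<N. f (x i)) / real N - (LINT t|\<mu>. f t)\<bar> \<le> \<Lambda> * \<eta>"
    using good_lipschitz[OF \<eta>] by blast
  show ?thesis
  proof (rule that[OF e])
    fix m y s0 assume N: "N0 \<le> Suc m" and gd: "good \<epsilon> (Suc m) (y(m := s0))"
    let ?N = "real (Suc m)" and ?x = "y(m := s0)"
    define \<Lambda>f where "\<Lambda>f = L + 2 / \<delta>"
    have Npos: "0 < ?N" "1 \<le> ?N" by auto
    have split: "(\<Sum>i<Suc m. f (?x i)) = (\<Sum>k<m. f (y k)) + f s0" for f :: "real \<Rightarrow> real"
      unfolding lessThan_Suc by (simp add: add.commute)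
    have avg: "?N * ((LINT t|\<mu>. f t) - \<Lambda> * \<eta>) \<le> (\<Sum>i<Suc m. f (?x i))"
      "(\<Sum>i<Suc m. f (?x i)) \<le> ?N * ((LINT t|\<mu>. f t) + \<Lambda> * \<eta>)"
      if "0 \<le> \<Lambda>" "\<And>s t. \<bar>f s - f t\<bar> \<le> \<Lambda> * \<bar>s - t\<bar>" for f \<Lambda>
    proof -
      have "\<bar>(\<Sum>i<Suc m. f (?x i)) / ?N - (LINT t|\<mu>. f t)\<bar> \<le> \<Lambda> * \<eta>" by (rule lip[OF N gd that])
      then have "(LINT t|\<mu>. f t) - \<Lambda> * \<eta> \<le> (\<Sum>i<Suc m. f (?x i)) / ?N" "(\<Sum>i<Suc m. f (?x i)) / ?N \<le> (LINT t|\<mu>. f t) + \<Lambda> * \<eta>"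
        by linarith+
      then show "?N * ((LINT t|\<mu>. f t) - \<Lambda> * \<eta>) \<le> (\<Sum>i<Suc m. f (?x i))"
        "(\<Sum>i<Suc m. f (?x i)) \<le> ?N * ((LINT t|\<mu>. f t) + \<Lambda> * \<eta>)"
        using Npos(1) by (simp_all only: pos_le_divide_eq pos_divide_le_eq mult.commute)
    qed
    define u where "u = - (?N * l0) - ?N * \<kappa> * \<delta>\<^sup>2 / 2 + ?N * \<Lambda>f * \<eta> + B1 \<delta>"
    have num: "pw m y s * indicator {b + \<delta>..} s \<le> exp u * exp (- (\<kappa> / 2 * (s - b)\<^sup>2))" for s
    proof (cases "b + \<delta> \<le> s")
      case True
      have "?N * ((LINT t|\<mu>. fo \<delta> s t) - \<Lambda>f * \<eta>) \<le> (\<Sum>k<m. fo \<delta> s (y k)) + fo \<delta> s s0"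
        unfolding split[symmetric] using fo_lipschitz[OF \<delta>] L_nonneg \<delta> by (intro avg) (auto simp: \<Lambda>f_def)
      moreover have "fo \<delta> s s0 \<le> B1 \<delta>"
      proof -
        have "ln \<delta> \<le> ln (max \<bar>s - s0\<bar> \<delta>)" using \<delta> by (intro ln_mono) auto
        then show ?thesis using h_bound[of "s - s0"] unfolding fo_def B1_def by (simp add: abs_if split: if_splits)
      qed
      moreover have "?N * (l0 + \<kappa> * (s - b)\<^sup>2) \<le> ?N * (Q s + (LINT t|\<mu>. fo \<delta> s t))"
        using outer_potential[OF \<delta> True] by (intro mult_left_mono) (auto simp: \<kappa>_def)
      \<comment> \<open>One half of the quadratic excess gives exponential decay in N through
        \<open>s - b \<ge> \<delta>\<close>; the other, with N lowered to 1, keeps the bound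
        integrable in s.\<close>
      moreover have "?N * \<kappa> * \<delta>\<^sup>2 / 2 + \<kappa> / 2 * (s - b)\<^sup>2 \<le> ?N * (\<kappa> * (s - b)\<^sup>2)"
      proof -
        have "\<delta>\<^sup>2 \<le> (s - b)\<^sup>2" using True \<delta> by (intro power_mono) auto
        then have "?N * (\<kappa> / 2) * \<delta>\<^sup>2 \<le> ?N * (\<kappa> / 2) * (s - b)\<^sup>2" using \<kappa>_pos by (intro mult_left_mono) auto
        moreover have "1 * (\<kappa> / 2 * (s - b)\<^sup>2) \<le> ?N * (\<kappa> / 2 * (s - b)\<^sup>2)" using \<kappa>_pos Npos by (intro mult_right_mono) auto
        ultimately show ?thesis by (simp add: field_simps)
      qed
      ultimately have "- (?N * Q s + (\<Sum>k<m. fo \<delta> s (y k))) \<le> u + - (\<kappa> / 2 * (s - b)\<^sup>2)"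
        unfolding u_def distrib_left right_diff_distrib mult.assoc by linarith
      then have "exp (- (?N * Q s + (\<Sum>k<m. fo \<delta> s (y k)))) \<le> exp (u + - (\<kappa> / 2 * (s - b)\<^sup>2))"
        by (simp only: exp_le_cancel_iff)
      then have "pw m y s \<le> exp u * exp (- (\<kappa> / 2 * (s - b)\<^sup>2))"
        using pw_numerator[OF \<delta>, of m y s] unfolding exp_add by linarith
      then show ?thesis using True by simp
    qed (simp add: indicator_def)
    have "(\<integral>\<^sup>+s. ennreal (pw m y s) * indicator {b + \<delta>..} s \<partial>lborel)
        \<le> (\<integral>\<^sup>+s. ennreal (exp u) * ennreal (exp (- (\<kappa> / 2 * (s - b)\<^sup>2))) \<partial>lborel)"
    proof (intro nn_integral_mono)
      fix s
      have "ennreal (pw m y s) * indicator {b + \<delta>..} s = ennreal (pw m y s * indicator {b + \<delta>..} s)"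
        by (auto simp: indicator_def)
      also have "\<dots> \<le> ennreal (exp u * exp (- (\<kappa> / 2 * (s - b)\<^sup>2)))" by (rule ennreal_leI[OF num])
      finally show "ennreal (pw m y s) * indicator {b + \<delta>..} s \<le> ennreal (exp u) * ennreal (exp (- (\<kappa> / 2 * (s - b)\<^sup>2)))"
        by (simp add: ennreal_mult)
    qed
    also have "\<dots> = ennreal (exp u) * ennreal G1"      unfolding G1[symmetric] by (intro nn_integral_cmult) measurable
    finally have up: "(\<integral>\<^sup>+s. ennreal (pw m y s) * indicator {b + \<delta>..} s \<partial>lborel) \<le> ennreal (exp u) * ennreal G1" .
    define v where "v = - (?N * l0) - ?N * \<Lambda>g * \<eta> - \<bar>g 0\<bar> - \<Lambda>g * sqrt (A2 * ?N)"
    have "v \<le> - (?N * (LINT s|R. Q s) + (\<Sum>k<m. g (y k)))"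
    proof -
      have "(\<Sum>k<m. g (y k)) + g s0 \<le> ?N * ((LINT t|\<mu>. g t) + \<Lambda>g * \<eta>)"
        unfolding split[symmetric] using g_lipschitz \<Lambda>g_nonneg by (intro avg) auto
      \<comment> \<open>The removed particle may be far out, but the second moment bound confines it
        to distance of order sqrt N, an error of lower order than N.\<close>
      moreover have "- g s0 \<le> \<bar>g 0\<bar> + \<Lambda>g * sqrt (A2 * ?N)"
      proof -
        have "s0\<^sup>2 \<le> (\<Sum>j<Suc m. (?x j)\<^sup>2)" by (subst split[of "\<lambda>t. t\<^sup>2"]) (simp add: sum_nonneg)
        also have "\<dots> \<le> A2 * ?N" using good_second_moment[OF gd _ e(2)] by simp
        finally have "sqrt (s0\<^sup>2) \<le> sqrt (A2 * ?N)" by (rule real_sqrt_le_mono)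
        then have "\<Lambda>g * \<bar>s0 - 0\<bar> \<le> \<Lambda>g * sqrt (A2 * ?N)" using \<Lambda>g_nonneg by (intro mult_left_mono) auto
        then show ?thesis using g_lipschitz[of s0 0] by linarith
      qed
      moreover have "?N * ((LINT s|R. Q s) + (LINT t|\<mu>. g t)) \<le> ?N * l0"
        using bulk_potential by (intro mult_left_mono) auto
      ultimately show ?thesis unfolding v_def distrib_left mult.assoc by linarith
    qed
    then have "ennreal (exp v) \<le> ennreal (exp (- (?N * (LINT s|R. Q s) + (\<Sum>k<m. g (y k)))))"
      by (intro ennreal_leI) simp
    also have "\<dots> \<le> ennreal (b / r0) * (\<integral>\<^sup>+s. ennreal (pw m y s) \<partial>lborel)" by (rule pw_denominator)
    finally have lo: "ennreal (exp v) \<le> ennreal (b / r0) * (\<integral>\<^sup>+s. ennreal (pw m y s) \<partial>lborel)" .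
    have uv: "u = rate \<delta> \<eta> (Suc m) + v"
      unfolding u_def v_def rate_def \<Lambda>f_def by (simp only: algebra_simps)
    have "ennreal (exp u) * ennreal G1 = ennreal (exp (rate \<delta> \<eta> (Suc m)) * G1) * ennreal (exp v)"
      unfolding uv exp_add using G1_nonneg by (simp add: ennreal_mult mult_ac)
    also have "\<dots> \<le> ennreal (exp (rate \<delta> \<eta> (Suc m)) * G1) * (ennreal (b / r0) * (\<integral>\<^sup>+s. ennreal (pw m y s) \<partial>lborel))"
      by (intro mult_left_mono lo) auto
    also have "\<dots> = ennreal (exp (rate \<delta> \<eta> (Suc m)) * G1 * (b / r0)) * (\<integral>\<^sup>+s. ennreal (pw m y s) \<partial>lborel)"
      using G1_nonneg b_pos r0_pos by (subst ennreal_mult[of _ "b / r0"]) (auto simp: mult.assoc)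
    finally show "(\<integral>\<^sup>+s. ennreal (pw m y s) * indicator {b + \<delta>..} s \<partial>lborel)
        \<le> ennreal (exp (rate \<delta> \<eta> (Suc m)) * G1 * (b / r0)) * (\<integral>\<^sup>+s. ennreal (pw m y s) \<partial>lborel)"
      using up by (rule order_trans[rotated])
  qed
qed

text \<open>By Fubini the last particle is integrated first. Fibres without good points contribute
  nothing, and on the others the ratio bound holds, so the total is at most that ratio times
  \<open>Z\<close>. A transposition carries this over to the i-th particle.\<close>

lemma prob_coordinate_large:
  assumes \<delta>: "0 < \<delta>" and \<eta>: "0 < \<eta>"
  obtains \<epsilon> N0 where "0 < \<epsilon>" "\<epsilon> \<le> 1" "0 < N0"
    "\<And>N i. N0 \<le> N \<Longrightarrow> i < N \<Longrightarrow>
      measure (ensemble h Q N) {x \<in> space (leb N). good \<epsilon> N x \<and> b + \<delta> \<le> x i} \<le> exp (rate \<delta> \<eta> N) * G1 * (b / r0)"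
proof -
  obtain \<epsilon> N0 where e: "0 < \<epsilon>" "\<epsilon> \<le> 1" "0 < N0" and sec: "\<And>m y s0. N0 \<le> Suc m \<Longrightarrow> good \<epsilon> (Suc m) (y(m := s0)) \<Longrightarrow>
      (\<integral>\<^sup>+s. ennreal (pw m y s) * indicator {b + \<delta>..} s \<partial>lborel)
        \<le> ennreal (exp (rate \<delta> \<eta> (Suc m)) * G1 * (b / r0)) * (\<integral>\<^sup>+s. ennreal (pw m y s) \<partial>lborel)"
    using section_bound[OF \<delta> \<eta>] by blast
  show ?thesis
  proof (rule that[OF e])
    fix N i assume N: "N0 \<le> N" and i: "i < N"
    obtain m where m: "N = Suc m" using i by (cases N) auto
    let ?c = "exp (rate \<delta> \<eta> N) * G1 * (b / r0)"
    have c0: "0 \<le> ?c" using G1_nonneg b_pos r0_pos by auto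
    have comp: "(\<lambda>x. x j) \<in> borel_measurable (leb N)" if "j < N" for j
      using measurable_component_singleton[of j "{..<N}" "\<lambda>_. lborel"] that by simp
    let ?A = "\<lambda>j. {x \<in> space (leb N). good \<epsilon> N x \<and> b + \<delta> \<le> x j}"
    have Am: "?A j \<in> sets (leb N)" if "j < N" for j using comp[OF that] by measurable
    have Am': "?A m \<in> sets (leb N)" using m by (intro Am) simp
    have "(\<integral>\<^sup>+x. ennreal (wt N x) * indicator (?A m) x \<partial>leb N)
        = (\<integral>\<^sup>+y. \<integral>\<^sup>+s. ennreal (wt N (y(m := s))) * indicator (?A m) (y(m := s)) \<partial>lborel \<partial>leb m)"
    proof -
      have "(\<lambda>x. ennreal (wt N x) * indicator (?A m) x) \<in> borel_measurable (leb N)"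
        using Am' by (intro borel_measurable_times_ennreal borel_measurable_indicator measurable_compose[OF weight_measurable measurable_ennreal])
      from lborel_product.product_nn_integral_insert[OF _ _ this[unfolded m lessThan_Suc]]
      show ?thesis unfolding m lessThan_Suc by simp
    qed
    also have "\<dots> \<le> (\<integral>\<^sup>+y. \<integral>\<^sup>+s. ennreal ?c * ennreal (wt N (y(m := s))) \<partial>lborel \<partial>leb m)"
    proof (rule nn_integral_mono)
      fix y
      have wl: "ennreal (wt N (y(m := s))) = ennreal (cw m y) * ennreal (pw m y s)" for s
        unfolding m weight_last by (simp add: ennreal_mult cw_nonneg pw_nonneg)
      show "(\<integral>\<^sup>+s. ennreal (wt N (y(m := s))) * indicator (?A m) (y(m := s)) \<partial>lborel)
          \<le> (\<integral>\<^sup>+s. ennreal ?c * ennreal (wt N (y(m := s))) \<partial>lborel)"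
      proof (cases "\<exists>s0. good \<epsilon> N (y(m := s0))")
        case True
        then obtain s0 where s0: "good \<epsilon> (Suc m) (y(m := s0))" by (auto simp: m)
        have "(\<integral>\<^sup>+s. ennreal (wt N (y(m := s))) * indicator (?A m) (y(m := s)) \<partial>lborel)
          \<le> (\<integral>\<^sup>+s. ennreal (cw m y) * (ennreal (pw m y s) * indicator {b + \<delta>..} s) \<partial>lborel)"
          unfolding wl by (intro nn_integral_mono) (auto simp: indicator_def mult.assoc)
        also have "\<dots> = ennreal (cw m y) * (\<integral>\<^sup>+s. ennreal (pw m y s) * indicator {b + \<delta>..} s \<partial>lborel)"
          by (rule nn_integral_cmult) measurable
        also have "\<dots> \<le> ennreal (cw m y) * (ennreal ?c * (\<integral>\<^sup>+s. ennreal (pw m y s) \<partial>lborel))"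
          using sec[OF _ s0] N by (intro mult_left_mono) (auto simp: m)
        also have "\<dots> = ennreal ?c * (ennreal (cw m y) * (\<integral>\<^sup>+s. ennreal (pw m y s) \<partial>lborel))"
          by (rule mult.left_commute)
        also have "ennreal (cw m y) * (\<integral>\<^sup>+s. ennreal (pw m y s) \<partial>lborel) = (\<integral>\<^sup>+s. ennreal (wt N (y(m := s))) \<partial>lborel)"
          unfolding wl by (intro nn_integral_cmult[symmetric]) measurable
        also have "ennreal ?c * \<dots> = (\<integral>\<^sup>+s. ennreal ?c * ennreal (wt N (y(m := s))) \<partial>lborel)"
          unfolding wl by (intro nn_integral_cmult[symmetric]) measurable
        finally show ?thesis .
      next
        case False
        then have "(\<integral>\<^sup>+s. ennreal (wt N (y(m := s))) * indicator (?A m) (y(m := s)) \<partial>lborel) = (\<integral>\<^sup>+s. 0 \<partial>(lborel :: real measure))"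
          by (intro nn_integral_cong) (auto simp: indicator_def)
        then show ?thesis by simp
      qed
    qed
    also have "\<dots> = (\<integral>\<^sup>+x. ennreal ?c * ennreal (wt N x) \<partial>leb N)"
      unfolding m lessThan_Suc
      by (intro lborel_product.product_nn_integral_insert[symmetric])
         (use weight_measurable[of "Suc m"] in \<open>auto simp: lessThan_Suc\<close>)
    also have "\<dots> = ennreal ?c * ennreal (Z N)" by (simp add: nn_integral_cmult nn_integral_weight)
    finally have int: "(\<integral>\<^sup>+x. ennreal (wt N x) * indicator (?A m) x \<partial>leb N) \<le> ennreal ?c * ennreal (Z N)" .
    have "emeasure (ensemble h Q N) (?A m) \<le> (ennreal ?c * ennreal (Z N)) / ennreal (Z N)"
      unfolding emeasure_ensemble[OF Am'] by (rule divide_right_mono_ennreal[OF int])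
    also have "\<dots> = ennreal ?c" using Z_pos[of N] by (intro mult_divide_eq_ennreal) auto
    finally have last: "emeasure (ensemble h Q N) (?A m) \<le> ennreal ?c" .
    define \<pi> where "\<pi> = Transposition.transpose i m"
    have p: "bij_betw \<pi> {..<N} {..<N}"
      unfolding \<pi>_def using i m by (auto simp: bij_betw_def inj_on_def Transposition.transpose_def image_iff)
    let ?T = "\<lambda>x::nat \<Rightarrow> real. \<lambda>j\<in>{..<N}. x (\<pi> j)"
    have pN: "\<pi> j < N" if "j < N" for j using p that by (auto simp: bij_betw_def)
    have T: "?T \<in> measurable (leb N) (leb N)"
      using pN by (intro measurable_restrict measurable_component_singleton) auto
    have sp: "space (ensemble h Q N) = space (leb N)" by (simp add: ensemble_def)
    have "emeasure (ensemble h Q N) (?A m) = emeasure (distr (ensemble h Q N) (leb N) ?T) (?A m)"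
      by (simp only: distr_ensemble_permute[OF p])
    also have "\<dots> = emeasure (ensemble h Q N) (?T -` ?A m \<inter> space (leb N))"
      using T Am' by (subst emeasure_distr) (auto simp: sp measurable_cong_sets[OF sets_ensemble refl])
    also have "?T -` ?A m \<inter> space (leb N) = ?A i"
    proof -
      have iff: "?T x \<in> ?A m \<longleftrightarrow> x \<in> ?A i" if x: "x \<in> space (leb N)" for x
      proof -
        have "?T x \<in> space (leb N)" using measurable_space[OF T x] .
        moreover have "?T x m = x i" using m by (simp add: \<pi>_def)
        moreover have "good \<epsilon> N (?T x) = good \<epsilon> N x" unfolding good_def weight_permute[OF p] ..
        ultimately show ?thesis using x by simp
      qed
      show ?thesis
      proof (rule set_eqI)
        fix x
        have "x \<in> ?T -` ?A m \<inter> space (leb N) \<longleftrightarrow> ?T x \<in> ?A m \<and> x \<in> space (leb N)"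
          by (simp only: Int_iff vimage_eq)
        then show "x \<in> ?T -` ?A m \<inter> space (leb N) \<longleftrightarrow> x \<in> ?A i" using iff[of x] by blast
      qed
    qed
    finally have "emeasure (ensemble h Q N) (?A i) \<le> ennreal ?c" using last by (simp only:)
    then show "measure (ensemble h Q N) (?A i) \<le> ?c"
      unfolding measure_def using c0 by (intro enn2real_leI)
  qed
qed

lemma rate_eventually:
  assumes \<delta>: "0 < \<delta>"
  obtains \<eta> where "0 < \<eta>" "\<forall>\<^sub>F N in sequentially. exp (rate \<delta> \<eta> N) * G1 * (b / r0) \<le> exp (- (\<kappa> * \<delta>\<^sup>2 / 4 * real N))"
proof -
  let ?\<Lambda> = "L + 2 / \<delta> + \<Lambda>g"
  have \<Lambda>: "0 < ?\<Lambda>" using \<delta> L_nonneg \<Lambda>g_nonneg by (simp add: add_nonneg_pos add_pos_nonneg)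
  have kd: "0 < \<kappa> * \<delta>\<^sup>2" using \<kappa>_pos \<delta> by simp
  \<comment> \<open>Of the gain \<open>\<kappa> * \<delta>\<^sup>2 / 2\<close> one eighth of
    \<open>\<kappa> * \<delta>\<^sup>2\<close> goes to the approximation errors and, for large N,
    another to everything sublinear, including the logarithm of the prefactor; a quarter is
    left.\<close>
  define \<eta> where "\<eta> = \<kappa> * \<delta>\<^sup>2 / (8 * ?\<Lambda>)"
  have \<eta>: "0 < \<eta>" using \<Lambda> kd by (simp add: \<eta>_def)
  define D where "D = G1 * (b / r0) + 1"
  have D: "0 < D" unfolding D_def using G1_nonneg b_pos r0_pos by (intro add_nonneg_pos mult_nonneg_nonneg) auto
  have sq: "(\<lambda>N. sqrt (A2 * real N) / real N) \<longlonglongrightarrow> 0"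
  proof -
    have "(\<lambda>N. sqrt (A2 / real N)) \<longlonglongrightarrow> sqrt 0"
      by (intro tendsto_real_sqrt tendsto_divide_0[OF tendsto_const] filterlim_at_top_imp_at_infinity filterlim_real_sequentially)
    moreover have "\<forall>\<^sub>F N in sequentially. sqrt (A2 / real N) = sqrt (A2 * real N) / real N"
      using eventually_gt_at_top[of 0]
    proof eventually_elim
      case (elim N)
      have "A2 / real N = A2 * real N / (real N)\<^sup>2" using elim by (simp add: power2_eq_square)
      then show ?case by (simp add: real_sqrt_divide)
    qed
    ultimately show ?thesis by (simp add: filterlim_cong[OF refl refl])
  qed
  have "(\<lambda>N. (B1 \<delta> + \<bar>g 0\<bar> + ln D) / real N + \<Lambda>g * (sqrt (A2 * real N) / real N)) \<longlonglongrightarrow> 0 + \<Lambda>g * 0"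
    by (intro tendsto_add tendsto_mult tendsto_const sq tendsto_divide_0[OF tendsto_const]
        filterlim_at_top_imp_at_infinity filterlim_real_sequentially)
  then have "\<forall>\<^sub>F N in sequentially. (B1 \<delta> + \<bar>g 0\<bar> + ln D) / real N + \<Lambda>g * (sqrt (A2 * real N) / real N) < \<kappa> * \<delta>\<^sup>2 / 8"
    using kd by (intro order_tendstoD(2)) auto
  then have "\<forall>\<^sub>F N in sequentially. exp (rate \<delta> \<eta> N) * G1 * (b / r0) \<le> exp (- (\<kappa> * \<delta>\<^sup>2 / 4 * real N))"
    using eventually_gt_at_top[of 0]
  proof eventually_elim
    case (elim N)
    have "real N * ((B1 \<delta> + \<bar>g 0\<bar> + ln D) / real N + \<Lambda>g * (sqrt (A2 * real N) / real N)) \<le> real N * (\<kappa> * \<delta>\<^sup>2 / 8)"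
      using elim by (intro mult_left_mono) auto
    moreover have "real N * (X / real N + \<Lambda>g * (Y / real N)) = X + \<Lambda>g * Y" for X Y
      using elim by (simp add: field_simps)
    ultimately have 1: "B1 \<delta> + \<bar>g 0\<bar> + ln D + \<Lambda>g * sqrt (A2 * real N) \<le> real N * (\<kappa> * \<delta>\<^sup>2 / 8)"
      by (simp only:)
    have "?\<Lambda> * \<eta> = \<kappa> * \<delta>\<^sup>2 / 8" using \<Lambda> by (simp add: \<eta>_def field_simps)
    then have 2: "real N * ?\<Lambda> * \<eta> = real N * (\<kappa> * \<delta>\<^sup>2 / 8)" by (simp only: mult.assoc)
    have "rate \<delta> \<eta> N + ln D \<le> - (\<kappa> * \<delta>\<^sup>2 / 4 * real N)"
      using 1 2 unfolding rate_def by (simp add: field_simps)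
    then have "exp (rate \<delta> \<eta> N) * D \<le> exp (- (\<kappa> * \<delta>\<^sup>2 / 4 * real N))"
      using D by (metis exp_add exp_le_cancel_iff exp_ln)
    moreover have "exp (rate \<delta> \<eta> N) * (G1 * (b / r0)) \<le> exp (rate \<delta> \<eta> N) * D"
      by (intro mult_left_mono) (auto simp: D_def)
    ultimately show ?case by (simp only: mult.assoc)
  qed
  then show ?thesis by (rule that[OF \<eta>])
qed

lemma Max_measurable: "(\<lambda>x. Max (x ` {..<N})) \<in> borel_measurable (leb N)"
proof -
  have "(\<lambda>x. x i) \<in> borel_measurable (leb N)" if "i \<in> {..<N}" for i
    using measurable_component_singleton[of i "{..<N}" "\<lambda>_. lborel"] that by simp
  then show ?thesis by (rule borel_measurable_Max[OF finite_lessThan])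
qed

text \<open>A deviation needs a configuration that is not good for one of the two thresholds, or one
  of N coordinates beyond b + \<delta>; the union bound gives the factor N + 2.\<close>

lemma max_deviation:
  assumes \<delta>: "0 < \<delta>"
  shows "\<exists>c>0. \<forall>\<^sub>F N in sequentially.
    measure (ensemble h Q N) {x \<in> space (leb N). \<not> \<bar>Max (x ` {..<N}) - b\<bar> < \<delta>} \<le> (real N + 2) * exp (- (c * real N))"
proof -
  obtain \<epsilon>1 N1 where e1: "0 < \<epsilon>1" "\<epsilon>1 \<le> 1" "0 < N1" and lo: "\<And>N x. N1 \<le> N \<Longrightarrow> good \<epsilon>1 N x \<Longrightarrow> \<exists>i<N. b - \<delta> < x i"
    using max_lower[OF \<delta>] by blast
  obtain \<eta> where \<eta>: "0 < \<eta>" and rate: "\<forall>\<^sub>F N in sequentially. exp (rate \<delta> \<eta> N) * G1 * (b / r0) \<le> exp (- (\<kappa> * \<delta>\<^sup>2 / 4 * real N))"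
    using rate_eventually[OF \<delta>] by blast
  obtain \<epsilon>2 N2 where e2: "0 < \<epsilon>2" "\<epsilon>2 \<le> 1" "0 < N2" and up: "\<And>N i. N2 \<le> N \<Longrightarrow> i < N \<Longrightarrow>
      measure (ensemble h Q N) {x \<in> space (leb N). good \<epsilon>2 N x \<and> b + \<delta> \<le> x i} \<le> exp (rate \<delta> \<eta> N) * G1 * (b / r0)"
    using prob_coordinate_large[OF \<delta> \<eta>] by blast
  define c where "c = min (\<kappa> * \<delta>\<^sup>2 / 4) (min (\<epsilon>1 / 4) (\<epsilon>2 / 4))"
  have c: "0 < c" using \<kappa>_pos \<delta> e1 e2 by (simp add: c_def)
  have "\<forall>\<^sub>F N in sequentially.
    measure (ensemble h Q N) {x \<in> space (leb N). \<not> \<bar>Max (x ` {..<N}) - b\<bar> < \<delta>} \<le> (real N + 2) * exp (- (c * real N))"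
    using rate prob_not_good[OF e1(1)] prob_not_good[OF e2(1)] eventually_ge_at_top[of N1] eventually_ge_at_top[of N2] eventually_gt_at_top[of 0]
  proof eventually_elim
    case (elim N)
    let ?P = "ensemble h Q N"
    interpret P: prob_space ?P by (rule prob_space_ensemble)
    let ?B1 = "{x \<in> space (leb N). \<not> good \<epsilon>1 N x}" and ?B2 = "{x \<in> space (leb N). \<not> good \<epsilon>2 N x}"
    let ?A = "\<lambda>i. {x \<in> space (leb N). good \<epsilon>2 N x \<and> b + \<delta> \<le> x i}"
    have comp: "(\<lambda>x. x j) \<in> borel_measurable (leb N)" if "j < N" for j
      using measurable_component_singleton[of j "{..<N}" "\<lambda>_. lborel"] that by simp
    have Am: "?A j \<in> sets ?P" if "j < N" for j unfolding sets_ensemble using comp[OF that] by measurable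
    have Bm: "?B1 \<in> sets ?P" "?B2 \<in> sets ?P" unfolding sets_ensemble by measurable
    have Um: "(\<Union>i<N. ?A i) \<in> sets ?P" using Am by auto
    have sub: "{x \<in> space (leb N). \<not> \<bar>Max (x ` {..<N}) - b\<bar> < \<delta>} \<subseteq> (?B1 \<union> ?B2) \<union> (\<Union>i<N. ?A i)"
    proof
      fix x assume x: "x \<in> {x \<in> space (leb N). \<not> \<bar>Max (x ` {..<N}) - b\<bar> < \<delta>}"
      show "x \<in> (?B1 \<union> ?B2) \<union> (\<Union>i<N. ?A i)"
      proof (rule ccontr)
        assume n: "x \<notin> (?B1 \<union> ?B2) \<union> (\<Union>i<N. ?A i)"
        then have g: "good \<epsilon>1 N x" "good \<epsilon>2 N x" using x by auto
        have "x i < b + \<delta>" if "i < N" for i using n x g that by (auto simp: not_le)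
        then have "Max (x ` {..<N}) < b + \<delta>" using elim by (subst Max_less_iff) auto
        moreover obtain i where "i < N" "b - \<delta> < x i" using lo[OF _ g(1)] elim by auto
        then have "b - \<delta> < Max (x ` {..<N})" by (subst Max_gr_iff) auto
        ultimately show False using x by auto
      qed
    qed
    have "measure ?P {x \<in> space (leb N). \<not> \<bar>Max (x ` {..<N}) - b\<bar> < \<delta>} \<le> measure ?P ((?B1 \<union> ?B2) \<union> (\<Union>i<N. ?A i))"
      using Bm Um by (intro P.finite_measure_mono sub) auto
    also have "\<dots> \<le> (measure ?P ?B1 + measure ?P ?B2) + (\<Sum>i<N. measure ?P (?A i))"
    proof (rule order_trans[OF measure_Un_le add_mono[OF measure_Un_le]])
      show "measure ?P (\<Union>i<N. ?A i) \<le> (\<Sum>i<N. measure ?P (?A i))"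
        using Am by (intro P.finite_measure_subadditive_finite) auto
    qed (use Bm Um in auto)
    also have "\<dots> \<le> (exp (- (c * real N)) + exp (- (c * real N))) + (\<Sum>i<N. exp (- (c * real N)))"
    proof (intro add_mono sum_mono)
      have le: "exp (- (d * real N)) \<le> exp (- (c * real N))" if "c \<le> d" for d
        using that by (simp add: mult_right_mono)
      show "measure ?P ?B1 \<le> exp (- (c * real N))" by (rule order_trans[OF elim(2) le]) (simp add: c_def)
      show "measure ?P ?B2 \<le> exp (- (c * real N))" by (rule order_trans[OF elim(3) le]) (simp add: c_def)
      fix i assume "i \<in> {..<N}"
      then have "measure ?P (?A i) \<le> exp (- (\<kappa> * \<delta>\<^sup>2 / 4 * real N))" using up[of N i] elim by simp
      also have "\<dots> \<le> exp (- (c * real N))" by (rule le) (simp add: c_def)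
      finally show "measure ?P (?A i) \<le> exp (- (c * real N))" .
    qed
    also have "\<dots> = (real N + 2) * exp (- (c * real N))" by (simp add: algebra_simps)
    finally show ?case .
  qed
  with c show ?thesis by blast
qed

end

section \<open>Almost sure convergence\<close>

lemma real_analytic_deriv:
  assumes "real_analytic f"
  shows "f differentiable (at x)" "real_analytic (deriv f)"
proof -
  \<comment> \<open>The coefficients \<open>diffs c\<close> belong to the term-by-term derivative.
    The expansion stays centred at x while f is differentiated at any y of the disc, so it
    represents \<open>deriv f\<close> on the whole disc.\<close>
  have *: "(f has_field_derivative (\<Sum>n. diffs c n * (y - x) ^ n)) (at y) \<and> (\<lambda>n. diffs c n * (y - x) ^ n) sums (\<Sum>n. diffs c n * (y - x) ^ n)"
    if c: "\<forall>y. \<bar>y - x\<bar> < r \<longrightarrow> (\<lambda>n. c n * (y - x) ^ n) sums f y" and y: "\<bar>y - x\<bar> < r" for x y r c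
  proof -
    have s: "summable (\<lambda>n. c n * z ^ n)" if "norm z < r" for z
      using c[rule_format, of "x + z"] that by (auto simp: sums_iff)
    have 1: "((\<lambda>z. \<Sum>n. c n * z ^ n) has_field_derivative (\<Sum>n. diffs c n * (y - x) ^ n)) (at (y - x))"
      by (rule termdiffs_strong'[of r]) (use s y in auto)
    have d: "((\<lambda>y. y - x) has_field_derivative 1) (at y)" by (auto intro!: derivative_eq_intros)
    have 2: "((\<lambda>y. \<Sum>n. c n * (y - x) ^ n) has_field_derivative (\<Sum>n. diffs c n * (y - x) ^ n)) (at y)"
      using DERIV_chain2[where f="\<lambda>z. \<Sum>n. c n * z ^ n" and g="\<lambda>y. y - x" and Db=1 and x=y and s=UNIV, OF 1 d] by simp
    have "(f has_field_derivative (\<Sum>n. diffs c n * (y - x) ^ n)) (at y)"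
    proof (rule has_field_derivative_transform_within_open[OF 2])
      show "open {y. \<bar>y - x\<bar> < r}" by (intro open_Collect_less continuous_intros)
      show "(\<Sum>n. c n * (z - x) ^ n) = f z" if "z \<in> {y. \<bar>y - x\<bar> < r}" for z
        using c that by (auto simp: sums_iff)
    qed (use y in auto)
    moreover have "summable (\<lambda>n. diffs c n * (y - x) ^ n)"
      by (rule termdiff_converges[of _ r]) (use s y in auto)
    ultimately show ?thesis by (simp add: summable_sums)
  qed
  show "f differentiable (at x)"
  proof -
    obtain r c where "0 < r" and c: "\<forall>y. \<bar>y - x\<bar> < r \<longrightarrow> (\<lambda>n. c n * (y - x) ^ n) sums f y"
      using assms unfolding real_analytic_def by blast
    then show ?thesis using *[OF c, of x] by (auto simp: real_differentiable_def)
  qed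
  show "real_analytic (deriv f)"
    unfolding real_analytic_def
  proof
    fix x
    obtain r c where r: "0 < r" and c: "\<forall>y. \<bar>y - x\<bar> < r \<longrightarrow> (\<lambda>n. c n * (y - x) ^ n) sums f y"
      using assms unfolding real_analytic_def by blast
    have "\<forall>y. \<bar>y - x\<bar> < r \<longrightarrow> (\<lambda>n. diffs c n * (y - x) ^ n) sums deriv f y"
    proof (intro allI impI)
      fix y assume "\<bar>y - x\<bar> < r"
      from *[OF c this] show "(\<lambda>n. diffs c n * (y - x) ^ n) sums deriv f y"
        using DERIV_imp_deriv by metis
    qed
    then show "\<exists>r>0. \<exists>a. \<forall>y. \<bar>y - x\<bar> < r \<longrightarrow> (\<lambda>n. a n * (y - x) ^ n) sums deriv f y" using r by blast
  qed
qed

lemma strictly_convex_imp_convex_on: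
  assumes "strictly_convex f"
  shows "convex_on UNIV f"
proof (rule convex_onI)
  fix t x y :: real assume t: "0 < t" "t < 1"
  show "f ((1 - t) *\<^sub>R x + t *\<^sub>R y) \<le> (1 - t) * f x + t * f y"
  proof (cases "x = y")
    case False
    then show ?thesis using assms t unfolding strictly_convex_def by (auto intro: less_imp_le)
  qed (simp add: algebra_simps)
qed auto

lemma convex_deriv2_nonneg:
  fixes f :: "real \<Rightarrow> real"
  assumes c: "convex_on UNIV f" and d: "\<And>x. (f has_real_derivative f' x) (at x)"
    and d2: "(f' has_real_derivative D) (at x)"
  shows "0 \<le> D"
proof -
  have tangent: "f' c * (y - c) \<le> f y - f c" for c y
    by (rule convex_on_imp_above_tangent[OF c]) (use d in auto)
  have mono: "f' s \<le> f' t" if "s \<le> t" for s t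
  proof (cases "s = t")
    case False
    have "f' s * (t - s) \<le> f' t * (t - s)" using tangent[of s t] tangent[of t s] by (simp add: algebra_simps)
    then show ?thesis using that False by (simp add: mult_le_cancel_right)
  qed simp
  show ?thesis
    by (rule mono_on_imp_deriv_nonneg[OF _ d2, of UNIV]) (auto simp: mono_on_def mono)
qed

text \<open>\<open>Q t - alpha Q / 2 * t\<^sup>2\<close> is convex, and its midpoint inequality is
  the claim. Convexity of Q bounds the second derivative below, so the real infimum
  \<open>alpha Q\<close> is a genuine lower bound.\<close>

lemma alpha_midpoint:
  assumes "real_analytic Q" "strictly_convex Q"
  shows "Q ((x + y) / 2) \<le> (Q x + Q y) / 2 - alpha Q / 8 * (x - y)\<^sup>2"
proof -
  have d1: "(Q has_real_derivative deriv Q t) (at t)" for t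
    using real_analytic_deriv(1)[OF assms(1)] by (simp add: DERIV_deriv_iff_real_differentiable)
  have d2: "(deriv Q has_real_derivative deriv (deriv Q) t) (at t)" for t
    using real_analytic_deriv(1)[OF real_analytic_deriv(2)[OF assms(1)]] by (simp add: DERIV_deriv_iff_real_differentiable)
  have "0 \<le> deriv (deriv Q) t" for t
    by (rule convex_deriv2_nonneg[OF strictly_convex_imp_convex_on[OF assms(2)] d1 d2])
  then have al: "alpha Q \<le> deriv (deriv Q) t" for t
    unfolding alpha_def by (intro cINF_lower bdd_belowI[of _ 0]) auto
  define G where "G t = Q t - alpha Q / 2 * t\<^sup>2" for t
  have "convex_on UNIV G"
  proof (rule f''_ge0_imp_convex[where f' = "\<lambda>t. deriv Q t - alpha Q * t" and f'' = "\<lambda>t. deriv (deriv Q) t - alpha Q"])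
    fix t :: real
    show "(G has_real_derivative deriv Q t - alpha Q * t) (at t)"
      unfolding G_def by (auto intro!: derivative_eq_intros d1)
    show "((\<lambda>t. deriv Q t - alpha Q * t) has_real_derivative deriv (deriv Q) t - alpha Q) (at t)"
      by (auto intro!: derivative_eq_intros d2)
    show "0 \<le> deriv (deriv Q) t - alpha Q" using al by simp
  qed auto
  from convex_onD[OF this, of "1/2" x y]
  have "G ((x + y) / 2) \<le> (G x + G y) / 2" by (simp add: add_divide_distrib algebra_simps)
  then show ?thesis unfolding G_def by (simp add: power2_eq_square field_simps)
qed

lemma bounded_deriv_lipschitz:
  fixes f :: "real \<Rightarrow> real"
  assumes "\<And>x. f differentiable (at x)" "\<And>x. \<bar>deriv f x\<bar> \<le> L"
  shows "\<bar>f x - f y\<bar> \<le> L * \<bar>x - y\<bar>"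
proof -
  have "norm (f x - f y) \<le> L * norm (x - y)"
    by (rule field_differentiable_bound[of UNIV f "deriv f"])
       (use assms in \<open>auto simp: DERIV_deriv_iff_real_differentiable\<close>)
  then show ?thesis by simp
qed

text \<open>The mean value inequality twice: the increment \<open>f p - f (p - v)\<close>, as a
  function of p, has derivative at most \<open>M * \<bar>v\<bar>\<close>.\<close>

lemma bounded_deriv2_second_difference:
  fixes f :: "real \<Rightarrow> real"
  assumes "\<And>x. f differentiable (at x)" "\<And>x. deriv f differentiable (at x)" "\<And>x. \<bar>deriv (deriv f) x\<bar> \<le> M"
  shows "\<bar>f p - f (p - v) - f (p + u) + f (p + u - v)\<bar> \<le> M * \<bar>u\<bar> * \<bar>v\<bar>"
proof -
  define F where "F p = f p - f (p - v)" for p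
  have d: "(f has_real_derivative deriv f x) (at x)" for x
    using assms(1) by (simp add: DERIV_deriv_iff_real_differentiable)
  have "(F has_real_derivative deriv f x - deriv f (x - v)) (at x)" for x
  proof -
    have "((\<lambda>x. f (x - v)) has_real_derivative deriv f (x - v) * 1) (at x)"
      by (rule DERIV_chain2[OF d]) (auto intro!: derivative_eq_intros)
    then show ?thesis unfolding F_def by (auto intro!: derivative_eq_intros d)
  qed
  moreover have "\<bar>deriv f x - deriv f (x - v)\<bar> \<le> M * \<bar>v\<bar>" for x
    using bounded_deriv_lipschitz[of "deriv f" M x "x - v"] assms by simp
  ultimately have "norm (F p - F (p + u)) \<le> (M * \<bar>v\<bar>) * norm (p - (p + u))"
    by (intro field_differentiable_bound[of UNIV F "\<lambda>x. deriv f x - deriv f (x - v)"]) auto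
  then show ?thesis by (simp add: F_def algebra_simps)
qed

text \<open>The Schwartz bounds without polynomial factor, for the derivatives of order 0, 1 and 2,
  give B, L and M. They depend on h alone, so the threshold \<open>4 * M\<close> is fixed before
  Q.\<close>

lemma convex_ensemble_exists_bounds:
  assumes h: "even_function h" "schwartz_function h"
  obtains B L M where "0 \<le> M" "\<And>Q. real_analytic Q \<Longrightarrow> strictly_convex Q \<Longrightarrow> even_function Q \<Longrightarrow> 4 * M < alpha Q \<Longrightarrow>
    convex_ensemble h Q B L M (alpha Q)"
proof -
  have diff: "(deriv ^^ n) h differentiable (at x)" for n x using h(2) by (simp add: schwartz_function_def)
  have "bounded (range (\<lambda>x. x ^ 0 * (deriv ^^ n) h x))" for n using h(2) unfolding schwartz_function_def by blast
  then have "\<exists>D. \<forall>x. \<bar>(deriv ^^ n) h x\<bar> \<le> D" for n by (auto simp: bounded_iff)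
  then obtain D where D: "\<And>n x. \<bar>(deriv ^^ n) h x\<bar> \<le> D n" by metis
  have d0: "h differentiable (at x)" and d1: "deriv h differentiable (at x)" for x
    using diff[of 0 x] diff[of 1 x] by simp_all
  have b0: "\<bar>h x\<bar> \<le> D 0" and b1: "\<bar>deriv h x\<bar> \<le> D 1" and b2: "\<bar>deriv (deriv h) x\<bar> \<le> D 2" for x
    using D[of 0 x] D[of 1 x] D[of 2 x] by (simp_all add: numeral_2_eq_2)
  show ?thesis
  proof (rule that)
    show M0: "0 \<le> D 2" using b2[of 0] by linarith
    fix Q assume Q: "real_analytic Q" "strictly_convex Q" "even_function Q" "4 * D 2 < alpha Q"
    show "convex_ensemble h Q (D 0) (D 1) (D 2) (alpha Q)"
    proof
      show "h (- x) = h x" "Q (- x) = Q x" for x using h(1) Q(3) by (auto simp: even_function_def)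
      show "\<bar>h x - h y\<bar> \<le> D 1 * \<bar>x - y\<bar>" for x y by (rule bounded_deriv_lipschitz[OF d0 b1])
      show "\<bar>h p - h (p - v) - h (p + u) + h (p + u - v)\<bar> \<le> D 2 * \<bar>u\<bar> * \<bar>v\<bar>" for p u v
        by (rule bounded_deriv2_second_difference[OF d0 d1 b2])
      show "continuous_on UNIV Q"
        using real_analytic_deriv(1)[OF Q(1)]
        by (intro continuous_at_imp_continuous_on ballI differentiable_imp_continuous_within)
      show "Q ((x + y) / 2) \<le> (Q x + Q y) / 2 - alpha Q / 8 * (x - y)\<^sup>2" for x y
        by (rule alpha_midpoint[OF Q(1,2)])
    qed (use M0 Q(4) b0 in auto)
  qed
qed

text \<open>The case k = 1 already determines the measure: testing with cosines and sines gives its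
  characteristic function.\<close>

lemma limiting_measure_unique:
  assumes "limiting_measure h Q \<mu>" "limiting_measure h Q \<nu>"
  shows "\<nu> = \<mu>"
proof -
  have rd: "real_distribution \<mu>" "real_distribution \<nu>" using assms by (auto simp: limiting_measure_def)
  have eq: "(LINT x|\<nu>. f x) = (LINT x|\<mu>. f x)"
    if f: "continuous_on UNIV f" and bd: "\<And>x. \<bar>f x\<bar> \<le> 1" for f :: "real \<Rightarrow> real"
  proof -
    have lim: "(\<lambda>N. LINT x|correlation_measure h Q N 1. f (x 0)) \<longlonglongrightarrow> (LINT x|\<xi>. f x)"
      if \<xi>: "limiting_measure h Q \<xi>" for \<xi>
    proof -
      have "real_distribution \<xi>" using \<xi> by (simp add: limiting_measure_def)
      then interpret x: real_distribution \<xi> .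
      let ?P = "\<Pi>\<^sub>M i\<in>{..<1::nat}. \<xi>"
      have "continuous_on UNIV (\<lambda>x::nat \<Rightarrow> real. f (x 0))"
        by (rule continuous_on_compose2[OF f continuous_on_product_coordinates]) auto
      then have "continuous_on (space ?P) (\<lambda>x. f (x 0))" by (rule continuous_on_subset) auto
      moreover have "bounded ((\<lambda>x. f (x 0)) ` space ?P)" using bd by (auto simp: bounded_iff)
      ultimately have "(\<lambda>N. LINT x|correlation_measure h Q N 1. f (x 0)) \<longlonglongrightarrow> (LINT x|?P. f (x 0))"
        using \<xi> unfolding limiting_measure_def converges_weakly_def by blast
      also have "(LINT x|?P. f (x 0)) = (LINT x|distr ?P \<xi> (\<lambda>x. x 0). f x)"
        using borel_measurable_continuous_onI[OF f] by (subst integral_distr) auto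
      also have "distr ?P \<xi> (\<lambda>x. x 0) = \<xi>" by (intro distr_PiM_component x.prob_space_axioms) auto
      finally show ?thesis .
    qed
    show ?thesis by (rule LIMSEQ_unique[OF lim[OF assms(2)] lim[OF assms(1)]])
  qed
  have ch: "Re (char \<xi> t) = (LINT x|\<xi>. cos (t * x))" "Im (char \<xi> t) = (LINT x|\<xi>. sin (t * x))"
    if "real_distribution \<xi>" for \<xi> t
  proof -
    interpret real_distribution \<xi> by fact
    have i: "integrable \<xi> (\<lambda>x. iexp (t * x))" by (intro integrable_iexp) auto
    show "Re (char \<xi> t) = (LINT x|\<xi>. cos (t * x))" "Im (char \<xi> t) = (LINT x|\<xi>. sin (t * x))"
      unfolding char_def using integral_Re[OF i] integral_Im[OF i] by (simp_all add: Re_exp Im_exp)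
  qed
  have "char \<nu> = char \<mu>"
  proof
    fix t
    have "(LINT x|\<nu>. cos (t * x)) = (LINT x|\<mu>. cos (t * x))" "(LINT x|\<nu>. sin (t * x)) = (LINT x|\<mu>. sin (t * x))"
      by (intro eq continuous_intros; simp)+
    then show "char \<nu> t = char \<mu> t" by (simp add: complex_eq_iff ch rd)
  qed
  then show ?thesis by (rule Levy_uniqueness[OF rd(2,1)])
qed

lemma summable_linear_exp:
  assumes "0 < c"
  shows "summable (\<lambda>N. (real N + 2) * exp (- (c * real N)))"
proof (rule summable_comparison_test)
  show "summable (\<lambda>N. (2 / c + 2) * exp (- (c / 2)) ^ N)"
    using assms by (intro summable_mult summable_geometric) auto
  have "norm ((real N + 2) * exp (- (c * real N))) \<le> (2 / c + 2) * exp (- (c / 2)) ^ N" for N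
  proof -
    have "c / 2 * real N \<le> exp (c / 2 * real N)" using exp_ge_add_one_self[of "c / 2 * real N"] by linarith
    then have "real N \<le> 2 / c * exp (c / 2 * real N)" using assms by (simp add: field_simps)
    moreover have "1 \<le> exp (c / 2 * real N)" using assms by simp
    ultimately have "real N + 2 \<le> (2 / c + 2) * exp (c / 2 * real N)" unfolding distrib_right by linarith
    then have "(real N + 2) * exp (- (c * real N)) \<le> (2 / c + 2) * exp (c / 2 * real N) * exp (- (c * real N))"
      by (intro mult_right_mono) auto
    also have "\<dots> = (2 / c + 2) * exp (- (c / 2 * real N))" by (simp add: mult.assoc flip: exp_add)
    also have "exp (- (c / 2 * real N)) = exp (- (c / 2)) ^ N" by (simp add: exp_of_nat_mult[symmetric] mult.commute)
    finally show ?thesis by simp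
  qed
  then show "\<exists>n0. \<forall>N\<ge>n0. norm ((real N + 2) * exp (- (c * real N))) \<le> (2 / c + 2) * exp (- (c / 2)) ^ N" by blast
qed

section \<open>The Borel-Cantelli argument\<close>

context convex_ensemble begin

theorem max_converges_almost_surely:
  "\<P>(x in (\<Pi>\<^sub>M N\<in>{1..}. ensemble h Q N). (\<lambda>N. Max (x N ` {..<N})) \<longlonglongrightarrow> b) = 1"
proof -
  let ?P = "\<Pi>\<^sub>M N\<in>{1..}. ensemble h Q N"
  let ?f = "\<lambda>N x. Max (x N ` {..<N})"
  interpret P: prob_space ?P by (intro prob_space_PiM prob_space_ensemble)
  have fm[measurable]: "?f N \<in> borel_measurable ?P" for N
  \<comment> \<open>The index 0 is not a coordinate of the product, but there \<open>Max\<close> is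
    taken of the empty set and is constant.\<close>
  proof (cases "N = 0")
    case False
    then have "(\<lambda>x. x N) \<in> measurable ?P (ensemble h Q N)" by (intro measurable_component_singleton) auto
    moreover have "(\<lambda>y. Max (y ` {..<N})) \<in> borel_measurable (ensemble h Q N)"
      using Max_measurable[of N] by (simp only: measurable_cong_sets[OF sets_ensemble refl])
    ultimately show ?thesis by (rule measurable_compose)
  qed simp
  have AE_ev: "AE x in ?P. \<forall>\<^sub>F N in sequentially. \<bar>?f N x - b\<bar> < \<delta>" if \<delta>: "0 < \<delta>" for \<delta>
  proof -
    let ?A = "\<lambda>N. {x \<in> space ?P. \<not> \<bar>?f N x - b\<bar> < \<delta>}"
    have Am: "?A N \<in> sets ?P" for N by measurable
    obtain c where c: "0 < c" and ev: "\<forall>\<^sub>F N in sequentially.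
      measure (ensemble h Q N) {x \<in> space (leb N). \<not> \<bar>Max (x ` {..<N}) - b\<bar> < \<delta>} \<le> (real N + 2) * exp (- (c * real N))"
      using max_deviation[OF \<delta>] by blast
    have "\<forall>\<^sub>F N in sequentially. norm (measure ?P (?A N)) \<le> (real N + 2) * exp (- (c * real N))"
      using ev eventually_gt_at_top[of 0]
    proof eventually_elim
      case (elim N)
      let ?B = "{x \<in> space (leb N). \<not> \<bar>Max (x ` {..<N}) - b\<bar> < \<delta>}"
      have m: "(\<lambda>x. x N) \<in> measurable ?P (ensemble h Q N)" using elim by (intro measurable_component_singleton) auto
      have B: "?B \<in> sets (ensemble h Q N)"
        unfolding sets_ensemble using Max_measurable[of N] by measurable
      have sp: "space (ensemble h Q N) = space (leb N)" by (simp add: ensemble_def)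
      have "measure (ensemble h Q N) ?B = measure (distr ?P (ensemble h Q N) (\<lambda>x. x N)) ?B"
        using elim by (subst distr_PiM_component) (auto intro: prob_space_ensemble)
      also have "\<dots> = measure ?P ((\<lambda>x. x N) -` ?B \<inter> space ?P)" by (rule measure_distr[OF m B])
      also have "(\<lambda>x. x N) -` ?B \<inter> space ?P = ?A N"
        using measurable_space[OF m] sp by auto
      finally show ?case using elim by simp
    qed
    then have "summable (\<lambda>N. measure ?P (?A N))"
      using summable_linear_exp[OF c] by (rule summable_comparison_test_ev)
    then have "AE x in ?P. \<forall>\<^sub>F N in sequentially. x \<in> space ?P - ?A N"
      by (intro borel_cantelli_AE1 Am) (simp_all only: P.emeasure_eq_measure ennreal_less_top infinity_ennreal_def)
    then show ?thesis by eventually_elim (auto elim: eventually_mono)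
  qed
  have "AE x in ?P. \<forall>k::nat. \<forall>\<^sub>F N in sequentially. \<bar>?f N x - b\<bar> < 1 / Suc k"
    unfolding AE_all_countable by (intro allI AE_ev) simp
  then have AE_lim: "AE x in ?P. (\<lambda>N. ?f N x) \<longlonglongrightarrow> b"
  proof eventually_elim
    case (elim x)
    show ?case
    proof (rule tendstoI)
      fix e :: real assume "0 < e"
      then obtain k where k: "1 / Suc k < e" using nat_approx_posE by metis
      show "\<forall>\<^sub>F N in sequentially. dist (?f N x) b < e"
        using elim[rule_format, of k] by (rule eventually_mono) (use k in \<open>auto simp: dist_real_def\<close>)
    qed
  qed
  \<comment> \<open>The probability of the event is 1 only if the event is measurable; countable
    quantifiers make this evident.\<close>
  have eq: "(\<lambda>N. ?f N x) \<longlonglongrightarrow> b \<longleftrightarrow> (\<forall>k::nat. \<exists>n0::nat. \<forall>N\<ge>n0. \<bar>?f N x - b\<bar> < 1 / Suc k)" for x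
  proof
    assume l: "(\<lambda>N. ?f N x) \<longlonglongrightarrow> b"
    show "\<forall>k::nat. \<exists>n0::nat. \<forall>N\<ge>n0. \<bar>?f N x - b\<bar> < 1 / Suc k"
    proof
      fix k
      show "\<exists>n0::nat. \<forall>N\<ge>n0. \<bar>?f N x - b\<bar> < 1 / Suc k"
        using LIMSEQ_D[OF l, of "1 / Suc k"] by simp
    qed
  next
    assume r: "\<forall>k::nat. \<exists>n0::nat. \<forall>N\<ge>n0. \<bar>?f N x - b\<bar> < 1 / Suc k"
    show "(\<lambda>N. ?f N x) \<longlonglongrightarrow> b"
    proof (rule LIMSEQ_I)
      fix e :: real assume "0 < e"
      then obtain k where k: "1 / Suc k < e" using nat_approx_posE by metis
      then show "\<exists>no. \<forall>n\<ge>no. norm (?f n x - b) < e" using r[rule_format, of k] by force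
    qed
  qed
  have "{x \<in> space ?P. (\<lambda>N. ?f N x) \<longlonglongrightarrow> b} \<in> sets ?P" unfolding eq by measurable
  then show ?thesis using AE_lim by (subst P.prob_Collect_eq_1) auto
qed

end

theorem corollary11:
  fixes h :: "real \<Rightarrow> real"
  assumes "real_analytic h" and "even_function h" and "schwartz_function h"
    and "exponentially_decaying (fourier_transform h)"
  shows "\<exists>\<alpha>h\<ge>0. \<forall>Q :: real \<Rightarrow> real.
    real_analytic Q \<and> strictly_convex Q \<and> even_function Q \<and> alpha Q > \<alpha>h \<longrightarrow>
    (\<exists>\<mu>. limiting_measure h Q \<mu> \<and>
         (\<forall>\<nu>. limiting_measure h Q \<nu> \<longrightarrow> \<nu> = \<mu>) \<and>
         even_measure \<mu> \<and>
         equilibrium_measure (external_field h Q \<mu>) \<mu> \<and>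
         (\<exists>b>0. measure_support \<mu> = {-b..b}) \<and>
         \<P>(x in (\<Pi>\<^sub>M N\<in>{1..}. ensemble h Q N).
            (\<lambda>N. Max (x N ` {..<N})) \<longlonglongrightarrow> Sup (measure_support \<mu>)) = 1)"
proof -
  obtain B L M where M: "0 \<le> M" and ce: "\<And>Q. real_analytic Q \<Longrightarrow> strictly_convex Q \<Longrightarrow> even_function Q \<Longrightarrow> 4 * M < alpha Q \<Longrightarrow>
    convex_ensemble h Q B L M (alpha Q)"
    by (rule convex_ensemble_exists_bounds[OF assms(2,3)]) (rule that)
  show ?thesis
  proof (intro exI[of _ "4 * M"] conjI allI impI)
    fix Q assume Q: "real_analytic Q \<and> strictly_convex Q \<and> even_function Q \<and> alpha Q > 4 * M"
    interpret convex_ensemble h Q B L M "alpha Q" using Q by (intro ce) auto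
    show "\<exists>\<mu>. limiting_measure h Q \<mu> \<and>
         (\<forall>\<nu>. limiting_measure h Q \<nu> \<longrightarrow> \<nu> = \<mu>) \<and>
         even_measure \<mu> \<and>
         equilibrium_measure (external_field h Q \<mu>) \<mu> \<and>
         (\<exists>b>0. measure_support \<mu> = {-b..b}) \<and>
         \<P>(x in (\<Pi>\<^sub>M N\<in>{1..}. ensemble h Q N).
            (\<lambda>N. Max (x N ` {..<N})) \<longlonglongrightarrow> Sup (measure_support \<mu>)) = 1"
    proof (intro exI[of _ \<mu>] conjI allI impI)
      show "limiting_measure h Q \<mu>" by (rule limiting_measure_\<mu>)
      then show "\<nu> = \<mu>" if "limiting_measure h Q \<nu>" for \<nu> using that by (rule limiting_measure_unique)
      show "even_measure \<mu>" unfolding even_measure_def by (rule \<mu>_even)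
      show "equilibrium_measure V \<mu>" by (rule equilibrium_\<mu>)
      show "\<exists>b>0. S = {-b..b}" using b_pos support_interval by blast
      show "\<P>(x in (\<Pi>\<^sub>M N\<in>{1..}. ensemble h Q N). (\<lambda>N. Max (x N ` {..<N})) \<longlonglongrightarrow> Sup S) = 1"
        using max_converges_almost_surely by (simp only: b_def)
    qed
  qed (use M in auto)
qed

end
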